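(* Let $(X,\mathcal W)$ be a balayage space such that the constant function $1$ is harmonic. For all subsets $A,B$ of $X$ the following holds: 1. $A$ is unavoidable or $\inf_{x\in X}R_1^A(x)=0$. 2. If $A$ is unavoidable, $\kappa>0$, and $R_1^B\ge\kappa$ on $A$, then $B$ is unavoidable. 3. Suppose that $(X,\mathcal W)$ has the Liouville property, that is, every bounded harmonic function on $X$ is constant. Then (a) $A$ is avoidable if and only if $\hat R_1^A$ is a potential, (b) $A\cup B$ is avoidable if and only if $A$ and $B$ are avoidable.
   Context: Balayage spaces. Let $X$ be a locally compact space with countable base and $\mathcal C(X)$ the set of continuous real functions on $X$. Let $\mathcal W$ be a convex cone of positive ($\ge0$) lower semicontinuous numerical (i.e. extended real valued) functions on $X$. The fine topology is the coarsest topology on $X$ which is at least as fine as the initial topology and for which all functions in $\mathcal W$ are continuous; for $v\colon X\to[0,\infty]$, $\hat v^f$ denotes the largest finely lower semicontinuous minorant of $v$. $(X,\mathcal W)$ is a balayage space if: (B1) $\sup v_n\in\mathcal W$ for every increasing sequence $(v_n)$ in $\mathcal W$; (B2) $\widehat{\inf\mathcal V}^f\in\mathcal W$ for every subset $\mathcal V$ of $\mathcal W$; (B3) if $u,v',v''\in\mathcal W$ with $u\le v'+v''$, there exist $u',u''\in\mathcal W$ with $u=u'+u''$, $u'\le v'$, $u''\le v''$; (B4) (i) for all $x\ne y$ in $X$ and $\lambda\in[0,\infty)$ there is $v\in\mathcal W$ with $v(x)\ne\lambda v(y)$, (ii) $w=\sup\{v\in\mathcal W\cap\mathcal C(X)\colon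 v\le w\}$ for every $w\in\mathcal W$, (iii) there are strictly positive $u,v\in\mathcal W\cap\mathcal C(X)$ with $u/v\to0$ at infinity. For $A\subset X$ and $u\in\mathcal W$, $R_u^A:=\inf\{v\in\mathcal W\colon v\ge u\text{ on }A\}$ and $\hat R_u^A(x):=\liminf_{y\to x}R_u^A(y)$. For $x\in X$ and $A\subset X$, $\varepsilon_x^A$ is the unique measure on $X$ with $\int u\,d\varepsilon_x^A=R_u^A(x)$ for every $u\in\mathcal W$. A function $h$ is harmonic on an open set $O\subset X$ if it is finite and continuous on $O$ and $\int h\,d\varepsilon_x^{X\setminus V}=h(x)$ for every relatively compact open $V$ with $\overline V\subset O$ and every $x\in V$; harmonic means harmonic on $X$. (If $1$ is harmonic, then $1\in\mathcal W$.) A function $p\in\mathcal W$ is a potential if it is superharmonic (for every relatively compact open $V$, the function $x\mapsto\int p\,d\varepsilon_x^{X\setminus V}$ is finite and continuous on $V$) and $0$ is the only harmonic function $h$ with $0\le h\le p$. A set $A\subset X$ is unavoidable if $R_1^A=1$, equivalently $\|\varepsilon_x^A\|=1$ for every $x\in X$ ($\|\cdot\|$ denoting total mass); it is avoidable if $R_1^A$ is not identically $1$. *)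

theory Defs
  imports "HOL-Analysis.Analysis"
begin

text \<open>
  Positive numerical functions are functions into \<^typ>\<open>ennreal\<close>, so that
  \<open>0 * \<infinity> = 0\<close>, and infima and suprema of families of functions are pointwise.
  Locally compact spaces are Hausdorff.
\<close>

definition lower_semicontinuous :: "'a topology \<Rightarrow> ('a \<Rightarrow> ennreal) \<Rightarrow> bool" where
  "lower_semicontinuous T f \<longleftrightarrow> (\<forall>a. openin T {x \<in> topspace T. a < f x})"

definition convex_cone :: "('a \<Rightarrow> ennreal) set \<Rightarrow> bool" where
  "convex_cone W \<longleftrightarrow>
     (\<forall>u\<in>W. \<forall>v\<in>W. (\<lambda>x. u x + v x) \<in> W) \<and>
     (\<forall>u\<in>W. \<forall>c::real. c \<ge> 0 \<longrightarrow> (\<lambda>x. ennreal c * u x) \<in> W)"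

text \<open>The functions in \<open>\<W> \<inter> \<C>(X)\<close>; these are real valued.\<close>

definition continuous_real_part ::
    "('a::topological_space \<Rightarrow> ennreal) set \<Rightarrow> ('a \<Rightarrow> ennreal) set" where
  "continuous_real_part W = {u \<in> W. continuous_on UNIV u \<and> (\<forall>x. u x < \<infinity>)}"

definition vanishes_at_infinity :: "('a::topological_space \<Rightarrow> ennreal) \<Rightarrow> bool" where
  "vanishes_at_infinity f \<longleftrightarrow> (\<forall>e>0. \<exists>K. compact K \<and> (\<forall>x. x \<notin> K \<longrightarrow> f x < e))"

definition fine_topology :: "('a::topological_space \<Rightarrow> ennreal) set \<Rightarrow> 'a topology" where
  "fine_topology W =
     topology_generated_by ({U. open U} \<union> {u -` S | u S. u \<in> W \<and> open S})"

text \<open>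
  The largest finely lower semicontinuous minorant; it exists because pointwise suprema of
  lower semicontinuous functions are lower semicontinuous.
\<close>

definition fine_lsc_regularization ::
    "('a::topological_space \<Rightarrow> ennreal) set \<Rightarrow> ('a \<Rightarrow> ennreal) \<Rightarrow> 'a \<Rightarrow> ennreal" where
  "fine_lsc_regularization W v =
     Sup {g. lower_semicontinuous (fine_topology W) g \<and> g \<le> v}"

locale balayage_space =
  fixes W :: "('a::{t2_space, second_countable_topology} \<Rightarrow> ennreal) set"
  assumes locally_compact: "locally_compact_space (euclidean :: 'a topology)"
    and cone: "convex_cone W"
    and lsc: "\<And>w. w \<in> W \<Longrightarrow> lower_semicontinuous euclidean w"
    and B1: "\<And>v :: nat \<Rightarrow> 'a \<Rightarrow> ennreal. incseq v \<Longrightarrow> range v \<subseteq> W \<Longrightarrow> (SUP n. v n) \<in> W"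
    and B2: "\<And>V. V \<subseteq> W \<Longrightarrow> fine_lsc_regularization W (Inf V) \<in> W"
    and B3: "\<And>u v' v''. \<lbrakk>u \<in> W; v' \<in> W; v'' \<in> W; \<And>x. u x \<le> v' x + v'' x\<rbrakk> \<Longrightarrow>
      \<exists>u'\<in>W. \<exists>u''\<in>W. (\<forall>x. u x = u' x + u'' x) \<and> u' \<le> v' \<and> u'' \<le> v''"
    and B4_i: "\<And>x y (c::real). x \<noteq> y \<Longrightarrow> c \<ge> 0 \<Longrightarrow> \<exists>v\<in>W. v x \<noteq> ennreal c * v y"
    and B4_ii: "\<And>w. w \<in> W \<Longrightarrow> w = Sup {v \<in> continuous_real_part W. v \<le> w}"
    and B4_iii: "\<exists>u\<in>continuous_real_part W. \<exists>v\<in>continuous_real_part W.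
      (\<forall>x. 0 < u x) \<and> (\<forall>x. 0 < v x) \<and> vanishes_at_infinity (\<lambda>x. u x / v x)"

definition reduced ::
    "('a \<Rightarrow> ennreal) set \<Rightarrow> ('a \<Rightarrow> ennreal) \<Rightarrow> 'a set \<Rightarrow> 'a \<Rightarrow> ennreal" where
  "reduced W u A = Inf {v \<in> W. \<forall>x\<in>A. u x \<le> v x}"

text \<open>
  The limit inferior as \<open>y \<rightarrow> x\<close> includes the value at \<open>x\<close>, hence \<^term>\<open>nhds x\<close>
  rather than \<^term>\<open>at x\<close>.
\<close>

definition regularized_reduced ::
    "('a::topological_space \<Rightarrow> ennreal) set \<Rightarrow> ('a \<Rightarrow> ennreal) \<Rightarrow> 'a set \<Rightarrow> 'a \<Rightarrow> ennreal" where
  "regularized_reduced W u A x = Liminf (nhds x) (reduced W u A)"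

text \<open>The measure \<open>\<epsilon>\<^sub>x\<^sup>A\<close>.\<close>

definition swept_measure ::
    "('a::topological_space \<Rightarrow> ennreal) set \<Rightarrow> 'a \<Rightarrow> 'a set \<Rightarrow> 'a measure" where
  "swept_measure W x A =
     (THE \<mu>. sets \<mu> = sets borel \<and> (\<forall>u\<in>W. (\<integral>\<^sup>+y. u y \<partial>\<mu>) = reduced W u A x))"

definition harmonic_on ::
    "('a::topological_space \<Rightarrow> ennreal) set \<Rightarrow> 'a set \<Rightarrow> ('a \<Rightarrow> real) \<Rightarrow> bool" where
  "harmonic_on W D h \<longleftrightarrow>
     continuous_on D h \<and>
     (\<forall>V. open V \<longrightarrow> compact (closure V) \<longrightarrow> closure V \<subseteq> D \<longrightarrow>
       (\<forall>x\<in>V. integrable (swept_measure W x (- V)) h \<and>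
              (\<integral>y. h y \<partial>swept_measure W x (- V)) = h x))"

abbreviation harmonic ::
    "('a::topological_space \<Rightarrow> ennreal) set \<Rightarrow> ('a \<Rightarrow> real) \<Rightarrow> bool" where
  "harmonic W h \<equiv> harmonic_on W UNIV h"

definition superharmonic ::
    "('a::topological_space \<Rightarrow> ennreal) set \<Rightarrow> ('a \<Rightarrow> ennreal) \<Rightarrow> bool" where
  "superharmonic W p \<longleftrightarrow>
     p \<in> W \<and>
     (\<forall>V. open V \<longrightarrow> compact (closure V) \<longrightarrow>
       (\<forall>x\<in>V. (\<integral>\<^sup>+y. p y \<partial>swept_measure W x (- V)) < \<infinity>) \<and>
       continuous_on V (\<lambda>x. \<integral>\<^sup>+y. p y \<partial>swept_measure W x (- V)))"

definition potential ::
    "('a::topological_space \<Rightarrow> ennreal) set \<Rightarrow> ('a \<Rightarrow> ennreal) \<Rightarrow> bool" where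
  "potential W p \<longleftrightarrow>
     superharmonic W p \<and>
     (\<forall>h. harmonic W h \<and> (\<forall>x. 0 \<le> h x \<and> ennreal (h x) \<le> p x) \<longrightarrow> (\<forall>x. h x = 0))"

definition liouville_property :: "('a::topological_space \<Rightarrow> ennreal) set \<Rightarrow> bool" where
  "liouville_property W \<longleftrightarrow>
     (\<forall>h. harmonic W h \<and> bounded (range h) \<longrightarrow> (\<exists>c. \<forall>x. h x = c))"

definition unavoidable :: "('a \<Rightarrow> ennreal) set \<Rightarrow> 'a set \<Rightarrow> bool" where
  "unavoidable W A \<longleftrightarrow> (\<forall>x. reduced W (\<lambda>_. 1) A x = 1)"

abbreviation avoidable :: "('a \<Rightarrow> ennreal) set \<Rightarrow> 'a set \<Rightarrow> bool" where
  "avoidable W A \<equiv> \<not> unavoidable W A"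

end

theory Submission
  imports Defs
begin

text \<open>
Write \<open>R\<^sub>u\<^sup>A\<close> for the reduced function. Everything rests on one property of harmonic constants: if \<open>w\<close> belongs to
\<open>W\<close> and \<open>w \<ge> c\<close> for a constant \<open>c \<ge> 0\<close>, then \<open>w - c\<close> belongs to \<open>W\<close> (\<open>subtract_const_mem\<close>).

Suppose \<open>R\<^sub>1\<^sup>A \<ge> c\<close> with \<open>0 < c < 1\<close>. Every \<open>w\<close> in \<open>W\<close> with \<open>w \<ge> 1\<close> on \<open>A\<close> satisfies \<open>w \<ge> c\<close>, so
\<open>(w - c) / (1 - c)\<close> is in \<open>W\<close> and again at least \<open>1\<close> on \<open>A\<close>. Taking the infimum over \<open>w\<close> gives
\<open>(1 - c) R\<^sub>1\<^sup>A \<le> R\<^sub>1\<^sup>A - c\<close>, that is \<open>R\<^sub>1\<^sup>A \<ge> 1\<close>: this is the first assertion. If \<open>A\<close> is unavoidable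
and \<open>R\<^sub>1\<^sup>B \<ge> \<kappa>\<close> on \<open>A\<close>, then any \<open>w\<close> competing for \<open>B\<close> is at least \<open>\<kappa>\<close> on \<open>A\<close>, hence
everywhere, so \<open>R\<^sub>1\<^sup>B \<ge> \<kappa>\<close> and the first assertion applies to \<open>B\<close>.

Now let bounded harmonic functions be constant. A harmonic function between \<open>0\<close> and the regularization of
\<open>R\<^sub>1\<^sup>A\<close> is a constant \<open>\<le> inf R\<^sub>1\<^sup>A\<close>, so it vanishes if \<open>A\<close> is avoidable; if \<open>A\<close> is
unavoidable, it can be \<open>1\<close>. For the union of two avoidable sets choose
\<open>w\<^sub>1 \<ge> 1\<close> on \<open>A\<close> and \<open>w\<^sub>2 \<ge> 1\<close> on \<open>B\<close>, each smaller than \<open>1/2\<close> somewhere. Were \<open>A \<union> B\<close> unavoidable,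
then \<open>1 \<le> w\<^sub>1 + w\<^sub>2\<close>, and (B3) would split \<open>1 = u + v\<close> with \<open>u \<le> w\<^sub>1\<close>, \<open>v \<le> w\<^sub>2\<close>. Both summands are
superharmonic with harmonic sum, hence harmonic, hence constants smaller than \<open>1/2\<close>, which is absurd.

The main tool behind this is \<open>diff_mem_of_fixed_by_reduction\<close>, a purely algebraic criterion, from (B2) and
(B3), for a difference of two elements of \<open>W\<close> to be in \<open>W\<close> again. It yields \<open>subtract_const_mem\<close>. It also
yields that \<open>R\<^sub>w\<^sup>A\<close> is the increasing limit of \<open>R\<^sub>p\<^sup>A\<close> when \<open>p\<close> increases to \<open>w\<close>
(\<open>reduced_SUP\<close>); together with a Daniell representation theorem this gives the swept measures
(\<open>swept_measure\<close>). Finally it yields that \<open>R\<^sub>p\<close> for the complement of a relatively compact open set is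
continuous inside that set when \<open>p \<le> 1\<close> (\<open>continuous_on_reduced_complement\<close>), so that the regularization
of \<open>R\<^sub>1\<^sup>A\<close> is superharmonic.
\<close>

section \<open>Lower semicontinuity and the fine topology\<close>

lemma lower_semicontinuous_euclidean:
  "lower_semicontinuous euclidean f \<longleftrightarrow> (\<forall>a. open {x. a < f x})"
  by (simp add: lower_semicontinuous_def)

lemma open_less_of_continuous_lower_semicontinuous:
  fixes f g :: "'a::topological_space \<Rightarrow> ennreal"
  assumes "continuous_on U f" and "open U" and "lower_semicontinuous euclidean g"
  shows "open {x \<in> U. f x < g x}"
proof -
  have "{x \<in> U. f x < g x} = (\<Union>a. (U \<inter> f -` {..<a}) \<inter> {x. a < g x})"
    by (auto dest: dense)
  moreover have "open (U \<inter> f -` {..<a})" for a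
    using assms(1,2) by (auto intro!: continuous_open_preimage)
  ultimately show ?thesis
    using assms(3) by (simp add: lower_semicontinuous_euclidean open_UN open_Int)
qed

lemma lower_semicontinuous_const_add:
  fixes g :: "'a \<Rightarrow> ennreal"
  assumes "lower_semicontinuous T g"
  shows "lower_semicontinuous T (\<lambda>x. c + g x)"
  unfolding lower_semicontinuous_def
proof
  fix a
  show "openin T {x \<in> topspace T. a < c + g x}"
  proof (cases "a < c")
    case True
    then have "{x \<in> topspace T. a < c + g x} = topspace T"
      by (auto intro: less_le_trans)
    then show ?thesis by simp
  next
    case False
    show ?thesis
    proof (cases "c = top")
      case True
      with False have "a = top" by (metis top.not_eq_extremum)
      then show ?thesis using openin_subopen by force
    next
      case c: False
      have "a < c + g x \<longleftrightarrow> a - c < g x" for x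
        using minus_less_iff_ennreal[of c a "g x"] False c
        by (auto simp: add.commute top.not_eq_extremum)
      then show ?thesis using assms by (simp add: lower_semicontinuous_def)
    qed
  qed
qed

text \<open>Each summand is the difference of a continuous function and a lower semicontinuous one, hence also
  upper semicontinuous. This is how elements of \<open>W\<close> will be recognized as continuous.\<close>

lemma continuous_on_summand:
  fixes f g h :: "'a::topological_space \<Rightarrow> ennreal"
  assumes f: "lower_semicontinuous euclidean f" and g: "lower_semicontinuous euclidean g"
    and h: "continuous_on U h" and U: "open U"
    and eq: "\<And>x. x \<in> U \<Longrightarrow> f x + g x = h x" and fin: "\<And>x. x \<in> U \<Longrightarrow> h x < \<infinity>"
  shows "continuous_on U f"
proof -
  have less: "U \<inter> f -` {..<a} = {x \<in> U. h x < a + g x}" for a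
  proof -
    have "f x < a \<longleftrightarrow> h x < a + g x" if "x \<in> U" for x
    proof -
      have "g x \<noteq> \<infinity>" using eq[OF that] fin[OF that] by auto
      then show ?thesis
        using ennreal_add_left_cancel_less[of "g x" "f x" a] eq[OF that] by (simp add: add.commute)
    qed
    then show ?thesis by auto
  qed
  have 1: "open (U \<inter> f -` {..<a})" for a
    unfolding less using h U lower_semicontinuous_const_add[OF g]
    by (rule open_less_of_continuous_lower_semicontinuous)
  have 2: "open (U \<inter> f -` {a<..})" for a
  proof -
    have "f -` {a<..} = {x. a < f x}" by auto
    then show ?thesis using f U by (auto simp: lower_semicontinuous_euclidean)
  qed
  show ?thesis
    using 1 2
    by (intro continuous_on_generate_topology[OF open_generated_order]) (auto simp: Int_commute; blast)
qed

lemma lower_semicontinuous_if_open: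
  fixes f :: "'a \<Rightarrow> ennreal"
  assumes "\<And>a. openin T {x \<in> U. a < f x}" 
  shows "lower_semicontinuous T (\<lambda>x. if x \<in> U then f x else 0)"
proof -
  have "{x \<in> topspace T. a < (if x \<in> U then f x else 0)} = {x \<in> U. a < f x}" for a
    using openin_subset[OF assms[of a]] by (auto split: if_splits)
  then show ?thesis using assms by (simp add: lower_semicontinuous_def)
qed

lemma topspace_fine_topology [simp]: "topspace (fine_topology W) = UNIV"
  by (auto simp: fine_topology_def topology_generated_by_topspace)

lemma openin_fine_topology_open: "open U \<Longrightarrow> openin (fine_topology W) U"
  unfolding fine_topology_def by (rule topology_generated_by_Basis) simp

lemma openin_fine_topology_vimage:
  "u \<in> W \<Longrightarrow> open S \<Longrightarrow> openin (fine_topology W) (u -` S)"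
  unfolding fine_topology_def by (rule topology_generated_by_Basis) blast

lemma finely_lower_semicontinuous:
  fixes f :: "'a::topological_space \<Rightarrow> ennreal"
  assumes "lower_semicontinuous euclidean f"
  shows "lower_semicontinuous (fine_topology W) f"
  using assms by (auto simp: lower_semicontinuous_def intro: openin_fine_topology_open)

text \<open>Elements of \<open>W\<close> are finely continuous, so their differences are too. Truncated subtraction is harmless
  here: it only replaces negative values by \<open>0\<close>.\<close>

lemma openin_fine_topology_diff:
  fixes s t :: "'a::topological_space \<Rightarrow> ennreal"
  assumes s: "s \<in> W" and t: "t \<in> W" and fin: "\<And>x. x \<in> U \<Longrightarrow> t x < \<infinity> \<or> s x < \<infinity>"
    and U: "open U"
  shows "openin (fine_topology W) {x \<in> U. a < s x - t x}"
proof (cases "a = top")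
  case False
  have "a < s x - t x \<longleftrightarrow> (\<exists>b. t x < b - a \<and> b < s x)" if "x \<in> U" for x
  proof -
    have "a < s x - t x \<longleftrightarrow> t x + a < s x"
      using fin[OF that] by (subst less_diff_eq_ennreal) (auto simp: add.commute)
    also have "\<dots> \<longleftrightarrow> (\<exists>b. t x + a < b \<and> b < s x)"
      by (meson dense less_trans)
    also have "\<dots> \<longleftrightarrow> (\<exists>b. t x < b - a \<and> b < s x)"
      using False by (subst less_diff_eq_ennreal) (auto simp: top.not_eq_extremum)
    finally show ?thesis .
  qed
  then have "{x \<in> U. a < s x - t x} = (\<Union>b. U \<inter> t -` {..<b - a} \<inter> s -` {b<..})"
    by auto
  also have "openin (fine_topology W) \<dots>"
    using openin_fine_topology_vimage[OF s, of "{_<..}"] openin_fine_topology_vimage[OF t, of "{..<_}"]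
      openin_fine_topology_open[OF U] by (intro openin_Union) (auto intro!: openin_Int)
  finally show ?thesis .
qed simp

lemma finely_lower_semicontinuous_diff:
  fixes s t :: "'a::topological_space \<Rightarrow> ennreal"
  assumes "s \<in> W" and "t \<in> W" and "\<And>x. t x < \<infinity>"
  shows "lower_semicontinuous (fine_topology W) (\<lambda>x. s x - t x)"
  using openin_fine_topology_diff[of s W t UNIV] assms by (simp add: lower_semicontinuous_def)

lemma fine_lsc_regularization_le: "fine_lsc_regularization W v \<le> v"
  unfolding fine_lsc_regularization_def by (rule Sup_least) simp

lemma fine_lsc_regularization_greatest:
  "lower_semicontinuous (fine_topology W) g \<Longrightarrow> g \<le> v \<Longrightarrow> g \<le> fine_lsc_regularization W v"
  unfolding fine_lsc_regularization_def by (rule Sup_upper) simp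

section \<open>Reduced functions and specific minorants\<close>

lemma reduced_apply: "reduced W u A x = (INF v\<in>{v \<in> W. \<forall>x\<in>A. u x \<le> v x}. v x)"
  by (simp add: reduced_def)

lemma reduced_lower: "w \<in> W \<Longrightarrow> (\<And>y. y \<in> A \<Longrightarrow> u y \<le> w y) \<Longrightarrow> reduced W u A x \<le> w x"
  unfolding reduced_apply by (rule INF_lower) simp

lemma reduced_greatest:
  "(\<And>w. w \<in> W \<Longrightarrow> \<forall>y\<in>A. u y \<le> w y \<Longrightarrow> c \<le> w x) \<Longrightarrow> c \<le> reduced W u A x"
  unfolding reduced_apply by (rule INF_greatest) simp

lemma reduced_upper: "x \<in> A \<Longrightarrow> u x \<le> reduced W u A x"
  by (rule reduced_greatest) simp

lemma reduced_eq: "u \<in> W \<Longrightarrow> x \<in> A \<Longrightarrow> reduced W u A x = u x"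
  by (intro antisym reduced_lower reduced_upper) auto

lemma reduced_lessE:
  assumes "reduced W u A x < c"
  obtains w where "w \<in> W" "\<And>y. y \<in> A \<Longrightarrow> u y \<le> w y" "w x < c"
  using assms unfolding reduced_apply INF_less_iff by blast

lemma reduced_mono:
  assumes "A \<subseteq> B" and "\<And>y. y \<in> A \<Longrightarrow> u y \<le> v y"
  shows "reduced W u A x \<le> reduced W v B x"
  using assms by (intro reduced_greatest reduced_lower) (auto intro: order_trans)

context balayage_space
begin

lemma add_mem: "u \<in> W \<Longrightarrow> v \<in> W \<Longrightarrow> (\<lambda>x. u x + v x) \<in> W"
  using cone by (simp add: convex_cone_def)

lemma scale_mem: "u \<in> W \<Longrightarrow> 0 \<le> c \<Longrightarrow> (\<lambda>x. ennreal c * u x) \<in> W"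
  using cone by (simp add: convex_cone_def)

lemma SUP_mem:
  assumes "\<And>n::nat. v n \<in> W" and "\<And>n x. v n x \<le> v (Suc n) x"
  shows "(\<lambda>x. SUP n. v n x) \<in> W"
proof -
  have "incseq v" using assms(2) by (intro incseq_SucI le_funI)
  moreover have "range v \<subseteq> W" using assms(1) by auto
  ultimately have "(SUP n. v n) \<in> W" by (rule B1)
  moreover have "(SUP n. v n) = (\<lambda>x. SUP n. v n x)" by (simp add: fun_eq_iff image_image)
  ultimately show ?thesis by simp
qed

text \<open>Where an infimum of elements of \<open>W\<close> is already finely lower semicontinuous, regularizing does not
  change it: extend it by \<open>0\<close> outside \<open>U\<close> to get a competitor for the regularization. So (B2) provides an element
  of \<open>W\<close> that agrees with the infimum itself on \<open>U\<close>.\<close>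

lemma fine_lsc_regularization_Inf_eq:
  assumes V: "V \<subseteq> W" and U: "\<And>a. openin (fine_topology W) {x \<in> U. a < g x}"
    and eq: "\<And>x. x \<in> U \<Longrightarrow> Inf V x = g x" and x: "x \<in> U"
  shows "fine_lsc_regularization W (Inf V) x = g x"
proof (rule antisym)
  show "fine_lsc_regularization W (Inf V) x \<le> g x"
    using fine_lsc_regularization_le[of W "Inf V"] eq[OF x] by (metis le_fun_def)
  have "(\<lambda>x. if x \<in> U then g x else 0) \<le> fine_lsc_regularization W (Inf V)"
    using eq by (intro fine_lsc_regularization_greatest lower_semicontinuous_if_open U)
      (simp add: le_fun_def)
  from le_funD[OF this, of x] show "g x \<le> fine_lsc_regularization W (Inf V) x" using x by simp
qed

lemma min_mem:
  assumes u: "u \<in> W" and v: "v \<in> W"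
  shows "(\<lambda>x. min (u x) (v x)) \<in> W"
proof -
  have eq: "Inf {u, v} = (\<lambda>x. min (u x) (v x))" by (simp add: fun_eq_iff inf_min)
  have "{x. a < min (u x) (v x)} = {x. a < u x} \<inter> {x. a < v x}" for a by auto
  moreover have "open {x. a < u x}" "open {x. a < v x}" for a
    using lsc[OF u] lsc[OF v] by (simp_all add: lower_semicontinuous_euclidean)
  ultimately have "openin (fine_topology W) {x. a < min (u x) (v x)}" for a
    by (intro openin_fine_topology_open) (simp add: open_Int)
  then have "fine_lsc_regularization W (Inf {u, v}) = (\<lambda>x. min (u x) (v x))"
    using u v by (intro ext fine_lsc_regularization_Inf_eq[of _ UNIV]) (auto simp: eq inf_min)
  with B2[of "{u, v}"] u v show ?thesis by simp
qed

text \<open>The regularization of the infimum still lies above \<open>f\<close>, so it takes part in the infimum.\<close>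

lemma reduced_mem:
  assumes "lower_semicontinuous (fine_topology W) f"
  shows "reduced W f UNIV \<in> W"
proof -
  let ?V = "{w \<in> W. \<forall>x\<in>UNIV. f x \<le> w x}" and ?r = "fine_lsc_regularization W (reduced W f UNIV)"
  have "f \<le> ?r"
    using assms by (rule fine_lsc_regularization_greatest) (simp add: le_fun_def reduced_upper)
  moreover have r: "?r \<in> W" unfolding reduced_def by (rule B2) auto
  ultimately have "reduced W f UNIV \<le> ?r"
    by (intro le_funI reduced_lower) (auto simp: le_fun_def)
  with fine_lsc_regularization_le[of W "reduced W f UNIV"] r show ?thesis
    by (metis antisym)
qed

lemma reduced_open_mem:
  assumes u: "u \<in> W" and G: "open G"
  shows "reduced W u G \<in> W"
proof -
  have eq: "reduced W u G = reduced W (\<lambda>x. if x \<in> G then u x else 0) UNIV"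
    unfolding reduced_def by (rule arg_cong[of _ _ Inf]) auto
  have "{x \<in> G. a < u x} = G \<inter> {x. a < u x}" for a by auto
  then have "open {x \<in> G. a < u x}" for a
    using lsc[OF u] G by (auto simp: lower_semicontinuous_euclidean)
  then show ?thesis unfolding eq
    by (intro reduced_mem lower_semicontinuous_if_open openin_fine_topology_open)
qed

text \<open>Mokobodzki's decomposition. Since \<open>s \<le> r + t\<close>, (B3) splits \<open>s = r' + t'\<close> with \<open>r' \<le> r\<close> and
  \<open>t' \<le> t\<close>; then \<open>r' \<ge> s - t\<close>, so \<open>r' = r\<close> by minimality of \<open>r\<close>.\<close>

lemma reduced_diff_specific_minorant:
  assumes s: "s \<in> W" and t: "t \<in> W" and fin: "\<And>x. t x < \<infinity>"
  defines "r \<equiv> reduced W (\<lambda>x. s x - t x) UNIV"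
  shows "r \<in> W" and "\<exists>t'\<in>W. t' \<le> t \<and> (\<forall>x. s x = r x + t' x)"
proof -
  show r: "r \<in> W"
    unfolding r_def using s t fin by (intro reduced_mem finely_lower_semicontinuous_diff)
  have upper: "s x - t x \<le> r x" for x unfolding r_def by (rule reduced_upper) simp
  have "s x \<le> r x + t x" for x
    using upper[of x] fin[of x] by (auto simp: ennreal_minus_le_iff add.commute)
  from B3[OF s r t this] obtain r' t' where r': "r' \<in> W" "r' \<le> r" and t': "t' \<in> W" "t' \<le> t"
    and eq: "\<And>x. s x = r' x + t' x" by blast
  have "s x - t x \<le> r' x" for x
    using eq[of x] le_funD[OF t'(2), of x] fin[of x]
    by (auto simp: ennreal_minus_le_iff add.commute intro: add_left_mono)
  then have "r x \<le> r' x" for x unfolding r_def using r' by (intro reduced_lower) auto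
  with r'(2) have "r = r'" by (auto simp: le_fun_def intro!: antisym)
  with t' eq show "\<exists>t'\<in>W. t' \<le> t \<and> (\<forall>x. s x = r x + t' x)" by blast
qed

text \<open>The criterion for \<open>Y - c\<close> to lie in \<open>W\<close>. Mokobodzki's decomposition gives \<open>Y = r + c'\<close> with
  \<open>c' \<le> c\<close>, where \<open>r\<close> is the reduction of \<open>Y - c\<close>, so that \<open>r \<le> b\<close>. On \<open>A\<close> the sum \<open>r + c'\<close> equals \<open>b + c\<close>, which
  forces \<open>c' = c\<close> there; since \<open>c\<close> is determined by its values on \<open>A\<close>, it follows that \<open>c' = c\<close> everywhere. Typically
  \<open>Y = min Z (b + c)\<close>, and then the criterion glues \<open>Z - c\<close>, which is superharmonic only outside \<open>A\<close>,
  to the function \<open>b\<close>.\<close>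

lemma diff_mem_of_fixed_by_reduction:
  assumes Y: "Y \<in> W" and b: "b \<in> W" and c: "c \<in> W"
    and fin: "\<And>x. b x < \<infinity>" "\<And>x. c x < \<infinity>"
    and le: "\<And>x. Y x \<le> b x + c x" and eq: "\<And>x. x \<in> A \<Longrightarrow> Y x = b x + c x"
    and fixed: "\<And>w x. w \<in> W \<Longrightarrow> (\<And>y. y \<in> A \<Longrightarrow> c y \<le> w y) \<Longrightarrow> c x \<le> w x"
  shows "\<exists>r\<in>W. \<forall>x. Y x = r x + c x"
proof -
  let ?r = "reduced W (\<lambda>x. Y x - c x) UNIV"
  note m = reduced_diff_specific_minorant[OF Y c fin(2)]
  from m obtain c' where c': "c' \<in> W" "c' \<le> c" and Yeq: "\<And>x. Y x = ?r x + c' x" by blast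
  have b_top: "b x \<noteq> top" for x using fin(1)[of x] by auto
  have c_top: "c x \<noteq> top" for x using fin(2)[of x] by auto
  have rb: "?r x \<le> b x" for x
    using le b by (intro reduced_lower) (auto simp: ennreal_minus_le_iff add.commute c_top)
  have "c y \<le> c' y" if "y \<in> A" for y
  proof -
    have "b y + c y = ?r y + c' y" using eq[OF that] Yeq[of y] by simp
    also have "\<dots> \<le> b y + c' y" by (intro add_right_mono rb)
    finally show ?thesis using b_top[of y] by (simp add: ennreal_add_left_cancel_le)
  qed
  then have "c x \<le> c' x" for x using fixed c'(1) by blast
  with c'(2) have "c' = c" by (auto simp: le_fun_def intro!: antisym)
  with Yeq m(1) show ?thesis by blast
qed

text \<open>Superadditivity is (B3) applied to \<open>min w (u + v)\<close> for a competitor \<open>w\<close>: on \<open>A\<close> the two parts add up to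
  \<open>u + v\<close> without exceeding \<open>u\<close> and \<open>v\<close>, so they equal \<open>u\<close> and \<open>v\<close> there.\<close>

lemma reduced_add:
  assumes u: "u \<in> W" and v: "v \<in> W" and fin: "\<And>x. u x < \<infinity>" "\<And>x. v x < \<infinity>"
  shows "reduced W (\<lambda>x. u x + v x) A x = reduced W u A x + reduced W v A x"
proof (rule antisym)
  show "reduced W (\<lambda>x. u x + v x) A x \<le> reduced W u A x + reduced W v A x"
  proof (rule ennreal_le_epsilon)
    fix e :: real assume fin': "reduced W u A x + reduced W v A x < top" and e: "0 < e"
    have less: "reduced W u A x < reduced W u A x + ennreal (e/2)"
      "reduced W v A x < reduced W v A x + ennreal (e/2)"
      using fin' e by (auto simp: ennreal_add_less_top ennreal_less_zero_iff)
    obtain w1 where w1: "w1 \<in> W" "\<And>y. y \<in> A \<Longrightarrow> u y \<le> w1 y" "w1 x < reduced W u A x + ennreal (e/2)"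
      using less(1) by (rule reduced_lessE) blast
    obtain w2 where w2: "w2 \<in> W" "\<And>y. y \<in> A \<Longrightarrow> v y \<le> w2 y" "w2 x < reduced W v A x + ennreal (e/2)"
      using less(2) by (rule reduced_lessE) blast
    have "reduced W (\<lambda>x. u x + v x) A x \<le> w1 x + w2 x"
      using w1 w2 by (intro reduced_lower[where w = "\<lambda>x. w1 x + w2 x"] add_mem add_mono)
    also have "\<dots> \<le> (reduced W u A x + ennreal (e/2)) + (reduced W v A x + ennreal (e/2))"
      using w1 w2 by (intro add_mono) auto
    also have "\<dots> = reduced W u A x + reduced W v A x + ennreal (e/2 + e/2)"
      using e by (subst ennreal_plus) (auto simp: algebra_simps)
    finally show "reduced W (\<lambda>x. u x + v x) A x \<le> reduced W u A x + reduced W v A x + ennreal e"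
      by simp
  qed
  show "reduced W u A x + reduced W v A x \<le> reduced W (\<lambda>x. u x + v x) A x"
  proof (rule reduced_greatest)
    fix w assume w: "w \<in> W" and wA: "\<forall>y\<in>A. u y + v y \<le> w y"
    let ?w = "\<lambda>x. min (w x) (u x + v x)"
    have "?w \<in> W" by (intro min_mem w add_mem u v)
    from B3[OF this u v] obtain u' v' where u': "u' \<in> W" "u' \<le> u" and v': "v' \<in> W" "v' \<le> v"
      and eq: "\<And>x. ?w x = u' x + v' x" by auto
    have "u y \<le> u' y \<and> v y \<le> v' y" if "y \<in> A" for y
    proof -
      have sum: "u y + v y = u' y + v' y" using eq[of y] wA that by (simp add: min_absorb2)
      have le: "u' y \<le> u y" "v' y \<le> v y" using u' v' by (auto simp: le_fun_def)
      have "u y + v y \<le> u' y + v y" "u y + v y \<le> u y + v' y"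
        unfolding sum using le by (auto intro: add_mono)
      then show ?thesis
        using fin[of y, THEN less_imp_neq]
        by (simp add: ennreal_add_left_cancel_le add.commute[of _ "v y"])
    qed
    then have "reduced W u A x \<le> u' x" "reduced W v A x \<le> v' x"
      using u' v' by (auto intro!: reduced_lower)
    then have "reduced W u A x + reduced W v A x \<le> ?w x" unfolding eq by (rule add_mono)
    then show "reduced W u A x + reduced W v A x \<le> w x" by simp
  qed
qed

lemma reduced_scale:
  assumes c: "0 < c"
  shows "reduced W (\<lambda>y. ennreal c * u y) A x = ennreal c * reduced W u A x"
proof (rule antisym)
  have cancel: "ennreal c * (ennreal (1/c) * a) = a" "ennreal (1/c) * (ennreal c * a) = a" for a
    using c by (simp_all add: mult.assoc[symmetric] ennreal_mult[symmetric])
  have "ennreal (1/c) * reduced W (\<lambda>y. ennreal c * u y) A x \<le> reduced W u A x"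
  proof (rule reduced_greatest)
    fix w assume w: "w \<in> W" "\<forall>y\<in>A. u y \<le> w y"
    then have "reduced W (\<lambda>y. ennreal c * u y) A x \<le> ennreal c * w x"
      using c by (intro reduced_lower[where w = "\<lambda>y. ennreal c * w y"] scale_mem mult_left_mono) simp_all
    then have "ennreal (1/c) * reduced W (\<lambda>y. ennreal c * u y) A x \<le> ennreal (1/c) * (ennreal c * w x)"
      by (intro mult_left_mono) simp_all
    then show "ennreal (1/c) * reduced W (\<lambda>y. ennreal c * u y) A x \<le> w x" unfolding cancel .
  qed
  then have "ennreal c * (ennreal (1/c) * reduced W (\<lambda>y. ennreal c * u y) A x) \<le> ennreal c * reduced W u A x"
    by (intro mult_left_mono) simp_all
  then show "reduced W (\<lambda>y. ennreal c * u y) A x \<le> ennreal c * reduced W u A x" unfolding cancel .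
  show "ennreal c * reduced W u A x \<le> reduced W (\<lambda>y. ennreal c * u y) A x"
  proof (rule reduced_greatest)
    fix w assume w: "w \<in> W" "\<forall>y\<in>A. ennreal c * u y \<le> w y"
    have "u y \<le> ennreal (1/c) * w y" if "y \<in> A" for y
    proof -
      have "ennreal (1/c) * (ennreal c * u y) \<le> ennreal (1/c) * w y"
        using w(2) that by (intro mult_left_mono) simp_all
      then show ?thesis unfolding cancel .
    qed
    then have "reduced W u A x \<le> ennreal (1/c) * w x"
      using w(1) c by (intro reduced_lower[where w = "\<lambda>y. ennreal (1/c) * w y"] scale_mem) simp_all
    then have "ennreal c * reduced W u A x \<le> ennreal c * (ennreal (1/c) * w x)"
      by (intro mult_left_mono) simp_all
    then show "ennreal c * reduced W u A x \<le> w x" unfolding cancel .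
  qed
qed

end

section \<open>Daniell functionals\<close>

text \<open>The lattice \<open>L\<close> plays the role of the continuous functions with compact support in the Riesz representation
  theorem: by the last assumption it is rich enough to build the measure from its values on open sets. The assumption
  on null sequences replaces the compactness of supports.\<close>

locale daniell_functional =
  fixes L :: "('a::topological_space \<Rightarrow> real) set" and I :: "('a \<Rightarrow> real) \<Rightarrow> real"
  assumes one: "(\<lambda>x. 1) \<in> L"
    and add: "f \<in> L \<Longrightarrow> g \<in> L \<Longrightarrow> (\<lambda>x. f x + g x) \<in> L"
    and scale: "f \<in> L \<Longrightarrow> (\<lambda>x. c * f x) \<in> L"
    and max: "f \<in> L \<Longrightarrow> g \<in> L \<Longrightarrow> (\<lambda>x. max (f x) (g x)) \<in> L"
    and continuous: "f \<in> L \<Longrightarrow> continuous_on UNIV f"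
    and I_add: "f \<in> L \<Longrightarrow> g \<in> L \<Longrightarrow> I (\<lambda>x. f x + g x) = I f + I g"
    and I_scale: "f \<in> L \<Longrightarrow> I (\<lambda>x. c * f x) = c * I f"
    and I_nonneg: "f \<in> L \<Longrightarrow> (\<And>x. 0 \<le> f x) \<Longrightarrow> 0 \<le> I f"
    and I_null: "(\<And>n. F n \<in> L) \<Longrightarrow> (\<And>n x. F (Suc n) x \<le> F n x) \<Longrightarrow>
      (\<And>x. (\<lambda>n. F n x) \<longlonglongrightarrow> 0) \<Longrightarrow> (\<lambda>n. I (F n)) \<longlonglongrightarrow> 0"
    and approximates_open: "open D \<Longrightarrow> \<exists>F. \<forall>n x. F n \<in> L \<and> 0 \<le> F n x \<and> F n x \<le> indicator D x \<and>
      F n x \<le> F (Suc n) x \<and> (\<lambda>n. F n x) \<longlonglongrightarrow> indicator D x"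
begin

lemma diff: "f \<in> L \<Longrightarrow> g \<in> L \<Longrightarrow> (\<lambda>x. f x - g x) \<in> L"
  using add[of f "\<lambda>x. (-1) * g x"] scale[of g "-1"] by simp

lemma I_diff: "f \<in> L \<Longrightarrow> g \<in> L \<Longrightarrow> I (\<lambda>x. f x - g x) = I f - I g"
  using I_add[of f "\<lambda>x. (-1) * g x"] scale[of g "-1"] I_scale[of g "-1"] by simp

lemma const: "(\<lambda>x. c) \<in> L"
  using scale[OF one, of c] by simp

lemma min: "f \<in> L \<Longrightarrow> g \<in> L \<Longrightarrow> (\<lambda>x. min (f x) (g x)) \<in> L"
  using diff[OF add max, of f g f g] by (simp add: max_def min_def if_distrib cong: if_cong)

lemma sum: "(\<And>i. i \<in> J \<Longrightarrow> F i \<in> L) \<Longrightarrow> (\<lambda>x. \<Sum>i\<in>J. F i x) \<in> L"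
  by (induction J rule: infinite_finite_induct) (auto simp: const add)

lemma I_sum: "(\<And>i. i \<in> J \<Longrightarrow> F i \<in> L) \<Longrightarrow> I (\<lambda>x. \<Sum>i\<in>J. F i x) = (\<Sum>i\<in>J. I (F i))"
proof (induction J rule: infinite_finite_induct)
  case (insert i J)
  then show ?case by (simp add: I_add sum)
qed (use I_scale[OF one, of 0] in auto)

lemma I_mono: "f \<in> L \<Longrightarrow> g \<in> L \<Longrightarrow> (\<And>x. f x \<le> g x) \<Longrightarrow> I f \<le> I g"
  using I_nonneg[OF diff, of g f] I_diff[of g f] by simp

text \<open>The remainders \<open>f - min f (F n)\<close> decrease to \<open>0\<close>.\<close>

lemma I_le_of_approximation:
  assumes f: "f \<in> L" and F: "\<And>n. F n \<in> L" "\<And>n x. F n x \<le> F (Suc n) x"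
    and approx: "\<And>x d. 0 < d \<Longrightarrow> \<exists>n. f x \<le> F n x + d" and e: "0 < e"
  shows "\<exists>n. I f \<le> I (F n) + e"
proof -
  let ?G = "\<lambda>n x. f x - min (f x) (F n x)"
  have lim: "(\<lambda>n. ?G n x) \<longlonglongrightarrow> 0" for x
  proof (rule LIMSEQ_I)
    fix d :: real assume "0 < d"
    then obtain m where m: "f x \<le> F m x + d/2" using approx[of "d/2"] by auto
    show "\<exists>m. \<forall>n\<ge>m. norm (?G n x - 0) < d"
    proof (intro exI allI impI)
      fix n assume "m \<le> n"
      then have "F m x \<le> F n x" using lift_Suc_mono_le[of "\<lambda>n. F n x", OF F(2)] by blast
      then show "norm (?G n x - 0) < d" using m \<open>0 < d\<close> by (simp add: min_def)
    qed
  qed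
  have "(\<lambda>n. I (?G n)) \<longlonglongrightarrow> 0"
    using lim F by (intro I_null diff min f) (auto simp: min_def intro: order_trans)
  then have "\<forall>\<^sub>F n in sequentially. I (?G n) < e" using e by (rule order_tendstoD)
  then obtain n where "I (?G n) < e" by (auto simp: eventually_sequentially)
  moreover have "I (?G n) = I f - I (\<lambda>x. min (f x) (F n x))" by (intro I_diff min f F)
  moreover have "I (\<lambda>x. min (f x) (F n x)) \<le> I (F n)" by (intro I_mono min f F) auto
  ultimately show ?thesis by (intro exI[of _ n]) linarith
qed

definition below :: "'a set \<Rightarrow> ('a \<Rightarrow> real) set" where
  "below D = {f \<in> L. \<forall>x. 0 \<le> f x \<and> f x \<le> indicator D x}"

definition content :: "'a set \<Rightarrow> ennreal" where
  "content D = (SUP f\<in>below D. ennreal (I f))"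

definition outer :: "'a set \<Rightarrow> ennreal" where
  "outer E = (INF D\<in>{D. open D \<and> E \<subseteq> D}. content D)"

lemma zero_below: "(\<lambda>x. 0) \<in> below D"
  by (simp add: below_def const)

lemma I_zero: "I (\<lambda>x. 0) = 0"
  using I_scale[OF one, of 0] by simp

lemma content_mono:
  assumes "D \<subseteq> E"
  shows "content D \<le> content E"
proof -
  have ind: "(indicator D x :: real) \<le> indicator E x" for x using assms by (auto simp: indicator_def)
  have "below D \<subseteq> below E"
    unfolding below_def using order_trans[OF _ ind] by (intro Collect_mono) blast
  then show ?thesis unfolding content_def by (rule SUP_subset_mono) simp
qed

lemma content_upper: "f \<in> below D \<Longrightarrow> ennreal (I f) \<le> content D"
  unfolding content_def by (rule SUP_upper)

lemma content_UNIV_le: "content D \<le> ennreal (I (\<lambda>x. 1))"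
  unfolding content_def
proof (rule SUP_least)
  fix f assume "f \<in> below D"
  then have "f \<in> L" "\<And>x. f x \<le> 1"
    by (simp_all add: below_def) (metis indicator_le_1 order_trans)
  then show "ennreal (I f) \<le> ennreal (I (\<lambda>x. 1))" by (intro ennreal_leI I_mono one)
qed

lemma outer_open: "open D \<Longrightarrow> outer D = content D"
  unfolding outer_def by (intro antisym INF_lower2[of D] INF_greatest content_mono) auto

lemma outer_mono: "A \<subseteq> B \<Longrightarrow> outer A \<le> outer B"
  unfolding outer_def by (rule INF_superset_mono[OF Collect_mono order_refl]) blast

text \<open>If \<open>f\<close> is below the union, then the finite sums of the functions approximating the indicators of the
  \<open>D i\<close> eventually almost exceed \<open>f\<close> at each point.\<close>

lemma content_UN_le:
  fixes D :: "nat \<Rightarrow> 'a set"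
  assumes D: "\<And>i. open (D i)"
  shows "content (\<Union>i. D i) \<le> (\<Sum>i. content (D i))"
proof -
  have "\<forall>i. \<exists>F. \<forall>n x. F n \<in> L \<and> 0 \<le> F n x \<and> F n x \<le> indicator (D i) x \<and>
      F n x \<le> F (Suc n) x \<and> (\<lambda>n. F n x) \<longlonglongrightarrow> indicator (D i) x"
    using approximates_open[OF D] by blast
  from choice[OF this] obtain F where F: "\<And>i n. F i n \<in> L" "\<And>i n x. 0 \<le> F i n x"
    "\<And>i n x. F i n x \<le> indicator (D i) x" "\<And>i n x. F i n x \<le> F i (Suc n) x"
    "\<And>i x. (\<lambda>n. F i n x) \<longlonglongrightarrow> indicator (D i) x" by blast
  have below: "F i n \<in> below (D i)" for i n using F by (simp add: below_def)
  have I_F: "ennreal (I (F i n)) \<le> content (D i)" for i n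
    unfolding content_def by (rule SUP_upper[OF below])
  define S where "S n x = (\<Sum>i<n. F i n x)" for n x
  have S: "S n \<in> L" for n unfolding S_def by (intro sum F)
  have I_S: "ennreal (I (S n)) \<le> (\<Sum>i. content (D i))" for n
  proof -
    have "ennreal (I (S n)) = (\<Sum>i<n. ennreal (I (F i n)))"
      unfolding S_def using F by (subst I_sum) (auto intro!: sum_ennreal[symmetric] I_nonneg)
    also have "\<dots> \<le> (\<Sum>i<n. content (D i))" by (intro sum_mono I_F)
    also have "\<dots> \<le> (\<Sum>i. content (D i))" by (intro sum_le_suminf) auto
    finally show ?thesis .
  qed
  show ?thesis
    unfolding content_def[of "\<Union>i. D i"]
  proof (rule SUP_least)
    fix f assume "f \<in> below (\<Union>i. D i)"
    then have f: "f \<in> L" "\<And>x. 0 \<le> f x" "\<And>x. f x \<le> indicator (\<Union>i. D i) x"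
      by (auto simp: below_def)
    have mono: "S n x \<le> S (Suc n) x" for n x
    proof -
      have "S n x \<le> (\<Sum>i<n. F i (Suc n) x)" unfolding S_def by (intro sum_mono F)
      also have "\<dots> \<le> S (Suc n) x" unfolding S_def using F(2) by simp
      finally show ?thesis .
    qed
    have approx: "\<exists>n. f x \<le> S n x + d" if d: "0 < d" for x d
    proof (cases "x \<in> (\<Union>i. D i)")
      case True
      then obtain i where i: "x \<in> D i" by auto
      have "\<forall>\<^sub>F n in sequentially. 1 - d < F i n x"
        using F(5)[of i x] i d by (intro order_tendstoD) auto
      then obtain n0 where n0: "\<And>n. n0 \<le> n \<Longrightarrow> 1 - d < F i n x" by (auto simp: eventually_sequentially)
      let ?n = "Suc (n0 + i)"
      have "F i ?n x \<le> S ?n x" unfolding S_def using F(2)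
        by (intro member_le_sum) auto
      with n0[of ?n] f(3)[of x] True show ?thesis by (intro exI[of _ ?n]) auto
    next
      case False
      then have "f x \<le> S 0 x" using f(3)[of x] by (simp add: S_def)
      with d show ?thesis by (intro exI[of _ 0]) simp
    qed
    show "ennreal (I f) \<le> (\<Sum>i. content (D i))"
    proof (rule ennreal_le_epsilon)
      fix e :: real assume "0 < e"
      from I_le_of_approximation[OF f(1) S mono approx this] obtain n where "I f \<le> I (S n) + e" by blast
      then have "ennreal (I f) \<le> ennreal (I (S n) + e)" by (rule ennreal_leI)
      also have "\<dots> \<le> ennreal (I (S n)) + ennreal e"
        using \<open>0 < e\<close> F(2) S by (subst ennreal_plus) (auto intro!: I_nonneg sum_nonneg simp: S_def)
      also have "\<dots> \<le> (\<Sum>i. content (D i)) + ennreal e" by (intro add_right_mono I_S)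
      finally show "ennreal (I f) \<le> (\<Sum>i. content (D i)) + ennreal e" .
    qed
  qed
qed

lemma outer_UN_le:
  fixes A :: "nat \<Rightarrow> 'a set"
  shows "outer (\<Union>i. A i) \<le> (\<Sum>i. outer (A i))"
proof (rule ennreal_le_epsilon)
  fix e :: real assume e: "0 < e" and fin: "(\<Sum>i. outer (A i)) < top"
  have "\<exists>D. open D \<and> A i \<subseteq> D \<and> content D \<le> outer (A i) + ennreal (e * (1/2)^Suc i)" for i
  proof -
    have "outer (A i) \<le> (\<Sum>i. outer (A i))"
      using sum_le_suminf[of "\<lambda>i. outer (A i)" "{i}"] by simp
    then have "outer (A i) < outer (A i) + ennreal (e * (1/2)^Suc i)"
      using fin e by (auto simp: ennreal_zero_less_mult_iff)
    then show ?thesis by (subst (asm) outer_def) (auto simp: INF_less_iff intro: less_imp_le)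
  qed
  then obtain D where D: "\<And>i. open (D i)" "\<And>i. A i \<subseteq> D i"
    "\<And>i. content (D i) \<le> outer (A i) + ennreal (e * (1/2)^Suc i)" by metis
  have "outer (\<Union>i. A i) \<le> content (\<Union>i. D i)"
    unfolding outer_def using D by (intro INF_lower) auto
  also have "\<dots> \<le> (\<Sum>i. content (D i))" by (rule content_UN_le) fact
  also have "\<dots> \<le> (\<Sum>i. outer (A i) + ennreal (e * (1/2)^Suc i))"
    by (intro suminf_le D) auto
  also have "\<dots> = (\<Sum>i. outer (A i)) + (\<Sum>i. ennreal (e * (1/2)^Suc i))"
    by (rule suminf_add[symmetric]) auto
  also have "(\<Sum>i. ennreal (e * (1/2)^Suc i)) = ennreal e"
  proof -
    have "(\<lambda>i. e * (1/2)^Suc i) sums (e * 1)" by (intro sums_mult power_half_series)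
    then show ?thesis using e by (intro suminf_ennreal_eq) auto
  qed
  finally show "outer (\<Union>i. A i) \<le> (\<Sum>i. outer (A i)) + ennreal e" .
qed

lemma outer_empty: "outer {} = 0"
proof -
  have "content {} = 0"
    unfolding content_def
  proof (intro antisym SUP_least)
    fix f assume "f \<in> below {}"
    then have "f = (\<lambda>x. 0)" by (auto simp: below_def fun_eq_iff intro: antisym)
    then show "ennreal (I f) \<le> 0" by (simp add: I_zero)
  qed simp
  then show ?thesis using outer_open[of "{}"] by simp
qed

lemma outer_measure_space_outer: "outer_measure_space UNIV outer"
  unfolding outer_measure_space_def
proof (intro conjI)
  show "positive UNIV outer" by (simp add: positive_def outer_empty)
  show "increasing UNIV outer" by (simp add: increasing_def outer_mono)
  show "countably_subadditive UNIV outer" by (simp add: countably_subadditive_def outer_UN_le)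
qed

text \<open>For \<open>f\<close> below \<open>G \<inter> D\<close> and a function \<open>h\<close> below \<open>{x \<in> G. f x < d}\<close>, an open set containing \<open>G - D\<close>,
  the functions \<open>max 0 (f - d)\<close> and \<open>h\<close> are not positive at a common point, so their sum is still below \<open>G\<close>.
  This costs an error \<open>d * I 1\<close> only.\<close>

lemma content_split:
  assumes D: "open D" and G: "open G"
  shows "content (G \<inter> D) + outer (G - D) \<le> content G"
proof -
  have *: "ennreal (I f) + outer (G - D) \<le> content G + ennreal d * ennreal (I (\<lambda>x. 1))"
    if f: "f \<in> below (G \<inter> D)" and d: "0 < d" for f and d :: real
  proof -
    have f': "f \<in> L" "\<And>x. 0 \<le> f x" "\<And>x. f x \<le> indicator (G \<inter> D) x" using f by (auto simp: below_def)
    let ?G = "G \<inter> {x. f x < d}"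
    have G': "open ?G"
      using continuous[OF f'(1)] G by (intro open_Int open_Collect_less) auto
    have "f x \<le> 0" if "x \<in> G - D" for x using f'(3)[of x] that by simp
    then have "G - D \<subseteq> ?G" using d by fastforce
    then have "outer (G - D) \<le> content ?G" unfolding outer_def using G' by (intro INF_lower) auto
    moreover have "ennreal (I f) + content ?G \<le> content G + ennreal d * ennreal (I (\<lambda>x. 1))"
    proof -
      have "ennreal (I f) + ennreal (I h) \<le> content G + ennreal d * ennreal (I (\<lambda>x. 1))"
        if h: "h \<in> below ?G" for h
      proof -
        have h': "h \<in> L" "\<And>x. 0 \<le> h x" "\<And>x. h x \<le> indicator ?G x" using h by (auto simp: below_def)
        let ?f = "\<lambda>x. max 0 (f x - d)"
        have fL: "?f \<in> L" using f' by (intro max diff const)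
        have "?f x + h x \<le> indicator G x" for x
        proof (cases "x \<in> G \<and> f x < d")
          case True
          then show ?thesis using h'(3)[of x] by simp
        next
          case False
          have "(indicator (G \<inter> D) x :: real) \<le> indicator G x" by (auto simp: indicator_def)
          moreover have "(indicator G x :: real) \<le> 1" by (rule indicator_le_1)
          ultimately have "f x \<le> indicator G x" "f x \<le> 1" using f'(3)[of x] by linarith+
          moreover have "h x \<le> 0" using h'(3)[of x] False by (simp add: indicator_def)
          moreover have "(0::real) \<le> indicator G x" by simp
          ultimately have "max 0 (f x - d) \<le> indicator G x" "h x \<le> 0" using d by (auto intro: max.boundedI)
          then show ?thesis by linarith
        qed
        moreover have "0 \<le> ?f x + h x" for x using h'(2)[of x] by simp
        ultimately have in_below: "(\<lambda>x. ?f x + h x) \<in> below G"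
          unfolding below_def by (intro CollectI conjI allI add[OF fL h'(1)])
        have le: "I f + I h \<le> I (\<lambda>x. ?f x + h x) + d * I (\<lambda>x. 1)"
        proof -
          have "I f \<le> I (\<lambda>x. ?f x + d * 1)"
            using fL f' by (intro I_mono add scale one) auto
          moreover have "I (\<lambda>x. ?f x + d * 1) = I ?f + I (\<lambda>x. d * 1)" by (rule I_add[OF fL scale[OF one]])
          moreover have "I (\<lambda>x. d * 1) = d * I (\<lambda>x. 1)" by (rule I_scale[OF one])
          moreover have "I (\<lambda>x. ?f x + h x) = I ?f + I h" by (rule I_add[OF fL h'(1)])
          ultimately show ?thesis by linarith
        qed
        have S: "0 \<le> I (\<lambda>x. ?f x + h x)" using fL h' by (intro I_nonneg add) auto
        have nn: "0 \<le> I f" "0 \<le> I h" "0 \<le> I (\<lambda>x. 1)" using f' h' one by (auto intro!: I_nonneg)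
        have "ennreal (I f) + ennreal (I h) = ennreal (I f + I h)" using nn by simp
        also have "\<dots> \<le> ennreal (I (\<lambda>x. ?f x + h x) + d * I (\<lambda>x. 1))" using le by (rule ennreal_leI)
        also have "\<dots> = ennreal (I (\<lambda>x. ?f x + h x)) + ennreal (d * I (\<lambda>x. 1))"
          using S nn d by (intro ennreal_plus) auto
        also have "ennreal (d * I (\<lambda>x. 1)) = ennreal d * ennreal (I (\<lambda>x. 1))" using nn d by (intro ennreal_mult) auto
        also have "ennreal (I (\<lambda>x. ?f x + h x)) + ennreal d * ennreal (I (\<lambda>x. 1))
            \<le> content G + ennreal d * ennreal (I (\<lambda>x. 1))"
          using in_below by (intro add_right_mono content_upper)
        finally show ?thesis .
      qed
      then have "(SUP h\<in>below ?G. ennreal (I f) + ennreal (I h)) \<le> content G + ennreal d * ennreal (I (\<lambda>x. 1))"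
        by (rule SUP_least)
      moreover have "below ?G \<noteq> {}" using zero_below by blast
      ultimately show ?thesis unfolding content_def[of ?G] by (simp add: ennreal_SUP_add_right)
    qed
    ultimately show ?thesis by (meson add_left_mono order_trans)
  qed
  have **: "ennreal (I f) + outer (G - D) \<le> content G" if f: "f \<in> below (G \<inter> D)" for f
  proof (rule ennreal_le_epsilon)
    fix e :: real assume e: "0 < e"
    have I1: "0 \<le> I (\<lambda>x. 1)" by (intro I_nonneg one) auto
    let ?d = "e / (I (\<lambda>x. 1) + 1)"
    have d: "0 < ?d" using e I1 by auto
    have "ennreal ?d * ennreal (I (\<lambda>x. 1)) = ennreal (?d * I (\<lambda>x. 1))" using I1 d by (intro ennreal_mult[symmetric]) auto
    also have "\<dots> \<le> ennreal e" using I1 e by (intro ennreal_leI) (auto simp: field_simps)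
    finally show "ennreal (I f) + outer (G - D) \<le> content G + ennreal e"
      using *[OF f d] by (meson add_left_mono order_trans)
  qed
  have "below (G \<inter> D) \<noteq> {}" using zero_below by blast
  then have "content (G \<inter> D) + outer (G - D) = (SUP f\<in>below (G \<inter> D). ennreal (I f) + outer (G - D))"
    unfolding content_def[of "G \<inter> D"] by (simp add: ennreal_SUP_add_left)
  also have "\<dots> \<le> content G" using ** by (rule SUP_least)
  finally show ?thesis .
qed

lemma open_in_lambda_system:
  assumes D: "open D"
  shows "D \<in> lambda_system UNIV UNIV outer"
proof -
  have "outer (D \<inter> E) + outer ((UNIV - D) \<inter> E) = outer E" for E
  proof (rule antisym)
    show "outer (D \<inter> E) + outer ((UNIV - D) \<inter> E) \<le> outer E"
      unfolding outer_def[of E]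
    proof (rule INF_greatest)
      fix G assume "G \<in> {G. open G \<and> E \<subseteq> G}"
      then have G: "open G" "E \<subseteq> G" by auto
      have "outer (D \<inter> E) \<le> content (G \<inter> D)"
        using outer_mono[of "D \<inter> E" "G \<inter> D"] outer_open[OF open_Int[OF G(1) D]] G(2) by auto
      moreover have "outer ((UNIV - D) \<inter> E) \<le> outer (G - D)" using G by (intro outer_mono) auto
      ultimately show "outer (D \<inter> E) + outer ((UNIV - D) \<inter> E) \<le> content G"
        using content_split[OF D G(1)] by (meson add_mono order_trans)
    qed
    have "outer E = outer (\<Union>i. binaryset (D \<inter> E) ((UNIV - D) \<inter> E) i)"
      by (simp only: UN_binaryset_eq) (rule arg_cong[of _ _ outer], auto)
    also have "\<dots> \<le> (\<Sum>i. outer (binaryset (D \<inter> E) ((UNIV - D) \<inter> E) i))" by (rule outer_UN_le)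
    also have "\<dots> = outer (D \<inter> E) + outer ((UNIV - D) \<inter> E)"
      by (simp add: suminf_binaryset_eq outer_empty)
    finally show "outer E \<le> outer (D \<inter> E) + outer ((UNIV - D) \<inter> E)" .
  qed
  then show ?thesis by (simp add: lambda_system_def)
qed

lemma exists_borel_measure:
  "\<exists>M. sets M = sets borel \<and> (\<forall>D. open D \<longrightarrow> emeasure M D = content D)"
proof -
  interpret sigma_algebra UNIV "UNIV :: 'a set set" using sigma_algebra_Pow[of UNIV] by simp
  have m: "measure_space UNIV (lambda_system UNIV UNIV outer) outer"
    by (rule caratheodory_lemma) (rule outer_measure_space_outer)
  have "sets borel \<subseteq> lambda_system UNIV UNIV outer"
  proof -
    have "sigma_algebra UNIV (lambda_system UNIV UNIV outer)" using m by (simp add: measure_space_def)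
    then have "sigma_sets UNIV {D. open D} \<subseteq> lambda_system UNIV UNIV outer"
      using open_in_lambda_system by (intro sigma_algebra.sigma_sets_subset) auto
    then show ?thesis by (simp add: borel_def)
  qed
  moreover have "sigma_algebra UNIV (sets (borel :: 'a measure))"
    using sets.sigma_algebra_axioms[of "borel :: 'a measure"] by simp
  ultimately have m': "measure_space UNIV (sets borel) outer" using measure_down[OF m] by blast
  let ?M = "measure_of UNIV (sets borel) outer"
  have "sets ?M = sets borel"
    using sets.sigma_sets_eq[of "borel :: 'a measure"] by (simp add: sets_measure_of)
  moreover have "emeasure ?M D = content D" if "open D" for D
  proof -
    have "emeasure ?M D = outer D"
      using m' that by (intro emeasure_measure_of_sigma) (auto simp: measure_space_def)
    with outer_open[OF that] show ?thesis by simp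
  qed
  ultimately show ?thesis by blast
qed

text \<open>Cut \<open>n f\<close> into \<open>n\<close> layers with values in \<open>[0, 1]\<close>. Both the functional and the integral of the \<open>k\<close>-th layer
  lie between the measures of \<open>{n f > k + 1}\<close> and \<open>{n f > k}\<close>, so the errors telescope to at most \<open>I 1 / n\<close>.\<close>

lemma integral_eq_functional_of_le_one:
  assumes M: "sets M = sets borel" "\<And>D. open D \<Longrightarrow> emeasure M D = content D"
    and f: "f \<in> L" "\<And>x. 0 \<le> f x" "\<And>x. f x \<le> 1"
  shows "integrable M f" and "(\<integral>x. f x \<partial>M) = I f"
proof -
  have sp: "space M = UNIV" using sets_eq_imp_space_eq[OF M(1)] by simp
  have UNIV: "emeasure M UNIV \<le> ennreal (I (\<lambda>x. 1))" using M(2)[of UNIV] content_UNIV_le by simp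
  interpret finite_measure M
    by (rule finite_measureI) (use UNIV in \<open>auto simp: sp top_unique\<close>)
  have I1: "0 \<le> I (\<lambda>x. 1)" by (intro I_nonneg one) auto
  have meas[measurable]: "g \<in> borel_measurable M" if "g \<in> L" for g
    using borel_measurable_continuous_onI[OF continuous[OF that]] M(1) measurable_cong_sets[OF M(1)] by blast
  have int: "integrable M g" if "g \<in> L" "\<And>x. 0 \<le> g x" "\<And>x. g x \<le> 1" for g
    using that by (intro integrable_const_bound[of _ 1]) auto
  show "integrable M f" using f by (rule int)
  have dist: "\<bar>(\<integral>x. f x \<partial>M) - I f\<bar> \<le> I (\<lambda>x. 1) / real n" if n: "0 < n" for n
  proof -
    define T where "T k x = min 1 (max 0 (real n * f x - real k))" for k x
    define D where "D k = {x. real k < real n * f x}" for k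
    have T: "T k \<in> L" "\<And>x. 0 \<le> T k x" "\<And>x. T k x \<le> 1" for k
      unfolding T_def using f by (auto intro!: min max diff scale const)
    have oD: "open (D k)" for k unfolding D_def
      using continuous[OF f(1)] by (intro open_Collect_less continuous_intros) auto
    have D_sets[measurable]: "D k \<in> sets M" for k using oD M(1) by auto
    have TD: "T k x \<le> indicator (D k) x" "indicator (D (Suc k)) x \<le> T k x" for k x
      by (auto simp: T_def D_def indicator_def)
    have measD: "ennreal (measure M (D k)) = content (D k)" for k
      using M(2)[OF oD] by (simp add: emeasure_eq_measure)
    have up: "I (T k) \<le> measure M (D k)" for k
    proof -
      have "T k \<in> below (D k)" using T TD by (simp add: below_def)
      from content_upper[OF this] have "ennreal (I (T k)) \<le> ennreal (measure M (D k))" by (simp add: measD)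
      then show ?thesis by (simp add: ennreal_le_iff)
    qed
    have lo: "measure M (D (Suc k)) \<le> I (T k)" for k
    proof -
      have "content (D (Suc k)) \<le> ennreal (I (T k))"
        unfolding content_def
      proof (intro SUP_least ennreal_leI I_mono T)
        fix g x assume "g \<in> below (D (Suc k))"
        then show "g \<in> L" "g x \<le> T k x" using TD(2)[of k x] by (auto simp: below_def intro: order_trans)
      qed
      then have "ennreal (measure M (D (Suc k))) \<le> ennreal (I (T k))" by (simp add: measD)
      then show ?thesis using I_nonneg[OF T(1,2)] by (simp add: ennreal_le_iff)
    qed
    have sumT: "(\<Sum>k<m. T k x) = min (real m) (real n * f x)" for m x
    proof (induction m)
      case 0 then show ?case using f(2)[of x] by simp
    next
      case (Suc m) then show ?case by (simp add: T_def)
    qed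
    have sumT': "(\<lambda>x. \<Sum>k<n. T k x) = (\<lambda>x. real n * f x)"
      using f(3) n by (simp add: sumT min_absorb2 mult_left_le)
    have A: "real n * I f = (\<Sum>k<n. I (T k))"
      using I_sum[of "{..<n}" T] T I_scale[OF f(1)] by (simp add: sumT')
    have B: "real n * (\<integral>x. f x \<partial>M) = (\<Sum>k<n. \<integral>x. T k x \<partial>M)"
    proof -
      have "(\<integral>x. (\<Sum>k<n. T k x) \<partial>M) = (\<Sum>k<n. \<integral>x. T k x \<partial>M)"
        using int[OF T] by (rule Bochner_Integration.integral_sum)
      then show ?thesis unfolding sumT' by simp
    qed
    have ind: "integrable M (indicator (D k) :: _ \<Rightarrow> real)" for k
      by (intro integrable_real_indicator D_sets) (simp add: emeasure_eq_measure)
    have up': "(\<integral>x. T k x \<partial>M) \<le> measure M (D k)" for k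
      using integral_mono[OF int[OF T] ind, of k k] TD by (simp add: sp)
    have lo': "measure M (D (Suc k)) \<le> (\<integral>x. T k x \<partial>M)" for k
      using integral_mono[OF ind int[OF T], of "Suc k" k] TD by (simp add: sp)
    have "\<bar>real n * (\<integral>x. f x \<partial>M) - real n * I f\<bar> = \<bar>\<Sum>k<n. (\<integral>x. T k x \<partial>M) - I (T k)\<bar>"
      by (simp add: A B sum_subtractf)
    also have "\<dots> \<le> (\<Sum>k<n. measure M (D k) - measure M (D (Suc k)))"
    proof (rule order_trans[OF sum_abs], rule sum_mono)
      fix k
      show "\<bar>(\<integral>x. T k x \<partial>M) - I (T k)\<bar> \<le> measure M (D k) - measure M (D (Suc k))"
        using up[of k] lo[of k] up'[of k] lo'[of k] by linarith
    qed
    also have "\<dots> = measure M (D 0) - measure M (D n)" by (rule sum_lessThan_telescope')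
    also have "\<dots> \<le> I (\<lambda>x. 1)"
    proof -
      have "ennreal (measure M (D 0)) \<le> ennreal (I (\<lambda>x. 1))" using measD content_UNIV_le by simp
      then have "measure M (D 0) \<le> I (\<lambda>x. 1)" using I1 by (simp add: ennreal_le_iff)
      then show ?thesis using measure_nonneg[of M "D n"] by linarith
    qed
    finally have "real n * \<bar>(\<integral>x. f x \<partial>M) - I f\<bar> \<le> I (\<lambda>x. 1)"
      by (simp add: abs_mult right_diff_distrib[symmetric])
    then show ?thesis using n by (simp add: field_simps)
  qed
  have "(\<lambda>n. I (\<lambda>x. 1) / real n) \<longlonglongrightarrow> 0" by (rule lim_const_over_n)
  then have "\<bar>(\<integral>x. f x \<partial>M) - I f\<bar> \<le> 0"
    by (rule LIMSEQ_le_const) (use dist in \<open>auto intro!: exI[of _ 1]\<close>)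
  then show "(\<integral>x. f x \<partial>M) = I f" by simp
qed

theorem representing_measure:
  "\<exists>M. sets M = sets borel \<and> (\<forall>f\<in>L. (\<forall>x. 0 \<le> f x) \<longrightarrow> (\<integral>\<^sup>+x. f x \<partial>M) = ennreal (I f))"
proof -
  obtain M where "sets M = sets borel \<and> (\<forall>D. open D \<longrightarrow> emeasure M D = content D)"
    using exists_borel_measure by (rule exE)
  then have M: "sets M = sets borel" "\<And>D. open D \<Longrightarrow> emeasure M D = content D" by simp_all
  have "(\<integral>\<^sup>+x. f x \<partial>M) = ennreal (I f)" if f: "f \<in> L" "\<forall>x. 0 \<le> f x" for f
  proof -
    define F where "F n = (\<lambda>x. min (f x) (real (Suc n)))" for n
    have F: "F n \<in> L" "0 \<le> F n x" "F n x \<le> F (Suc n) x" for n x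
      using min[OF f(1) const] f(2) by (simp_all add: F_def)
    have *: "(\<integral>\<^sup>+x. F n x \<partial>M) = ennreal (I (F n))" for n
    proof -
      let ?g = "\<lambda>x. inverse (real (Suc n)) * F n x"
      have "0 \<le> ?g x \<and> ?g x \<le> 1" for x
        using F(2)[of n x] by (simp add: F_def field_simps)
      then have g: "?g \<in> L" "\<And>x. 0 \<le> ?g x" "\<And>x. ?g x \<le> 1"
        using scale[OF F(1)] by blast+
      note int = integral_eq_functional_of_le_one[OF M g]
      have eq: "F n = (\<lambda>x. real (Suc n) * ?g x)" by (simp add: fun_eq_iff)
      have "integrable M (F n) = integrable M (\<lambda>x. real (Suc n) * ?g x)" using eq by (rule arg_cong)
      moreover have "integrable M (\<lambda>x. real (Suc n) * ?g x)" using int(1) by (rule integrable_mult_right)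
      ultimately have intF: "integrable M (F n)" by blast
      have "integral\<^sup>L M (F n) = integral\<^sup>L M (\<lambda>x. real (Suc n) * ?g x)" using eq by (rule arg_cong)
      also have "\<dots> = real (Suc n) * integral\<^sup>L M ?g" by (rule integral_mult_right_zero)
      also have "\<dots> = real (Suc n) * (inverse (real (Suc n)) * I (F n))"
        by (rule arg_cong[OF trans[OF int(2) I_scale[OF F(1)]]])
      also have "\<dots> = I (F n)" by simp
      finally have "integrable M (F n)" "integral\<^sup>L M (F n) = I (F n)" using intF by blast+
      then show ?thesis using F(2) by (subst nn_integral_eq_integral) auto
    qed
    have SUP: "ennreal (f x) = (SUP n. ennreal (F n x))" for x
    proof -
      obtain n where "f x \<le> real n" using real_arch_simple by blast
      then have "F n x = f x" by (simp add: F_def)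
      then show ?thesis
        by (intro antisym SUP_upper2[of n] SUP_least ennreal_leI) (auto simp: F_def)
    qed
    have meas: "F n \<in> borel_measurable M" for n
      using borel_measurable_continuous_onI[OF continuous[OF F(1)]] measurable_cong_sets[OF M(1)] by blast
    have "(\<integral>\<^sup>+x. f x \<partial>M) = (SUP n. \<integral>\<^sup>+x. F n x \<partial>M)"
      unfolding SUP using F meas
      by (intro nn_integral_monotone_convergence_SUP) (auto intro!: incseq_SucI le_funI ennreal_leI)
    also have "\<dots> = (SUP n. ennreal (I (F n)))" by (simp add: *)
    also have "\<dots> = ennreal (I f)"
    proof (rule antisym)
      show "(SUP n. ennreal (I (F n))) \<le> ennreal (I f)"
        by (intro SUP_least ennreal_leI I_mono F f) (simp add: F_def)
      show "ennreal (I f) \<le> (SUP n. ennreal (I (F n)))"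
      proof (rule ennreal_le_epsilon)
        fix e :: real assume e: "0 < e"
        have "\<exists>n. f x \<le> F n x + d" if "0 < d" for x d
        proof -
          obtain n where "f x \<le> real n" using real_arch_simple by blast
          then show ?thesis using that by (intro exI[of _ n]) (simp add: F_def)
        qed
        from I_le_of_approximation[OF f(1) F(1,3) this e] obtain n where "I f \<le> I (F n) + e" by blast
        then have "ennreal (I f) \<le> ennreal (I (F n)) + ennreal e"
          using e by (subst ennreal_plus[symmetric]) (auto intro!: I_nonneg F ennreal_leI)
        also have "\<dots> \<le> (SUP n. ennreal (I (F n))) + ennreal e"
          by (intro add_right_mono SUP_upper) simp
        finally show "ennreal (I f) \<le> (SUP n. ennreal (I (F n))) + ennreal e" .
      qed
    qed
    finally show ?thesis .
  qed
  with M(1) show ?thesis by blast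
qed

end

section \<open>Continuous potentials\<close>

text \<open>For each \<open>d\<close> in a countable dense set the open sets \<open>{v > d}\<close> have a countable subfamily with the same
  union, by Lindelof's theorem; collect these subfamilies.\<close>

lemma countable_subfamily_SUP_eq:
  fixes C :: "('a::second_countable_topology \<Rightarrow> ennreal) set"
  assumes lsc: "\<And>v. v \<in> C \<Longrightarrow> lower_semicontinuous euclidean v" and "C \<noteq> {}"
  shows "\<exists>v::nat \<Rightarrow> 'a \<Rightarrow> ennreal. range v \<subseteq> C \<and> (\<forall>x. (SUP n. v n x) = (SUP v\<in>C. v x))"
proof -
  obtain D :: "ennreal set" where D: "countable D" "\<And>X. open X \<Longrightarrow> X \<noteq> {} \<Longrightarrow> \<exists>d\<in>D. d \<in> X"
    using countable_dense_setE by metis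
  have "\<exists>C'\<subseteq>C. countable C' \<and> (\<Union>v\<in>C'. {x. d < v x}) = (\<Union>v\<in>C. {x. d < v x})" for d
  proof -
    obtain \<F> where \<F>: "\<F> \<subseteq> (\<lambda>v. {x. d < v x}) ` C" "countable \<F>" "\<Union>\<F> = (\<Union>v\<in>C. {x. d < v x})"
      using Lindelof_openin[of "(\<lambda>v. {x. d < v x}) ` C" UNIV] lsc
      by (auto simp: lower_semicontinuous_euclidean openin_subtopology_self)
    then obtain C' where "C' \<subseteq> C" "countable C'" "\<F> = (\<lambda>v. {x. d < v x}) ` C'"
      using countable_subset_image by metis
    with \<F>(3) show ?thesis by blast
  qed
  then obtain C' where C': "\<And>d. C' d \<subseteq> C" "\<And>d. countable (C' d)"
    "\<And>d. (\<Union>v\<in>C' d. {x. d < v x}) = (\<Union>v\<in>C. {x. d < v x})" by metis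
  obtain v0 where "v0 \<in> C" using \<open>C \<noteq> {}\<close> by blast
  define E where "E = insert v0 (\<Union>d\<in>D. C' d)"
  have E: "countable E" "E \<noteq> {}" "E \<subseteq> C" using C' D(1) \<open>v0 \<in> C\<close> by (auto simp: E_def)
  have "(SUP v\<in>E. v x) = (SUP v\<in>C. v x)" for x
  proof (rule antisym)
    show "(SUP v\<in>E. v x) \<le> (SUP v\<in>C. v x)" using E by (intro SUP_subset_mono) auto
    show "(SUP v\<in>C. v x) \<le> (SUP v\<in>E. v x)"
    proof (rule SUP_least, rule ccontr)
      fix v assume v: "v \<in> C" and "\<not> v x \<le> (SUP v\<in>E. v x)"
      then have "{(SUP v\<in>E. v x)<..<v x} \<noteq> {}" using dense by (auto simp: not_le)
      then obtain d where d: "d \<in> D" "(SUP v\<in>E. v x) < d" "d < v x"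
        using D(2)[OF open_greaterThanLessThan] by auto
      with v have "x \<in> (\<Union>v\<in>C. {x. d < v x})" by blast
      then obtain w where "w \<in> C' d" "d < w x" unfolding C'(3)[symmetric] by blast
      then have "d < (SUP v\<in>E. v x)" using d(1) by (intro less_SUP_iff[THEN iffD2]) (auto simp: E_def)
      with d(2) show False by simp
    qed
  qed
  moreover have range: "range (from_nat_into E) = E" using E by (intro range_from_nat_into)
  moreover have "(SUP n. from_nat_into E n x) = (SUP v\<in>range (from_nat_into E). v x)" for x
    by (simp add: image_image)
  ultimately show ?thesis using E(3) by (intro exI[of _ "from_nat_into E"]) simp
qed

lemma continuous_on_enn2real:
  assumes "continuous_on S f" and fin: "\<And>x. x \<in> S \<Longrightarrow> f x < top"
  shows "continuous_on S (\<lambda>x. enn2real (f x))"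
  unfolding continuous_on_def
proof
  fix x assume x: "x \<in> S"
  then have "(f \<longlongrightarrow> ennreal (enn2real (f x))) (at x within S)"
    using assms(1) fin[OF x] by (simp add: continuous_on_def)
  then show "((\<lambda>x. enn2real (f x)) \<longlongrightarrow> enn2real (f x)) (at x within S)"
    by (rule tendsto_enn2real) simp
qed

text \<open>The functions \<open>u\<close> and \<open>v\<close> of (B4)(iii), fixed as real functions. The weight \<open>v0\<close> controls functions at
  infinity: errors of size \<open>e * v0\<close> are allowed, since \<open>v0\<close> is in \<open>W\<close>.\<close>

locale weighted_balayage_space = balayage_space W
  for W :: "('a::{t2_space, second_countable_topology} \<Rightarrow> ennreal) set" +
  fixes u0 v0 :: "'a \<Rightarrow> real"
  assumes u0_pos: "0 < u0 x" and v0_pos: "0 < v0 x"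
    and u0_mem: "(\<lambda>x. ennreal (u0 x)) \<in> W" and v0_mem: "(\<lambda>x. ennreal (v0 x)) \<in> W"
    and u0_cont: "continuous_on UNIV u0" and v0_cont: "continuous_on UNIV v0"
    and u0_small: "0 < e \<Longrightarrow> \<exists>K. compact K \<and> (\<forall>x. x \<notin> K \<longrightarrow> u0 x \<le> e * v0 x)"

lemma (in balayage_space) exists_weights: "\<exists>u0 v0. weighted_balayage_space W u0 v0"
proof -
  obtain u v where u: "u \<in> continuous_real_part W" "\<And>x. 0 < u x"
    and v: "v \<in> continuous_real_part W" "\<And>x. 0 < v x" and
    uv: "vanishes_at_infinity (\<lambda>x. u x / v x)" using B4_iii by blast
  have fin: "u x < top" "v x < top" for x using u v by (auto simp: continuous_real_part_def)
  let ?u = "\<lambda>x. enn2real (u x)" and ?v = "\<lambda>x. enn2real (v x)"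
  have "weighted_balayage_space W ?u ?v"
  proof
    show "0 < ?u x" "0 < ?v x" for x using u(2) v(2) fin by (auto simp: enn2real_positive_iff)
    show "(\<lambda>x. ennreal (?u x)) \<in> W" "(\<lambda>x. ennreal (?v x)) \<in> W"
      using u v fin by (simp_all add: continuous_real_part_def)
    have "continuous_on UNIV (\<lambda>x. enn2real (w x))" if "w \<in> continuous_real_part W" for w
      using that by (intro continuous_on_enn2real) (simp_all add: continuous_real_part_def)
    then show "continuous_on UNIV ?u" "continuous_on UNIV ?v" using u v by blast+
    fix e :: real assume e: "0 < e"
    then have "0 < ennreal e" by simp
    with uv obtain K where K: "compact K" "\<And>x. x \<notin> K \<Longrightarrow> u x / v x < ennreal e"
      unfolding vanishes_at_infinity_def by blast
    have "?u x \<le> e * ?v x" if "x \<notin> K" for x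
    proof -
      have pos: "0 < ?v x" using v(2) fin by (auto simp: enn2real_positive_iff)
      have "u x / v x = ennreal (?u x) / ennreal (?v x)" using fin by simp
      also have "\<dots> = ennreal (?u x / ?v x)" using pos by (intro divide_ennreal) auto
      finally have "ennreal (?u x / ?v x) < ennreal e" using K(2)[OF that] by simp
      then have "?u x / ?v x < e" using e by (subst (asm) ennreal_less_iff) auto
      then show ?thesis using pos by (simp add: field_simps)
    qed
    then show "\<exists>K. compact K \<and> (\<forall>x. x \<notin> K \<longrightarrow> ?u x \<le> e * ?v x)" using K(1) by blast
  qed
  then show ?thesis by blast
qed

context weighted_balayage_space
begin

text \<open>In the theory of balayage spaces these functions are continuous potentials. The bound by \<open>v0\<close> extends
  Dini's theorem from compact sets to the whole space. The functions are real because their differences are needed.\<close>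

definition tame :: "('a \<Rightarrow> real) set" where
  "tame = {p. (\<forall>x. 0 \<le> p x) \<and> (\<lambda>x. ennreal (p x)) \<in> W \<and> continuous_on UNIV p \<and>
     (\<forall>e>0. \<exists>K. compact K \<and> (\<forall>x. x \<notin> K \<longrightarrow> p x \<le> e * v0 x))}"

lemma tameD:
  assumes "p \<in> tame"
  shows "0 \<le> p x" "(\<lambda>x. ennreal (p x)) \<in> W" "continuous_on UNIV p"
    "0 < e \<Longrightarrow> \<exists>K. compact K \<and> (\<forall>x. x \<notin> K \<longrightarrow> p x \<le> e * v0 x)"
  using assms by (auto simp: tame_def)

lemma u0_tame: "u0 \<in> tame"
  using u0_mem u0_cont u0_small u0_pos by (auto simp: tame_def intro: less_imp_le)

lemma tame_le:
  assumes "p \<in> tame" and "\<And>x. 0 \<le> s x" and "(\<lambda>x. ennreal (s x)) \<in> W" and "continuous_on UNIV s"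
    and "\<And>x. s x \<le> p x"
  shows "s \<in> tame"
  unfolding tame_def
proof (intro CollectI conjI allI impI)
  fix e :: real assume "0 < e"
  then obtain K where "compact K" "\<And>x. x \<notin> K \<Longrightarrow> p x \<le> e * v0 x" using tameD(4)[OF assms(1)] by blast
  then show "\<exists>K. compact K \<and> (\<forall>x. x \<notin> K \<longrightarrow> s x \<le> e * v0 x)"
    using assms(5) order_trans by blast
qed (use assms in auto)

lemma tame_add:
  assumes p: "p \<in> tame" and q: "q \<in> tame"
  shows "(\<lambda>x. p x + q x) \<in> tame"
  unfolding tame_def
proof (intro CollectI conjI allI impI)
  show "0 \<le> p x + q x" for x using tameD(1)[OF p] tameD(1)[OF q] by simp
  show "continuous_on UNIV (\<lambda>x. p x + q x)" by (intro continuous_on_add tameD p q)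
  show "(\<lambda>x. ennreal (p x + q x)) \<in> W"
    using add_mem[OF tameD(2)[OF p] tameD(2)[OF q]] tameD(1)[OF p] tameD(1)[OF q] by simp
  fix e :: real assume "0 < e"
  then have "0 < e/2" by simp
  from tameD(4)[OF p this] tameD(4)[OF q this] obtain K K' where
    K: "compact K" "\<And>x. x \<notin> K \<Longrightarrow> p x \<le> e/2 * v0 x" "compact K'" "\<And>x. x \<notin> K' \<Longrightarrow> q x \<le> e/2 * v0 x"
    by blast
  have "p x + q x \<le> e * v0 x" if "x \<notin> K \<union> K'" for x
    using that K(2)[of x] K(4)[of x] by (simp add: field_simps)
  then show "\<exists>K. compact K \<and> (\<forall>x. x \<notin> K \<longrightarrow> p x + q x \<le> e * v0 x)"
    using compact_Un[OF K(1,3)] by blast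
qed

lemma tame_scale:
  assumes p: "p \<in> tame" and c: "0 \<le> c"
  shows "(\<lambda>x. c * p x) \<in> tame"
  unfolding tame_def
proof (intro CollectI conjI allI impI)
  show "0 \<le> c * p x" for x using tameD(1)[OF p] c by simp
  show "continuous_on UNIV (\<lambda>x. c * p x)" by (intro continuous_on_mult_left tameD p)
  show "(\<lambda>x. ennreal (c * p x)) \<in> W"
    using scale_mem[OF tameD(2)[OF p] c] c tameD(1)[OF p] by (simp add: ennreal_mult)
  fix e :: real assume "0 < e"
  then have "0 < e / (c + 1)" using c by simp
  from tameD(4)[OF p this] obtain K where K: "compact K" "\<And>x. x \<notin> K \<Longrightarrow> p x \<le> e / (c + 1) * v0 x" by blast
  have "c * p x \<le> e * v0 x" if "x \<notin> K" for x
  proof -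
    have "c * p x \<le> (c + 1) * p x" using tameD(1)[OF p] by (simp add: mult_right_mono)
    also have "\<dots> \<le> (c + 1) * (e / (c + 1) * v0 x)" using K(2)[OF that] c by (intro mult_left_mono) auto
    also have "\<dots> = e * v0 x" using c by simp
    finally show ?thesis .
  qed
  with K(1) show "\<exists>K. compact K \<and> (\<forall>x. x \<notin> K \<longrightarrow> c * p x \<le> e * v0 x)" by blast
qed

lemma ennreal_min: "0 \<le> a \<Longrightarrow> 0 \<le> b \<Longrightarrow> ennreal (min a b) = min (ennreal a) (ennreal b)"
  by (auto simp: min_def ennreal_le_iff)

lemma tame_min:
  assumes p: "p \<in> tame" and w: "(\<lambda>x. ennreal (w x)) \<in> W" "continuous_on UNIV w" "\<And>x. 0 \<le> w x"
  shows "(\<lambda>x. min (p x) (w x)) \<in> tame"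
proof (rule tame_le[OF p])
  show "(\<lambda>x. ennreal (min (p x) (w x))) \<in> W"
    using min_mem[OF tameD(2)[OF p] w(1)] tameD(1)[OF p] w(3) by (simp add: ennreal_min)
  show "continuous_on UNIV (\<lambda>x. min (p x) (w x))" by (intro continuous_on_min tameD p w)
qed (use tameD(1)[OF p] w(3) in simp_all)

text \<open>Specific minorants of a continuous function are continuous. With Mokobodzki's decomposition this is the
  source of all continuous reductions.\<close>

lemma tame_specific_minorant:
  assumes p: "p \<in> tame" and s: "s \<in> W" and t: "t \<in> W" and eq: "\<And>x. ennreal (p x) = s x + t x"
  shows "(\<lambda>x. enn2real (s x)) \<in> tame" and "s x < top"
proof -
  have le: "s x \<le> ennreal (p x)" for x unfolding eq by simp
  have fin: "s x < top" for x using le[of x] ennreal_less_top by (rule le_less_trans)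
  show "s x < top" by (rule fin)
  have "continuous_on UNIV s"
  proof (rule continuous_on_summand[OF lsc[OF s] lsc[OF t]])
    show "continuous_on UNIV (\<lambda>x. ennreal (p x))" by (intro continuous_on_ennreal tameD p)
  qed (simp_all add: eq[symmetric])
  then have "continuous_on UNIV (\<lambda>x. enn2real (s x))"
    using fin by (intro continuous_on_enn2real)
  moreover have "enn2real (s x) \<le> p x" for x
    using tameD(1)[OF p] le by (intro enn2real_leI)
  moreover have "(\<lambda>x. ennreal (enn2real (s x))) \<in> W" using s fin by simp
  ultimately show "(\<lambda>x. enn2real (s x)) \<in> tame" by (intro tame_le[OF p]) simp_all
qed

text \<open>By Mokobodzki's decomposition the smallest majorant is a specific minorant of \<open>p\<close>, hence continuous.\<close>

lemma reduced_diff_tame: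
  assumes p: "p \<in> tame" and q: "q \<in> tame"
  obtains r where "r \<in> tame" "\<And>x. p x - q x \<le> r x" "\<And>x. r x \<le> p x"
    "\<And>w x. w \<in> W \<Longrightarrow> (\<And>y. ennreal (p y - q y) \<le> w y) \<Longrightarrow> ennreal (r x) \<le> w x"
proof -
  let ?R = "reduced W (\<lambda>x. ennreal (p x) - ennreal (q x)) UNIV"
  note m = reduced_diff_specific_minorant[OF tameD(2)[OF p] tameD(2)[OF q]]
  have R: "?R \<in> W" by (rule m) simp
  from m(2) obtain t where t: "t \<in> W" "\<And>x. ennreal (p x) = ?R x + t x" by auto
  note R' = tame_specific_minorant[OF p R t]
  let ?r = "\<lambda>x. enn2real (?R x)"
  have r: "ennreal (?r x) = ?R x" for x using R'(2)[of x] by simp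
  have d: "ennreal (p x) - ennreal (q x) = ennreal (p x - q x)" for x
    using tameD(1)[OF q] by (simp add: ennreal_minus)
  show ?thesis
  proof
    show "?r \<in> tame" by (rule R')
    show "p x - q x \<le> ?r x" for x
    proof -
      have "ennreal (p x - q x) \<le> ennreal (?r x)" unfolding r d[symmetric] by (rule reduced_upper) simp
      then show ?thesis using ennreal_le_iff[OF enn2real_nonneg] by blast
    qed
    show "?r x \<le> p x" for x
    proof -
      have "?R x \<le> ennreal (p x)" using t(2) by (metis le_iff_add)
      then show ?thesis using tameD(1)[OF p] by (intro enn2real_leI)
    qed
    show "ennreal (?r x) \<le> w x" if "w \<in> W" "\<And>y. ennreal (p y - q y) \<le> w y" for w x
      unfolding r using that by (intro reduced_lower) (auto simp: d)
  qed
qed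

lemma tame_zero: "(\<lambda>x. 0) \<in> tame"
  using tame_scale[OF u0_tame, of 0] by simp

lemma tame_min2: "p \<in> tame \<Longrightarrow> q \<in> tame \<Longrightarrow> (\<lambda>x. min (p x) (q x)) \<in> tame"
  by (intro tame_min tameD)

text \<open>The maximum of \<open>p\<close> and \<open>q\<close> is the difference of \<open>p + q\<close> and \<open>min p q\<close>, both tame.\<close>

lemma tame_max_majorant:
  assumes p: "p \<in> tame" and q: "q \<in> tame"
  obtains r where "r \<in> tame" "\<And>x. p x \<le> r x" "\<And>x. q x \<le> r x"
    "\<And>w x. w \<in> W \<Longrightarrow> (\<And>y. ennreal (p y) \<le> w y) \<Longrightarrow> (\<And>y. ennreal (q y) \<le> w y) \<Longrightarrow> ennreal (r x) \<le> w x"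
proof -
  have eq: "(p x + q x) - min (p x) (q x) = max (p x) (q x)" for x by (simp add: min_def max_def)
  obtain r where r: "r \<in> tame" "\<And>x. max (p x) (q x) \<le> r x"
    "\<And>w x. w \<in> W \<Longrightarrow> (\<And>y. ennreal (max (p y) (q y)) \<le> w y) \<Longrightarrow> ennreal (r x) \<le> w x"
    using reduced_diff_tame[OF tame_add[OF p q] tame_min2[OF p q]] unfolding eq by metis
  show ?thesis
  proof
    show "r \<in> tame" by (rule r)
    show "p x \<le> r x" "q x \<le> r x" for x using r(2)[of x] by simp_all
    show "ennreal (r x) \<le> w x" if "w \<in> W" "\<And>y. ennreal (p y) \<le> w y" "\<And>y. ennreal (q y) \<le> w y" for w x
      using r(3)[OF that(1)] that(2,3) by (simp add: max_def)
  qed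
qed

lemma SUP_tame_eq:
  assumes w: "w \<in> W"
  shows "w x = (SUP p\<in>{p \<in> tame. \<forall>y. ennreal (p y) \<le> w y}. ennreal (p x))"
proof (rule antisym)
  let ?C = "{p \<in> tame. \<forall>y. ennreal (p y) \<le> w y}"
  show "(SUP p\<in>?C. ennreal (p x)) \<le> w x" by (rule SUP_least) simp
  show "w x \<le> (SUP p\<in>?C. ennreal (p x))"
  proof (rule dense_le)
    fix a assume "a < w x"
    also have "w x = (SUP v\<in>{v \<in> continuous_real_part W. v \<le> w}. v x)"
      using fun_cong[OF B4_ii[OF w], of x] by simp
    finally obtain v where v: "v \<in> continuous_real_part W" "v \<le> w" "a < v x"
      by (auto simp: less_SUP_iff)
    have v': "v \<in> W" "continuous_on UNIV v" "\<And>x. v x < top" using v(1) by (auto simp: continuous_real_part_def)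
    let ?v = "\<lambda>x. enn2real (v x)"
    obtain n :: nat where "?v x / u0 x < real n" using reals_Archimedean2 by blast
    then have n: "?v x \<le> real n * u0 x" using u0_pos[of x] by (simp add: field_simps)
    let ?p = "\<lambda>y. min (real n * u0 y) (?v y)"
    have "?p \<in> tame"
      using v' by (intro tame_min tame_scale u0_tame continuous_on_enn2real) simp_all
    moreover have "ennreal (?p y) \<le> w y" for y
    proof -
      have "ennreal (?p y) \<le> ennreal (?v y)" by (rule ennreal_leI) simp
      also have "\<dots> = v y" using v'(3) by simp
      also have "\<dots> \<le> w y" using v(2) by (rule le_funD)
      finally show ?thesis .
    qed
    ultimately have "ennreal (?p x) \<le> (SUP p\<in>?C. ennreal (p x))" by (intro SUP_upper) simp
    moreover have "ennreal (?p x) = v x" using n v'(3) by (simp add: min_absorb2)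
    ultimately show "a \<le> (SUP p\<in>?C. ennreal (p x))" using v(3) by simp
  qed
qed

text \<open>A countable subfamily with the same supremum exists; directedness makes it increasing.\<close>

lemma directed_tame_sequence:
  assumes C: "C \<subseteq> tame" "C \<noteq> {}"
    and directed: "\<forall>p\<in>C. \<forall>q\<in>C. \<exists>r\<in>C. \<forall>x. p x \<le> r x \<and> q x \<le> r x"
  shows "\<exists>p. (\<forall>n::nat. p n \<in> C) \<and> (\<forall>n x. p n x \<le> p (Suc n) x) \<and>
    (\<forall>x. (SUP n. ennreal (p n x)) = (SUP p\<in>C. ennreal (p x)))"
proof -
  let ?D = "(\<lambda>p x. ennreal (p x)) ` C"
  have "\<exists>v::nat \<Rightarrow> 'a \<Rightarrow> ennreal. range v \<subseteq> ?D \<and> (\<forall>x. (SUP n. v n x) = (SUP v\<in>?D. v x))"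
  proof (rule countable_subfamily_SUP_eq)
    show "lower_semicontinuous euclidean v" if "v \<in> ?D" for v using that lsc tameD(2) C(1) by blast
    show "?D \<noteq> {}" using C(2) by blast
  qed
  then obtain v :: "nat \<Rightarrow> 'a \<Rightarrow> ennreal" where
    v: "range v \<subseteq> ?D \<and> (\<forall>x. (SUP n. v n x) = (SUP v\<in>?D. v x))" by (rule exE)
  have "v n \<in> ?D" for n using v[THEN conjunct1] by (rule subsetD) (rule rangeI)
  then have "\<forall>n. \<exists>p. p \<in> C \<and> v n = (\<lambda>x. ennreal (p x))" unfolding image_iff by blast
  from choice[OF this] obtain q where q: "\<And>n. q n \<in> C" "\<And>n. v n = (\<lambda>x. ennreal (q n x))" by blast
  have SUP_q: "(SUP n. ennreal (q n x)) = (SUP p\<in>C. ennreal (p x))" for x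
    using v[THEN conjunct2, THEN spec, of x] q(2) by (simp add: image_image)
  have "\<exists>p. \<forall>n. p n \<in> C \<and> (\<forall>x. p n x \<le> p (Suc n) x \<and> q n x \<le> p (Suc n) x)"
  proof (rule dependent_nat_choice)
    show "\<exists>p. p \<in> C" using C(2) by blast
    show "\<exists>r. r \<in> C \<and> (\<forall>x. p x \<le> r x \<and> q n x \<le> r x)" if "p \<in> C" for p n
      using directed that q(1)[of n] by blast
  qed
  then obtain p where p: "\<And>n. p n \<in> C" "\<And>n x. p n x \<le> p (Suc n) x" "\<And>n x. q n x \<le> p (Suc n) x"
    by blast
  have "(SUP n. ennreal (p n x)) = (SUP p\<in>C. ennreal (p x))" for x
  proof (rule antisym)
    show "(SUP n. ennreal (p n x)) \<le> (SUP p\<in>C. ennreal (p x))" by (intro SUP_least SUP_upper p)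
    show "(SUP p\<in>C. ennreal (p x)) \<le> (SUP n. ennreal (p n x))"
      unfolding SUP_q[symmetric] by (rule SUP_least) (meson SUP_upper2 UNIV_I ennreal_leI p(3))
  qed
  with p(1,2) show ?thesis by (intro exI[of _ p]) simp
qed

lemma increasing_tame_approximation:
  assumes w: "w \<in> W"
  obtains p where "\<And>n::nat. p n \<in> tame" "\<And>n x. p n x \<le> p (Suc n) x"
    "\<And>x. w x = (SUP n. ennreal (p n x))"
proof -
  let ?C = "{p \<in> tame. \<forall>y. ennreal (p y) \<le> w y}"
  have directed: "\<exists>r\<in>?C. \<forall>x. p x \<le> r x \<and> q x \<le> r x" if "p \<in> ?C" "q \<in> ?C" for p q
  proof -
    have "p \<in> tame" "q \<in> tame" using that by simp_all
    then obtain r where "r \<in> tame" "\<And>x. p x \<le> r x" "\<And>x. q x \<le> r x"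
      "\<And>w x. w \<in> W \<Longrightarrow> (\<And>y. ennreal (p y) \<le> w y) \<Longrightarrow> (\<And>y. ennreal (q y) \<le> w y) \<Longrightarrow> ennreal (r x) \<le> w x"
      by (rule tame_max_majorant) blast
    then show ?thesis using w that by blast
  qed
  have "(\<lambda>x. 0) \<in> ?C" using tame_zero by simp
  then have nonempty: "?C \<noteq> {}" by (rule ex_in_conv[THEN iffD1, OF exI])
  have "?C \<subseteq> tame" by (rule Collect_restrict)
  then have "\<exists>p. (\<forall>n::nat. p n \<in> ?C) \<and> (\<forall>n x. p n x \<le> p (Suc n) x) \<and>
      (\<forall>x. (SUP n. ennreal (p n x)) = (SUP p\<in>?C. ennreal (p x)))"
    using nonempty directed by (intro directed_tame_sequence ballI)
  then obtain p :: "nat \<Rightarrow> 'a \<Rightarrow> real" where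
    P: "(\<forall>n. p n \<in> ?C) \<and> (\<forall>n x. p n x \<le> p (Suc n) x) \<and>
      (\<forall>x. (SUP n. ennreal (p n x)) = (SUP p\<in>?C. ennreal (p x)))" by (rule exE)
  note p = P[THEN conjunct1, THEN spec] P[THEN conjunct2, THEN conjunct1, THEN spec, THEN spec]
    P[THEN conjunct2, THEN conjunct2, THEN spec]
  show ?thesis
  proof (rule that)
    show "p n \<in> tame" for n using p(1)[of n] by simp
    show "p n x \<le> p (Suc n) x" for n x by (rule p)
    show "w x = (SUP n. ennreal (p n x))" for x unfolding p(3) by (rule SUP_tame_eq[OF w])
  qed
qed

text \<open>A vector lattice of continuous functions, on which the functionals \<open>p \<mapsto> R\<^sub>p\<^sup>A(x)\<close> will be extended
  linearly.\<close>

definition tame_diff :: "('a \<Rightarrow> real) set" where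
  "tame_diff = {\<lambda>x. p x - q x | p q. p \<in> tame \<and> q \<in> tame}"

lemma tame_diffI: "p \<in> tame \<Longrightarrow> q \<in> tame \<Longrightarrow> (\<lambda>x. p x - q x) \<in> tame_diff"
  unfolding tame_diff_def by blast

lemma tame_diffE:
  assumes "d \<in> tame_diff"
  obtains p q where "p \<in> tame" "q \<in> tame" "d = (\<lambda>x. p x - q x)"
  using assms unfolding tame_diff_def by blast

lemma tame_diff_tame: "p \<in> tame \<Longrightarrow> p \<in> tame_diff"
  using tame_diffI[OF _ tame_zero] by force

lemma tame_diff_add:
  assumes "d \<in> tame_diff" and "e \<in> tame_diff"
  shows "(\<lambda>x. d x + e x) \<in> tame_diff"
proof -
  obtain p q where d: "p \<in> tame" "q \<in> tame" "d = (\<lambda>x. p x - q x)" using assms(1) by (rule tame_diffE)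
  obtain p' q' where e: "p' \<in> tame" "q' \<in> tame" "e = (\<lambda>x. p' x - q' x)" using assms(2) by (rule tame_diffE)
  have "(\<lambda>x. (p x + p' x) - (q x + q' x)) \<in> tame_diff" using d e by (intro tame_diffI tame_add)
  then show ?thesis unfolding d(3) e(3) by (simp add: algebra_simps)
qed

lemma tame_diff_scale:
  assumes "d \<in> tame_diff"
  shows "(\<lambda>x. c * d x) \<in> tame_diff"
proof -
  obtain p q where d: "p \<in> tame" "q \<in> tame" "d = (\<lambda>x. p x - q x)" using assms by (rule tame_diffE)
  show ?thesis
  proof (cases "0 \<le> c")
    case True
    then have "(\<lambda>x. c * p x - c * q x) \<in> tame_diff" using d by (intro tame_diffI tame_scale)
    then show ?thesis unfolding d(3) by (simp add: algebra_simps)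
  next
    case False
    then have "(\<lambda>x. (- c) * q x - (- c) * p x) \<in> tame_diff" using d by (intro tame_diffI tame_scale) auto
    then show ?thesis unfolding d(3) by (simp add: algebra_simps)
  qed
qed

lemma tame_diff_max:
  assumes "d \<in> tame_diff" and "e \<in> tame_diff"
  shows "(\<lambda>x. max (d x) (e x)) \<in> tame_diff"
proof -
  obtain p q where d: "p \<in> tame" "q \<in> tame" "d = (\<lambda>x. p x - q x)" using assms(1) by (rule tame_diffE)
  obtain p' q' where e: "p' \<in> tame" "q' \<in> tame" "e = (\<lambda>x. p' x - q' x)" using assms(2) by (rule tame_diffE)
  have "(\<lambda>x. (p x + p' x) - min (p' x + q x) (p x + q' x)) \<in> tame_diff"
    using d e by (intro tame_diffI tame_add tame_min2)
  also have "(\<lambda>x. (p x + p' x) - min (p' x + q x) (p x + q' x)) = (\<lambda>x. max (d x) (e x))"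
    unfolding d(3) e(3) by (auto simp: fun_eq_iff min_def max_def)
  finally show ?thesis .
qed

lemma tame_diff_min:
  assumes "d \<in> tame_diff" and "e \<in> tame_diff"
  shows "(\<lambda>x. min (d x) (e x)) \<in> tame_diff"
proof -
  have "(\<lambda>x. (d x + e x) + (-1) * max (d x) (e x)) \<in> tame_diff"
    using assms by (intro tame_diff_add tame_diff_scale tame_diff_max)
  also have "(\<lambda>x. (d x + e x) + (-1) * max (d x) (e x)) = (\<lambda>x. min (d x) (e x))"
    by (auto simp: fun_eq_iff min_def max_def)
  finally show ?thesis .
qed

lemma tame_diff_zero: "(\<lambda>x. 0) \<in> tame_diff" by (rule tame_diff_tame[OF tame_zero])

lemma tame_diff_sum: "(\<And>i. i \<in> J \<Longrightarrow> d i \<in> tame_diff) \<Longrightarrow> (\<lambda>x. \<Sum>i\<in>J. d i x) \<in> tame_diff"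
  by (induction J rule: infinite_finite_induct) (simp_all add: tame_diff_zero tame_diff_add)

lemma tame_diff_continuous: "d \<in> tame_diff \<Longrightarrow> continuous_on UNIV d"
  by (elim tame_diffE) (simp add: continuous_on_diff tameD(3))

text \<open>By (B4)(i) some tame \<open>p\<close> is not proportional to \<open>u0\<close> on \<open>{x, y}\<close>, so some combination \<open>\<plusminus>(p - m u0)\<close>
  separates the two points.\<close>

lemma tame_diff_separates:
  assumes "x \<noteq> y"
  obtains d where "d \<in> tame_diff" "0 < d x" "d y < 0"
proof -
  let ?c = "u0 x / u0 y"
  have c: "0 < ?c" using u0_pos by simp
  obtain v where v: "v \<in> W" "v x \<noteq> ennreal ?c * v y" using B4_i[OF assms, of ?c] c by auto
  obtain p where p: "\<And>n::nat. p n \<in> tame" "\<And>x. v x = (SUP n. ennreal (p n x))"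
    using increasing_tame_approximation[OF v(1)] by metis
  have "\<exists>n. p n x \<noteq> ?c * p n y"
  proof (rule ccontr)
    assume "\<not> ?thesis"
    then have "v x = (SUP n. ennreal ?c * ennreal (p n y))"
      using p(2)[of x] c tameD(1)[OF p(1)] by (simp add: ennreal_mult[symmetric])
    also have "\<dots> = ennreal ?c * v y" unfolding p(2)[of y] by (simp add: SUP_mult_left_ennreal)
    finally show False using v(2) by simp
  qed
  then obtain n where n: "p n x \<noteq> ?c * p n y" by blast
  have pos: "0 < u0 x" "0 < u0 y" by (rule u0_pos)+
  have ne: "p n x / u0 x \<noteq> p n y / u0 y" using n pos by (simp add: field_simps)
  have pu: "(\<lambda>z. p n z + (- m) * u0 z) \<in> tame_diff" for m
    by (intro tame_diff_add tame_diff_scale tame_diff_tame p u0_tame)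
  show ?thesis
  proof (cases "p n y / u0 y < p n x / u0 x")
    case True
    then obtain m where "p n y / u0 y < m" "m < p n x / u0 x" using dense by blast
    then have "p n y < m * u0 y" "m * u0 x < p n x"
      using pos by (simp_all add: pos_divide_less_eq pos_less_divide_eq)
    then show ?thesis by (intro that[OF pu[of m]]) simp_all
  next
    case False
    with ne have "p n x / u0 x < p n y / u0 y" by linarith
    then obtain m where "p n x / u0 x < m" "m < p n y / u0 y" using dense by blast
    then have "p n x < m * u0 x" "m * u0 y < p n y"
      using pos by (simp_all add: pos_divide_less_eq pos_less_divide_eq)
    then show ?thesis by (intro that[OF tame_diff_scale[OF pu[of m], of "-1"]]) simp_all
  qed
qed

text \<open>The minimum of finitely many separating functions is negative on \<open>K - D\<close>, for a compact set \<open>K\<close>. The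
  function \<open>?e\<close>, the positive part of \<open>u0 - \<delta> v0\<close>, takes care of the points outside \<open>K\<close>.\<close>

lemma tame_diff_bump:
  assumes D: "open D" and x: "x \<in> D"
  obtains d where "d \<in> tame_diff" "0 < d x" "\<And>y. 0 \<le> d y" "\<And>y. y \<notin> D \<Longrightarrow> d y = 0"
proof -
  define \<delta> where "\<delta> = u0 x / (2 * v0 x)"
  have \<delta>: "0 < \<delta>" "\<delta> * v0 x < u0 x" using u0_pos[of x] v0_pos[of x] by (simp_all add: \<delta>_def)
  obtain K where K: "compact K" "\<And>y. y \<notin> K \<Longrightarrow> u0 y \<le> \<delta> * v0 y" using u0_small[OF \<delta>(1)] by blast
  let ?e = "\<lambda>y. u0 y - min (u0 y) (\<delta> * v0 y)"
  have "(\<lambda>y. ennreal (\<delta> * v0 y)) \<in> W"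
    using scale_mem[OF v0_mem, of \<delta>] \<delta>(1) v0_pos by (simp add: ennreal_mult less_imp_le)
  then have e: "?e \<in> tame_diff"
    using \<delta>(1) v0_pos
    by (intro tame_diffI u0_tame tame_min continuous_on_mult_left v0_cont) (simp_all add: less_imp_le)
  have "\<exists>d\<in>tame_diff. 0 < d x \<and> d y < 0" if "y \<in> K - D" for y
  proof -
    have "x \<noteq> y" using that x by auto
    then show ?thesis by (rule tame_diff_separates) blast
  qed
  then obtain s where s: "\<And>y. y \<in> K - D \<Longrightarrow> s y \<in> tame_diff \<and> 0 < s y x \<and> s y y < 0" by metis
  have "compact (K - D)" using K(1) D by (rule compact_diff)
  moreover have "open {z. s y z < 0}" if "y \<in> K - D" for y
    using s[OF that] by (intro open_Collect_less tame_diff_continuous continuous_on_const) simp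
  moreover have "K - D \<subseteq> (\<Union>y\<in>K - D. {z. s y z < 0})" using s by blast
  ultimately obtain F where F: "F \<subseteq> K - D" "finite F" "K - D \<subseteq> (\<Union>y\<in>F. {z. s y z < 0})"
    by (rule compactE_image)
  have "\<exists>d\<in>tame_diff. 0 < d x \<and> (\<forall>z. d z \<le> ?e z) \<and> (\<forall>z\<in>\<Union>y\<in>F. {z. s y z < 0}. d z < 0)"
    using F(2,1)
  proof (induction F rule: finite_induct)
    case empty
    then show ?case using e \<delta>(2) by (intro bexI[of _ ?e]) simp_all
  next
    case (insert y F)
    have "F \<subseteq> K - D" using insert.prems by simp
    from insert.IH[OF this] obtain d where d: "d \<in> tame_diff" "0 < d x" "\<And>z. d z \<le> ?e z"
      "\<And>z. z \<in> (\<Union>y\<in>F. {z. s y z < 0}) \<Longrightarrow> d z < 0" by blast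
    have "s y \<in> tame_diff" "0 < s y x" using s insert.prems by auto
    moreover have "min (d z) (s y z) \<le> ?e z" for z using d(3)[of z] by linarith
    moreover have "min (d z) (s y z) < 0" if "z \<in> (\<Union>y\<in>insert y F. {z. s y z < 0})" for z
      using that d(4)[of z] by (auto simp: min_less_iff_disj)
    ultimately show ?case using d(1,2)
      by (intro bexI[of _ "\<lambda>z. min (d z) (s y z)"] tame_diff_min conjI allI ballI) simp_all
  qed
  then obtain d where d: "d \<in> tame_diff" "0 < d x" "\<And>z. d z \<le> ?e z" "\<And>z. z \<in> K - D \<Longrightarrow> d z < 0"
    using F(3) by blast
  show ?thesis
  proof
    show "(\<lambda>z. max (d z) 0) \<in> tame_diff" by (intro tame_diff_max d tame_diff_zero)
    show "max (d y) 0 = 0" if "y \<notin> D" for y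
    proof (cases "y \<in> K")
      case True
      then show ?thesis using that d(4)[of y] by simp
    next
      case False
      then show ?thesis using K(2)[of y] d(3)[of y] by simp
    qed
  qed (use d(2) in simp_all)
qed

lemma open_tame_diff_approximation:
  assumes D: "open D"
  obtains F where "\<And>n::nat. F n \<in> tame_diff" "\<And>n x. 0 \<le> F n x" "\<And>n x. F n x \<le> u0 x"
    "\<And>n x. F n x \<le> F (Suc n) x" "\<And>n x. x \<notin> D \<Longrightarrow> F n x = 0"
    "\<And>x. x \<in> D \<Longrightarrow> \<forall>\<^sub>F n in sequentially. F n x = u0 x"
proof (cases "D = {}")
  case True
  then show ?thesis using u0_pos by (intro that[of "\<lambda>n x. 0"]) (simp_all add: tame_diff_zero less_imp_le)
next
  case False
  have "\<exists>d\<in>tame_diff. 0 < d x \<and> (\<forall>y. 0 \<le> d y) \<and> (\<forall>y. y \<notin> D \<longrightarrow> d y = 0)" if "x \<in> D" for x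
    using tame_diff_bump[OF D that] by metis
  then obtain d where d: "\<And>x. x \<in> D \<Longrightarrow> d x \<in> tame_diff" "\<And>x. x \<in> D \<Longrightarrow> 0 < d x x"
    "\<And>x y. x \<in> D \<Longrightarrow> 0 \<le> d x y" "\<And>x y. x \<in> D \<Longrightarrow> y \<notin> D \<Longrightarrow> d x y = 0" by metis
  let ?U = "\<lambda>x. {y. 0 < d x y}"
  have oU: "open (?U x)" if "x \<in> D" for x
    using d(1)[OF that] by (intro open_Collect_less tame_diff_continuous continuous_on_const)
  obtain \<F> where \<F>: "\<F> \<subseteq> ?U ` D" "countable \<F>" "\<Union>\<F> = \<Union>(?U ` D)"
    using Lindelof_openin[of "?U ` D" UNIV] oU by auto
  then obtain E where E: "E \<subseteq> D" "countable E" "\<F> = ?U ` E" using countable_subset_image by metis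
  have cover: "D \<subseteq> (\<Union>x\<in>E. ?U x)" using \<F>(3) E(3) d(2) by blast
  then have "E \<noteq> {}" using False by blast
  define k where "k = from_nat_into E"
  have k: "range k = E" unfolding k_def using \<open>E \<noteq> {}\<close> E(2) by (rule range_from_nat_into)
  have kD: "k i \<in> D" for i using k E(1) by blast
  define G where "G n x = real n * (\<Sum>i<n. d (k i) x)" for n x
  have G_nonneg: "0 \<le> G n x" for n x unfolding G_def using d(3)[OF kD] by (intro mult_nonneg_nonneg sum_nonneg) simp_all
  have G_mono: "G n x \<le> G (Suc n) x" for n x
    unfolding G_def using d(3)[OF kD] by (intro mult_mono sum_mono2 sum_nonneg) auto
  show ?thesis
  proof
    fix n x
    have "(\<lambda>x. G n x) \<in> tame_diff" unfolding G_def by (intro tame_diff_scale tame_diff_sum d kD)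
    then show "(\<lambda>x. min (u0 x) (G n x)) \<in> tame_diff" by (rule tame_diff_min[OF tame_diff_tame[OF u0_tame]])
    show "0 \<le> min (u0 x) (G n x)" using G_nonneg u0_pos[of x] by simp
    show "min (u0 x) (G n x) \<le> u0 x" by simp
    show "min (u0 x) (G n x) \<le> min (u0 x) (G (Suc n) x)" using G_mono[of n x] by (intro min.mono) simp_all
    show "min (u0 x) (G n x) = 0" if "x \<notin> D" using d(4)[OF kD that] u0_pos[of x] by (simp add: G_def)
  next
    fix x assume "x \<in> D"
    then obtain i where i: "0 < d (k i) x" using cover k by blast
    obtain m :: nat where "u0 x / d (k i) x < real m" using reals_Archimedean2 by blast
    then have m: "u0 x \<le> real m * d (k i) x" using i by (simp add: field_simps)
    have "u0 x \<le> G n x" if n: "max m (Suc i) \<le> n" for n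
    proof -
      have "real m * d (k i) x \<le> real n * (\<Sum>i<n. d (k i) x)"
        using n d(3)[OF kD] i by (intro mult_mono member_le_sum) auto
      with m show ?thesis by (simp add: G_def)
    qed
    then show "\<forall>\<^sub>F n in sequentially. min (u0 x) (G n x) = u0 x"
      by (intro eventually_sequentiallyI[of "max m (Suc i)"]) (simp add: min_absorb1)
  qed
qed

end

section \<open>Swept measures\<close>

context weighted_balayage_space
begin

context
  fixes A :: "'a set" and x :: 'a
begin

definition red :: "('a \<Rightarrow> real) \<Rightarrow> real" where
  "red p = enn2real (reduced W (\<lambda>y. ennreal (p y)) A x)"

lemma reduced_tame_le: "p \<in> tame \<Longrightarrow> reduced W (\<lambda>y. ennreal (p y)) A x \<le> ennreal (p x)"
  using tameD(2) by (rule reduced_lower) simp_all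

lemma ennreal_red: "p \<in> tame \<Longrightarrow> ennreal (red p) = reduced W (\<lambda>y. ennreal (p y)) A x"
  unfolding red_def using reduced_tame_le ennreal_less_top le_less_trans by (intro ennreal_enn2real) blast

lemma red_nonneg: "0 \<le> red p"
  by (simp add: red_def)

lemma red_add:
  assumes p: "p \<in> tame" and q: "q \<in> tame"
  shows "red (\<lambda>y. p y + q y) = red p + red q"
proof -
  have "ennreal (red (\<lambda>y. p y + q y)) = reduced W (\<lambda>y. ennreal (p y) + ennreal (q y)) A x"
    using ennreal_red[OF tame_add[OF p q]] tameD(1)[OF p] tameD(1)[OF q] by simp
  also have "\<dots> = ennreal (red p) + ennreal (red q)"
    using ennreal_red[OF p] ennreal_red[OF q] reduced_add[OF tameD(2)[OF p] tameD(2)[OF q]] by simp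
  also have "\<dots> = ennreal (red p + red q)" using red_nonneg by simp
  finally show ?thesis by (subst (asm) ennreal_inj) (simp_all add: red_nonneg)
qed

lemma red_scale:
  assumes p: "p \<in> tame" and c: "0 \<le> c"
  shows "red (\<lambda>y. c * p y) = c * red p"
proof (cases "c = 0")
  case True
  have "reduced W (\<lambda>y. ennreal 0) A x \<le> 0" using reduced_tame_le[OF tame_zero] by simp
  then show ?thesis using True by (simp add: red_def)
next
  case False
  with c have c: "0 < c" by simp
  have "ennreal (red (\<lambda>y. c * p y)) = reduced W (\<lambda>y. ennreal c * ennreal (p y)) A x"
    using ennreal_red[OF tame_scale[OF p, of c]] tameD(1)[OF p] c by (simp add: ennreal_mult)
  also have "\<dots> = ennreal c * ennreal (red p)" unfolding reduced_scale[OF c] ennreal_red[OF p] ..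
  also have "\<dots> = ennreal (c * red p)" using red_nonneg c by (simp add: ennreal_mult)
  finally show ?thesis using red_nonneg c by (simp add: ennreal_inj)
qed

lemma red_le_add:
  assumes p: "p \<in> tame" and q: "q \<in> tame" and e: "0 \<le> e" and le: "\<And>y. p y \<le> q y + e * v0 y"
  shows "red p \<le> red q + e * v0 x"
proof -
  have v: "(\<lambda>y. ennreal (e * v0 y)) \<in> W"
    using scale_mem[OF v0_mem e] e v0_pos by (simp add: ennreal_mult less_imp_le)
  have ev: "0 \<le> e * v0 y" for y using e v0_pos[of y] by simp
  have *: "reduced W (\<lambda>y. ennreal (p y)) A x \<le> w x + ennreal (e * v0 x)"
    if w: "w \<in> W" "\<forall>y\<in>A. ennreal (q y) \<le> w y" for w
  proof (rule reduced_lower[where w = "\<lambda>y. w y + ennreal (e * v0 y)"])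
    show "(\<lambda>y. w y + ennreal (e * v0 y)) \<in> W" by (intro add_mem w v)
    fix y assume "y \<in> A"
    have "ennreal (p y) \<le> ennreal (q y + e * v0 y)" using le by (rule ennreal_leI)
    also have "\<dots> = ennreal (q y) + ennreal (e * v0 y)" using tameD(1)[OF q] ev by simp
    also have "\<dots> \<le> w y + ennreal (e * v0 y)" using w(2) \<open>y \<in> A\<close> by (intro add_right_mono) simp
    finally show "ennreal (p y) \<le> w y + ennreal (e * v0 y)" .
  qed
  have "reduced W (\<lambda>y. ennreal (p y)) A x - ennreal (e * v0 x) \<le> reduced W (\<lambda>y. ennreal (q y)) A x"
  proof (rule reduced_greatest)
    fix w assume "w \<in> W" "\<forall>y\<in>A. ennreal (q y) \<le> w y"
    from *[OF this] show "reduced W (\<lambda>y. ennreal (p y)) A x - ennreal (e * v0 x) \<le> w x"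
      by (simp add: ennreal_minus_le_iff add.commute)
  qed
  then have "ennreal (red p) \<le> ennreal (red q) + ennreal (e * v0 x)"
    unfolding ennreal_red[OF p, symmetric] ennreal_red[OF q, symmetric]
    by (simp add: ennreal_minus_le_iff add.commute)
  also have "\<dots> = ennreal (red q + e * v0 x)" using red_nonneg ev by simp
  finally show ?thesis using red_nonneg[of q] ev[of x] by (subst (asm) ennreal_le_iff) simp_all
qed

lemma red_mono: "p \<in> tame \<Longrightarrow> q \<in> tame \<Longrightarrow> (\<And>y. p y \<le> q y) \<Longrightarrow> red p \<le> red q"
  using red_le_add[of p q 0] by simp

text \<open>The linear extension of \<open>red\<close> to differences; \<open>red_diff_eq\<close> shows that it does not depend on the
  representation.\<close>

definition red_diff :: "('a \<Rightarrow> real) \<Rightarrow> real" where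
  "red_diff d = (SOME r. \<exists>p q. p \<in> tame \<and> q \<in> tame \<and> d = (\<lambda>y. p y - q y) \<and> r = red p - red q)"

lemma red_diff_eq:
  assumes p: "p \<in> tame" and q: "q \<in> tame"
  shows "red_diff (\<lambda>y. p y - q y) = red p - red q"
  unfolding red_diff_def
proof (rule some_equality)
  show "\<exists>p' q'. p' \<in> tame \<and> q' \<in> tame \<and> (\<lambda>y. p y - q y) = (\<lambda>y. p' y - q' y) \<and>
      red p - red q = red p' - red q'" using assms by blast
  fix r assume "\<exists>p' q'. p' \<in> tame \<and> q' \<in> tame \<and> (\<lambda>y. p y - q y) = (\<lambda>y. p' y - q' y) \<and> r = red p' - red q'"
  then obtain p' q' where p': "p' \<in> tame" "q' \<in> tame" "(\<lambda>y. p y - q y) = (\<lambda>y. p' y - q' y)"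
    and r: "r = red p' - red q'" by blast
  have "(\<lambda>y. p y + q' y) = (\<lambda>y. p' y + q y)"
  proof
    fix y show "p y + q' y = p' y + q y" using fun_cong[OF p'(3), of y] by simp
  qed
  then have "red p + red q' = red p' + red q"
    using red_add[OF p p'(2)] red_add[OF p'(1) q] by simp
  then show "r = red p - red q" unfolding r by simp
qed

lemma red_diff_tame:
  assumes "p \<in> tame" shows "red_diff p = red p"
  using red_diff_eq[OF assms tame_zero] red_scale[OF tame_zero, of 0] by simp

lemma red_diff_add:
  assumes "d \<in> tame_diff" and "e \<in> tame_diff"
  shows "red_diff (\<lambda>y. d y + e y) = red_diff d + red_diff e"
proof -
  obtain p q where d: "p \<in> tame" "q \<in> tame" "d = (\<lambda>y. p y - q y)" using assms(1) by (rule tame_diffE)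
  obtain p' q' where e: "p' \<in> tame" "q' \<in> tame" "e = (\<lambda>y. p' y - q' y)" using assms(2) by (rule tame_diffE)
  have "(\<lambda>y. d y + e y) = (\<lambda>y. (p y + p' y) - (q y + q' y))" unfolding d(3) e(3) by (simp add: algebra_simps)
  then have "red_diff (\<lambda>y. d y + e y) = red (\<lambda>y. p y + p' y) - red (\<lambda>y. q y + q' y)"
    using red_diff_eq[OF tame_add[OF d(1) e(1)] tame_add[OF d(2) e(2)]] by simp
  also have "\<dots> = (red p - red q) + (red p' - red q')"
    unfolding red_add[OF d(1) e(1)] red_add[OF d(2) e(2)] by simp
  finally show ?thesis unfolding d(3) e(3) red_diff_eq[OF d(1,2)] red_diff_eq[OF e(1,2)] .
qed

lemma red_diff_scale:
  assumes "d \<in> tame_diff"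
  shows "red_diff (\<lambda>y. c * d y) = c * red_diff d"
proof -
  obtain p q where d: "p \<in> tame" "q \<in> tame" "d = (\<lambda>y. p y - q y)" using assms by (rule tame_diffE)
  show ?thesis
  proof (cases "0 \<le> c")
    case True
    have "(\<lambda>y. c * d y) = (\<lambda>y. c * p y - c * q y)" unfolding d(3) by (simp add: algebra_simps)
    then have "red_diff (\<lambda>y. c * d y) = red (\<lambda>y. c * p y) - red (\<lambda>y. c * q y)"
      using red_diff_eq[OF tame_scale[OF d(1) True] tame_scale[OF d(2) True]] by simp
    also have "\<dots> = c * (red p - red q)"
      unfolding red_scale[OF d(1) True] red_scale[OF d(2) True] by (simp add: algebra_simps)
    finally show ?thesis unfolding d(3) red_diff_eq[OF d(1,2)] .
  next
    case False
    then have c: "0 \<le> - c" by simp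
    have "(\<lambda>y. c * d y) = (\<lambda>y. (- c) * q y - (- c) * p y)" unfolding d(3) by (simp add: algebra_simps)
    then have "red_diff (\<lambda>y. c * d y) = red (\<lambda>y. (- c) * q y) - red (\<lambda>y. (- c) * p y)"
      using red_diff_eq[OF tame_scale[OF d(2) c] tame_scale[OF d(1) c]] by simp
    also have "\<dots> = c * (red p - red q)"
      unfolding red_scale[OF d(1) c] red_scale[OF d(2) c] by (simp add: algebra_simps)
    finally show ?thesis unfolding d(3) red_diff_eq[OF d(1,2)] .
  qed
qed

lemma red_diff_nonneg:
  assumes "d \<in> tame_diff" and "\<And>y. 0 \<le> d y"
  shows "0 \<le> red_diff d"
proof -
  obtain p q where d: "p \<in> tame" "q \<in> tame" "d = (\<lambda>y. p y - q y)" using assms(1) by (rule tame_diffE)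
  have "q y \<le> p y" for y using assms(2)[of y] d(3) by simp
  then show ?thesis unfolding d(3) red_diff_eq[OF d(1,2)] using red_mono[OF d(2,1)] by simp
qed

lemma red_diff_le:
  assumes "d \<in> tame_diff" and "0 \<le> e" and "\<And>y. d y \<le> e * v0 y"
  shows "red_diff d \<le> e * v0 x"
proof -
  obtain p q where d: "p \<in> tame" "q \<in> tame" "d = (\<lambda>y. p y - q y)" using assms(1) by (rule tame_diffE)
  have "p y \<le> q y + e * v0 y" for y using assms(3)[of y] d(3) by simp
  then show ?thesis unfolding d(3) red_diff_eq[OF d(1,2)] using red_le_add[OF d(1,2) assms(2)] by simp
qed

text \<open>Dini's theorem on a compact set outside of which already \<open>F 0\<close> is small compared with \<open>v0\<close>.\<close>

lemma red_diff_null: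
  assumes F: "\<And>n. F n \<in> tame_diff" and decr: "\<And>n y. F (Suc n) y \<le> F n y"
    and lim: "\<And>y. (\<lambda>n. F n y) \<longlonglongrightarrow> 0"
  shows "(\<lambda>n. red_diff (F n)) \<longlonglongrightarrow> 0"
proof (rule LIMSEQ_I)
  fix r :: real assume r: "0 < r"
  have decr': "F n y \<le> F m y" if "m \<le> n" for m n y
    using lift_Suc_antimono_le[of "\<lambda>n. F n y", OF decr that] .
  have nonneg: "0 \<le> F n y" for n y
    using lim decr' by (intro LIMSEQ_le_const2[OF lim]) blast
  define e where "e = r / (2 * v0 x)"
  have e: "0 < e" "e * v0 x < r" using r v0_pos[of x] by (simp_all add: e_def)
  obtain p q where d: "p \<in> tame" "q \<in> tame" "F 0 = (\<lambda>y. p y - q y)" using F by (rule tame_diffE)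
  obtain K where K: "compact K" "\<And>y. y \<notin> K \<Longrightarrow> p y \<le> e * v0 y" using tameD(4)[OF d(1) e(1)] by blast
  let ?U = "\<lambda>n. {y. F n y < e * v0 y}"
  have "open (?U n)" for n
    by (intro open_Collect_less tame_diff_continuous F continuous_on_mult_left v0_cont)
  moreover have "K \<subseteq> (\<Union>n\<in>UNIV. ?U n)"
  proof
    fix y assume "y \<in> K"
    have "0 < e * v0 y" using e v0_pos by simp
    with lim have "\<forall>\<^sub>F n in sequentially. F n y < e * v0 y" by (rule order_tendstoD)
    then show "y \<in> (\<Union>n\<in>UNIV. ?U n)" by (auto simp: eventually_sequentially)
  qed
  ultimately obtain J where J: "finite J" "K \<subseteq> (\<Union>n\<in>J. ?U n)"
    using compactE_image[OF K(1), of UNIV ?U] by metis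
  obtain m where m: "\<And>j. j \<in> J \<Longrightarrow> j \<le> m" using finite_nat_set_iff_bounded_le[of J] J(1) by blast
  have "norm (red_diff (F n) - 0) < r" if n: "m \<le> n" for n
  proof -
    have "F n y \<le> e * v0 y" for y
    proof (cases "y \<in> K")
      case True
      then obtain j where "j \<in> J" "F j y < e * v0 y" using J(2) by auto
      moreover have "F n y \<le> F j y" using m[OF \<open>j \<in> J\<close>] n by (intro decr') simp
      ultimately show ?thesis by simp
    next
      case False
      have "F n y \<le> F 0 y" by (rule decr') simp
      also have "\<dots> \<le> p y" unfolding d(3) using tameD(1)[OF d(2)] by simp
      also have "\<dots> \<le> e * v0 y" using K(2)[OF False] .
      finally show ?thesis .
    qed
    then have "red_diff (F n) \<le> e * v0 x" using e(1) by (intro red_diff_le F) simp_all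
    moreover have "0 \<le> red_diff (F n)" by (intro red_diff_nonneg F nonneg)
    ultimately show ?thesis using e(2) by simp
  qed
  then show "\<exists>m. \<forall>n\<ge>m. norm (red_diff (F n) - 0) < r" by blast
qed

lemma u0_neq_0: "u0 y \<noteq> 0" using u0_pos[of y] by simp

text \<open>Dividing by \<open>u0\<close> turns \<open>tame_diff\<close> into a lattice that contains the constants.\<close>

lemma daniell_functional_red_diff:
  "daniell_functional {f. (\<lambda>y. f y * u0 y) \<in> tame_diff} (\<lambda>f. red_diff (\<lambda>y. f y * u0 y))"
proof unfold_locales
  let ?L = "{f. (\<lambda>y. f y * u0 y) \<in> tame_diff}"
  show "(\<lambda>y. 1) \<in> ?L" using tame_diff_tame[OF u0_tame] by simp
  fix f assume f: "f \<in> ?L"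
  show "(\<lambda>y. c * f y) \<in> ?L" for c
    using tame_diff_scale[of "\<lambda>y. f y * u0 y" c] f by (simp add: mult.assoc)
  show "red_diff (\<lambda>y. c * f y * u0 y) = c * red_diff (\<lambda>y. f y * u0 y)" for c
    using red_diff_scale[of "\<lambda>y. f y * u0 y" c] f by (simp add: mult.assoc)
  show "continuous_on UNIV f"
  proof -
    have "continuous_on UNIV (\<lambda>y. f y * u0 y)" using f by (intro tame_diff_continuous) simp
    then have "continuous_on UNIV (\<lambda>y. f y * u0 y / u0 y)"
      using u0_cont u0_neq_0 by (intro continuous_on_divide) simp_all
    then show ?thesis using u0_neq_0 by simp
  qed
  show "0 \<le> red_diff (\<lambda>y. f y * u0 y)" if "\<And>y. 0 \<le> f y"
    using f that u0_pos by (intro red_diff_nonneg) (simp_all add: less_imp_le)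
  fix g assume g: "g \<in> ?L"
  show "(\<lambda>y. f y + g y) \<in> ?L"
    using tame_diff_add[of "\<lambda>y. f y * u0 y" "\<lambda>y. g y * u0 y"] f g by (simp add: distrib_right)
  show "red_diff (\<lambda>y. (f y + g y) * u0 y) = red_diff (\<lambda>y. f y * u0 y) + red_diff (\<lambda>y. g y * u0 y)"
    using red_diff_add[of "\<lambda>y. f y * u0 y" "\<lambda>y. g y * u0 y"] f g by (simp add: distrib_right)
  have "max (f y) (g y) * u0 y = max (f y * u0 y) (g y * u0 y)" for y
    using u0_pos[of y] by (simp add: max_mult_distrib_right)
  then show "(\<lambda>y. max (f y) (g y)) \<in> ?L"
    using tame_diff_max[of "\<lambda>y. f y * u0 y" "\<lambda>y. g y * u0 y"] f g by simp
next
  fix F :: "nat \<Rightarrow> 'a \<Rightarrow> real"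
  assume "\<And>n. F n \<in> {f. (\<lambda>y. f y * u0 y) \<in> tame_diff}" and "\<And>n y. F (Suc n) y \<le> F n y"
    and "\<And>y. (\<lambda>n. F n y) \<longlonglongrightarrow> 0"
  then show "(\<lambda>n. red_diff (\<lambda>y. F n y * u0 y)) \<longlonglongrightarrow> 0"
    using u0_pos by (intro red_diff_null tendsto_mult_left_zero) (simp_all add: less_imp_le)
next
  fix D :: "'a set" assume "open D"
  then obtain F where F: "\<And>n::nat. F n \<in> tame_diff" "\<And>n x. 0 \<le> F n x" "\<And>n x. F n x \<le> u0 x"
    "\<And>n x. F n x \<le> F (Suc n) x" "\<And>n x. x \<notin> D \<Longrightarrow> F n x = 0"
    "\<And>x. x \<in> D \<Longrightarrow> \<forall>\<^sub>F n in sequentially. F n x = u0 x"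
    by (rule open_tame_diff_approximation) blast
  show "\<exists>F. \<forall>n x. F n \<in> {f. (\<lambda>y. f y * u0 y) \<in> tame_diff} \<and> 0 \<le> F n x \<and>
      F n x \<le> indicator D x \<and> F n x \<le> F (Suc n) x \<and> (\<lambda>n. F n x) \<longlonglongrightarrow> indicator D x"
  proof (intro exI[of _ "\<lambda>n x. F n x / u0 x"] allI conjI)
    fix n x
    show "(\<lambda>x. F n x / u0 x) \<in> {f. (\<lambda>y. f y * u0 y) \<in> tame_diff}" using F(1) u0_neq_0 by simp
    show "0 \<le> F n x / u0 x" using F(2) u0_pos[of x] by simp
    show "F n x / u0 x \<le> indicator D x"
      using F(3)[of n x] F(5)[of x n] u0_pos[of x] by (cases "x \<in> D") simp_all
    show "F n x / u0 x \<le> F (Suc n) x / u0 x" using F(4) u0_pos[of x] by (intro divide_right_mono) simp_all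
    show "(\<lambda>n. F n x / u0 x) \<longlonglongrightarrow> indicator D x"
    proof (cases "x \<in> D")
      case True
      have "\<forall>\<^sub>F n in sequentially. F n x / u0 x = indicator D x"
        using F(6)[OF True] by eventually_elim (use True u0_neq_0 in simp)
      then show ?thesis by (rule tendsto_eventually)
    next
      case False
      then show ?thesis using F(5) by simp
    qed
  qed
qed

lemma exists_measure_representing_red:
  "\<exists>\<mu>. sets \<mu> = sets borel \<and> (\<forall>p\<in>tame. (\<integral>\<^sup>+y. ennreal (p y) \<partial>\<mu>) = reduced W (\<lambda>y. ennreal (p y)) A x)"
proof -
  interpret daniell_functional "{f. (\<lambda>y. f y * u0 y) \<in> tame_diff}" "\<lambda>f. red_diff (\<lambda>y. f y * u0 y)"
    by (rule daniell_functional_red_diff)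
  obtain M where M: "sets M = sets borel"
    and int: "\<And>f. (\<lambda>y. f y * u0 y) \<in> tame_diff \<Longrightarrow> (\<And>y. 0 \<le> f y) \<Longrightarrow>
      (\<integral>\<^sup>+y. f y \<partial>M) = ennreal (red_diff (\<lambda>y. f y * u0 y))"
    using representing_measure by auto
  let ?\<mu> = "density M (\<lambda>y. ennreal (1 / u0 y))"
  have meas: "(\<lambda>y. ennreal (f y)) \<in> borel_measurable M" if "continuous_on UNIV f" for f :: "'a \<Rightarrow> real"
    unfolding measurable_cong_sets[OF M refl]
    by (intro borel_measurable_continuous_onI continuous_on_ennreal that)
  have "(\<integral>\<^sup>+y. ennreal (p y) \<partial>?\<mu>) = reduced W (\<lambda>y. ennreal (p y)) A x" if p: "p \<in> tame" for p
  proof -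
    have c: "continuous_on UNIV (\<lambda>y. 1 / u0 y)"
      using u0_cont u0_neq_0 by (intro continuous_on_divide continuous_on_const) simp_all
    have "(\<integral>\<^sup>+y. ennreal (p y) \<partial>?\<mu>) = (\<integral>\<^sup>+y. ennreal (1 / u0 y) * ennreal (p y) \<partial>M)"
      by (intro nn_integral_density meas c tameD p)
    also have "\<dots> = (\<integral>\<^sup>+y. ennreal (p y / u0 y) \<partial>M)"
      using tameD(1)[OF p] u0_pos by (simp add: ennreal_mult[symmetric] less_imp_le)
    also have "\<dots> = ennreal (red_diff (\<lambda>y. p y / u0 y * u0 y))"
      using tameD(1)[OF p] u0_pos tame_diff_tame[OF p] u0_neq_0 by (intro int) (simp_all add: less_imp_le)
    also have "\<dots> = reduced W (\<lambda>y. ennreal (p y)) A x"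
      using u0_neq_0 red_diff_tame[OF p] ennreal_red[OF p] by simp
    finally show ?thesis .
  qed
  then show ?thesis using M by (intro exI[of _ ?\<mu>]) simp
qed

end

end

lemma ennreal_add_right_imp_eq:
  fixes a b c :: ennreal
  shows "a + c = b + c \<Longrightarrow> c \<noteq> \<infinity> \<Longrightarrow> a = b"
  by (simp add: add.commute[of _ c] ennreal_add_left_cancel)

context weighted_balayage_space
begin

text \<open>If \<open>w \<ge> p\<close> on \<open>A\<close>, then \<open>w + d * v0 > p\<close> on an open set containing \<open>A\<close>, because \<open>p\<close> is continuous.\<close>

lemma reduced_open_approximation:
  assumes p: "p \<in> tame" and e: "0 < e"
  obtains G where "open G" "A \<subseteq> G"
    "reduced W (\<lambda>y. ennreal (p y)) G x \<le> reduced W (\<lambda>y. ennreal (p y)) A x + ennreal e"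
proof -
  let ?p = "\<lambda>y. ennreal (p y)"
  have "reduced W ?p A x < top" using reduced_tame_le[OF p] ennreal_less_top by (rule le_less_trans)
  then have "reduced W ?p A x < reduced W ?p A x + ennreal (e/2)" using e by simp
  then obtain w where w: "w \<in> W" "\<And>y. y \<in> A \<Longrightarrow> ?p y \<le> w y" "w x < reduced W ?p A x + ennreal (e/2)"
    by (rule reduced_lessE) blast
  define d where "d = e / (2 * v0 x)"
  have d: "0 < d" "d * v0 x = e / 2" using e v0_pos[of x] by (simp_all add: d_def)
  have dv_pos: "0 < d * v0 y" for y using d(1) v0_pos[of y] by simp
  have "(\<lambda>y. ennreal (d * v0 y)) \<in> W"
    using scale_mem[OF v0_mem, of d] d(1) v0_pos by (simp add: ennreal_mult less_imp_le)
  with w(1) have W: "(\<lambda>y. w y + ennreal (d * v0 y)) \<in> W" by (rule add_mem)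
  let ?G = "{y \<in> UNIV. ?p y < w y + ennreal (d * v0 y)}"
  show ?thesis
  proof
    show "open ?G"
      using lsc[OF W] by (intro open_less_of_continuous_lower_semicontinuous continuous_on_ennreal tameD p open_UNIV)
    show "A \<subseteq> ?G"
    proof
      fix y assume "y \<in> A"
      have "?p y < ?p y + ennreal (d * v0 y)" using dv_pos[of y] by simp
      also have "\<dots> \<le> w y + ennreal (d * v0 y)" using w(2)[OF \<open>y \<in> A\<close>] by (rule add_right_mono)
      finally show "y \<in> ?G" by simp
    qed
    have "reduced W ?p ?G x \<le> w x + ennreal (d * v0 x)" by (rule reduced_lower[OF W]) (simp add: less_imp_le)
    also have "\<dots> \<le> (reduced W ?p A x + ennreal (e/2)) + ennreal (e/2)"
      unfolding d(2) using w(3) by (intro add_right_mono less_imp_le)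
    also have "\<dots> = reduced W ?p A x + ennreal e"
      using e by (simp add: add.assoc ennreal_plus[symmetric] del: ennreal_plus)
    finally show "reduced W ?p ?G x \<le> reduced W ?p A x + ennreal e" .
  qed
qed

text \<open>The difficulty is that \<open>R\<^sub>p\<^sup>A\<close> need not be in \<open>W\<close>. A majorant of \<open>w\<close> on \<open>A\<close> that is almost as small at \<open>x\<close> as
  the right hand side is built as the limit of an increasing sequence \<open>v n\<close> in \<open>W\<close> with \<open>v n = p n\<close> on an open set
  containing \<open>A\<close>. Given \<open>v n\<close>, and writing \<open>O\<close> for a smaller open set containing \<open>A\<close>, the next function is
  \<open>min (v n - R\<^sub>p\<^sup>O + R\<^sub>q\<^sup>O) q\<close> with \<open>p = p n\<close> and \<open>q = p (Suc n)\<close>. It is in \<open>W\<close> by the criterion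
  \<open>diff_mem_of_fixed_by_reduction\<close>, and the excess over \<open>R\<^sub>p\<^sup>A(x)\<close> grows by no more than the error made in
  replacing \<open>A\<close> by \<open>O\<close>.\<close>

lemma reduced_SUP:
  assumes p: "\<And>n::nat. p n \<in> tame" "\<And>n y. p n y \<le> p (Suc n) y" and w: "\<And>y. w y = (SUP n. ennreal (p n y))"
  shows "reduced W w A x = (SUP n. reduced W (\<lambda>y. ennreal (p n y)) A x)"
proof (rule antisym)
  let ?p = "\<lambda>n y. ennreal (p n y)"
  let ?R = "\<lambda>n. reduced W (?p n) A x"
  show "(SUP n. ?R n) \<le> reduced W w A x"
    unfolding w by (intro SUP_least reduced_mono order_refl SUP_upper UNIV_I)
  have R_fin: "?R n \<noteq> top" for n
    using le_less_trans[OF reduced_tame_le[OF p(1)] ennreal_less_top] by (metis less_irrefl)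
  show "reduced W w A x \<le> (SUP n. ?R n)"
  proof (rule ennreal_le_epsilon)
    fix e :: real assume e: "0 < e"
    \<comment> \<open>The total error after step \<open>n\<close>, which itself contributes \<open>e / 2 ^ (n + 1)\<close>.\<close>
    define s where "s n = e * (1 - (1/2)^Suc n)" for n
    have s_nonneg: "0 \<le> s n" for n unfolding s_def using e by (intro mult_nonneg_nonneg) (simp_all add: power_le_one del: power_Suc)
    have s_Suc: "s (Suc n) = s n + e * (1/2)^Suc (Suc n)" for n unfolding s_def by (simp add: algebra_simps)
    let ?P = "\<lambda>n v. v \<in> W \<and> (\<exists>G. open G \<and> A \<subseteq> G \<and> (\<forall>y\<in>G. v y = ?p n y)) \<and>
      (\<forall>y. v y \<le> ?p n y) \<and> v x \<le> ?R n + ennreal (s n)"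
    let ?Q = "\<lambda>(n::nat) v v'. \<forall>y. v y \<le> (v' y :: ennreal)"
    have "\<exists>v. \<forall>n. ?P n (v n) \<and> ?Q n (v n) (v (Suc n))"
    proof (rule dependent_nat_choice)
      have "0 < e/2" using e by simp
      then obtain G where G: "open G" "A \<subseteq> G" "reduced W (?p 0) G x \<le> ?R 0 + ennreal (e/2)"
        by (rule reduced_open_approximation[OF p(1)[of 0], where A = A and x = x]) blast
      have "?P 0 (reduced W (?p 0) G)"
      proof (intro conjI allI exI[of _ G] ballI)
        show "reduced W (?p 0) G \<in> W" using G(1) by (intro reduced_open_mem tameD p)
        show "reduced W (?p 0) G y = ?p 0 y" if "y \<in> G" for y using that by (intro reduced_eq tameD p)
        show "reduced W (?p 0) G y \<le> ?p 0 y" for y by (intro reduced_lower tameD p order_refl)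
        show "reduced W (?p 0) G x \<le> ?R 0 + ennreal (s 0)" using G(3) by (simp add: s_def)
      qed (use G in simp_all)
      then show "\<exists>v. ?P 0 v" by blast
    next
      fix v n assume "?P n v"
      then obtain G where v: "v \<in> W" "\<And>y. v y \<le> ?p n y" "v x \<le> ?R n + ennreal (s n)"
        and G: "open G" "A \<subseteq> G" "\<And>y. y \<in> G \<Longrightarrow> v y = ?p n y" by blast
      have en: "0 < e * (1/2)^Suc (Suc n)" using e by simp
      obtain G' where G': "open G'" "A \<subseteq> G'"
        "reduced W (?p (Suc n)) G' x \<le> ?R (Suc n) + ennreal (e * (1/2)^Suc (Suc n))"
        by (rule reduced_open_approximation[OF p(1)[of "Suc n"] en, where A = A and x = x]) blast
      let ?O = "G \<inter> G'" and ?b = "?p (Suc n)"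
      define c where "c = reduced W (?p n) ?O"
      define Z where "Z = reduced W ?b ?O"
      have O: "open ?O" using G(1) G'(1) by (rule open_Int)
      have c: "c \<in> W" and Z: "Z \<in> W"
        unfolding c_def Z_def using O by (intro reduced_open_mem tameD p; simp)+
      have c_eq: "c y = ?p n y" and Z_eq: "Z y = ?b y" if "y \<in> ?O" for y
        unfolding c_def Z_def using that by (intro reduced_eq tameD p; simp)+
      have c_le: "c y \<le> ?p n y" for y unfolding c_def by (intro reduced_lower tameD p order_refl)
      have c_fin: "c y \<noteq> top" for y using le_less_trans[OF c_le ennreal_less_top] by (metis less_irrefl)
      have p_Suc: "?p n y \<le> ?b y" for y using p(2) by (rule ennreal_leI)
      have cZ: "c y \<le> Z y" for y unfolding c_def Z_def by (intro reduced_mono p_Suc order_refl)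
      let ?Y = "\<lambda>y. min (v y + Z y) (?b y + c y)"
      have "\<exists>r\<in>W. \<forall>y. ?Y y = r y + c y"
      proof (rule diff_mem_of_fixed_by_reduction[where A = ?O and b = ?b])
        show "?Y \<in> W" by (intro min_mem add_mem v Z c tameD p)
        show "?b \<in> W" by (intro tameD p)
        show "c \<in> W" by (rule c)
        show "c y < \<infinity>" for y using c_fin[of y] by (simp add: less_top)
        show "?Y y = ?b y + c y" if "y \<in> ?O" for y
          using that G(3)[of y] c_eq[OF that] Z_eq[OF that] by (simp add: add.commute)
        show "c y \<le> u y" if "u \<in> W" "\<And>z. z \<in> ?O \<Longrightarrow> c z \<le> u z" for u y
          unfolding c_def using that c_eq by (intro reduced_lower) auto
      qed simp_all
      then obtain r where r: "r \<in> W" "\<And>y. ?Y y = r y + c y" by blast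
      have cancel: "a \<le> b" if "a + c y \<le> b + c y" for a b y
        using that c_fin[of y] by (simp add: add.commute[of _ "c y"] ennreal_add_left_cancel_le)
      have cancel_eq: "a = b" if "a + c y = b + c y" for a b y
        using cancel[of a y b] cancel[of b y a] that by simp
      have "?P (Suc n) r \<and> ?Q n v r"
      proof (intro conjI allI exI[of _ ?O] ballI)
        show "r \<in> W" by (rule r)
        show "open ?O" by (rule O)
        show "A \<subseteq> ?O" using G(2) G'(2) by simp
        show "r y = ?b y" if "y \<in> ?O" for y
        proof (rule cancel_eq)
          show "r y + c y = ?b y + c y"
            using r(2)[of y] that G(3)[of y] c_eq[OF that] Z_eq[OF that] by (simp add: add.commute)
        qed
        show "r y \<le> ?b y" for y
        proof (rule cancel)
          show "r y + c y \<le> ?b y + c y" unfolding r(2)[symmetric] by simp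
        qed
        show "v y \<le> r y" for y
        proof (rule cancel)
          have "v y + c y \<le> v y + Z y" using cZ by (rule add_left_mono)
          moreover have "v y + c y \<le> ?b y + c y" using order_trans[OF v(2) p_Suc] by (rule add_right_mono)
          ultimately show "v y + c y \<le> r y + c y" unfolding r(2)[symmetric] by simp
        qed
        show "r x \<le> ?R (Suc n) + ennreal (s (Suc n))"
        proof -
          have "?R n + r x \<le> c x + r x"
            unfolding c_def using G(2) G'(2) by (intro add_right_mono reduced_mono) simp_all
          also have "c x + r x \<le> v x + Z x" using r(2)[of x] by (metis add.commute min.cobounded1)
          also have "\<dots> \<le> (?R n + ennreal (s n)) + (?R (Suc n) + ennreal (e * (1/2)^Suc (Suc n)))"
          proof (rule add_mono[OF v(3)])
            have "Z x \<le> reduced W ?b G' x" unfolding Z_def by (rule reduced_mono) simp_all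
            with G'(3) show "Z x \<le> ?R (Suc n) + ennreal (e * (1/2)^Suc (Suc n))" by (rule order_trans[rotated])
          qed
          also have "\<dots> = ?R n + (?R (Suc n) + (ennreal (s n) + ennreal (e * (1/2)^Suc (Suc n))))"
            by (simp only: ac_simps)
          also have "ennreal (s n) + ennreal (e * (1/2)^Suc (Suc n)) = ennreal (s (Suc n))"
            unfolding s_Suc using s_nonneg[of n] en by (intro ennreal_plus[symmetric]) simp_all
          finally show ?thesis using R_fin[of n] by (simp only: ennreal_add_left_cancel_le) simp
        qed
      qed
      then show "\<exists>v'. ?P (Suc n) v' \<and> ?Q n v v'" by blast
    qed
    then obtain v where v: "\<And>n. v n \<in> W" "\<And>n. \<exists>G. open G \<and> A \<subseteq> G \<and> (\<forall>y\<in>G. v n y = ?p n y)"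
      "\<And>n. v n x \<le> ?R n + ennreal (s n)" "\<And>n y. v n y \<le> v (Suc n) y" by blast
    have "reduced W w A x \<le> (SUP n. v n x)"
    proof (rule reduced_lower[where w = "\<lambda>y. SUP n. v n y"])
      show "(\<lambda>y. SUP n. v n y) \<in> W" by (rule SUP_mem) (rule v)+
      fix y assume "y \<in> A"
      then have "v n y = ?p n y" for n using v(2)[of n] by blast
      then show "w y \<le> (SUP n. v n y)" unfolding w by simp
    qed
    also have "\<dots> \<le> (SUP n. ?R n) + ennreal e"
    proof (rule SUP_least)
      fix n
      have "ennreal (s n) \<le> ennreal e" unfolding s_def using e by (intro ennreal_leI) (simp add: mult_left_le)
      moreover have "?R n \<le> (SUP n. ?R n)" by (rule SUP_upper) simp
      ultimately show "v n x \<le> (SUP n. ?R n) + ennreal e"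
        by (intro order_trans[OF v(3)] add_mono)
    qed
    finally show "reduced W w A x \<le> (SUP n. ?R n) + ennreal e" .
  qed
qed

lemma measurable_W: "w \<in> W \<Longrightarrow> w \<in> borel_measurable borel"
proof (rule borel_measurableI_greater)
  fix a assume "w \<in> W"
  then have "open {y. a < w y}" using lsc by (simp add: lower_semicontinuous_euclidean)
  then show "{y \<in> space borel. a < w y} \<in> sets borel" by simp
qed

lemma nn_integral_eq_reduced:
  assumes M: "sets \<mu> = sets borel"
    and tame: "\<And>p. p \<in> tame \<Longrightarrow> (\<integral>\<^sup>+y. ennreal (p y) \<partial>\<mu>) = reduced W (\<lambda>y. ennreal (p y)) A x"
    and w: "w \<in> W"
  shows "(\<integral>\<^sup>+y. w y \<partial>\<mu>) = reduced W w A x"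
proof -
  obtain p where p: "\<And>n::nat. p n \<in> tame" "\<And>n y. p n y \<le> p (Suc n) y"
    "\<And>y. w y = (SUP n. ennreal (p n y))" by (rule increasing_tame_approximation[OF w]) blast
  have meas: "(\<lambda>y. ennreal (p n y)) \<in> borel_measurable \<mu>" for n
    unfolding measurable_cong_sets[OF M refl] by (intro measurable_W tameD p)
  have "(\<integral>\<^sup>+y. w y \<partial>\<mu>) = (SUP n. \<integral>\<^sup>+y. ennreal (p n y) \<partial>\<mu>)"
    unfolding p(3) using p(2) meas
    by (intro nn_integral_monotone_convergence_SUP incseq_SucI le_funI ennreal_leI)
  also have "\<dots> = reduced W w A x" unfolding reduced_SUP[OF p] tame[OF p(1)] ..
  finally show ?thesis .
qed

lemma nn_integral_tame_diff:
  assumes M: "sets \<mu> = sets borel" and p: "p \<in> tame" and q: "q \<in> tame" and le: "\<And>y. q y \<le> p y"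
  shows "(\<integral>\<^sup>+y. ennreal (p y) \<partial>\<mu>) = (\<integral>\<^sup>+y. ennreal (p y - q y) \<partial>\<mu>) + (\<integral>\<^sup>+y. ennreal (q y) \<partial>\<mu>)"
proof -
  have meas: "(\<lambda>y. ennreal (f y)) \<in> borel_measurable \<mu>" if "continuous_on UNIV f" for f :: "'a \<Rightarrow> real"
    unfolding measurable_cong_sets[OF M refl]
    by (intro borel_measurable_continuous_onI continuous_on_ennreal that)
  have "(\<integral>\<^sup>+y. ennreal (p y) \<partial>\<mu>) = (\<integral>\<^sup>+y. ennreal (p y - q y) + ennreal (q y) \<partial>\<mu>)"
    using le tameD(1)[OF q] by (simp add: ennreal_plus[symmetric] del: ennreal_plus)
  also have "\<dots> = (\<integral>\<^sup>+y. ennreal (p y - q y) \<partial>\<mu>) + (\<integral>\<^sup>+y. ennreal (q y) \<partial>\<mu>)"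
    by (intro nn_integral_add meas continuous_on_diff tameD p q)
  finally show ?thesis .
qed

text \<open>The integrals of \<open>tame_diff\<close> determine the finite measure with density \<open>u0\<close> on open sets.\<close>

lemma measure_eqI_tame:
  assumes M: "sets \<mu> = sets borel" "sets \<nu> = sets borel"
    and eq: "\<And>p. p \<in> tame \<Longrightarrow> (\<integral>\<^sup>+y. ennreal (p y) \<partial>\<mu>) = (\<integral>\<^sup>+y. ennreal (p y) \<partial>\<nu>)"
    and fin: "\<And>p. p \<in> tame \<Longrightarrow> (\<integral>\<^sup>+y. ennreal (p y) \<partial>\<mu>) < top"
  shows "\<mu> = \<nu>"
proof -
  have meas: "(\<lambda>y. ennreal (f y)) \<in> borel_measurable borel" if "continuous_on UNIV f" for f :: "'a \<Rightarrow> real"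
    by (intro borel_measurable_continuous_onI continuous_on_ennreal that)
  have u_meas: "(\<lambda>y. ennreal (u0 y)) \<in> borel_measurable borel" by (intro meas u0_cont)
  have inv_meas: "(\<lambda>y. ennreal (1 / u0 y)) \<in> borel_measurable borel"
    using u0_neq_0 by (intro meas continuous_on_divide continuous_on_const u0_cont) simp
  have diff_eq: "(\<integral>\<^sup>+y. ennreal (d y) \<partial>\<mu>) = (\<integral>\<^sup>+y. ennreal (d y) \<partial>\<nu>)"
    if d: "d \<in> tame_diff" "\<And>y. 0 \<le> d y" for d
  proof -
    obtain p q where pq: "p \<in> tame" "q \<in> tame" "d = (\<lambda>x. p x - q x)" using d(1) by (rule tame_diffE)
    have le: "q y \<le> p y" for y using d(2)[of y] pq(3) by simp
    have "(\<integral>\<^sup>+y. ennreal (d y) \<partial>\<mu>) + (\<integral>\<^sup>+y. ennreal (q y) \<partial>\<mu>) = (\<integral>\<^sup>+y. ennreal (p y) \<partial>\<mu>)"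
      unfolding pq(3) by (rule nn_integral_tame_diff[OF M(1) pq(1,2) le, symmetric])
    also have "\<dots> = (\<integral>\<^sup>+y. ennreal (p y) \<partial>\<nu>)" by (rule eq[OF pq(1)])
    also have "\<dots> = (\<integral>\<^sup>+y. ennreal (d y) \<partial>\<nu>) + (\<integral>\<^sup>+y. ennreal (q y) \<partial>\<nu>)"
      unfolding pq(3) by (rule nn_integral_tame_diff[OF M(2) pq(1,2) le])
    also have "(\<integral>\<^sup>+y. ennreal (q y) \<partial>\<nu>) = (\<integral>\<^sup>+y. ennreal (q y) \<partial>\<mu>)" by (rule eq[OF pq(2), symmetric])
    finally have "(\<integral>\<^sup>+y. ennreal (d y) \<partial>\<mu>) + (\<integral>\<^sup>+y. ennreal (q y) \<partial>\<mu>) =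
      (\<integral>\<^sup>+y. ennreal (d y) \<partial>\<nu>) + (\<integral>\<^sup>+y. ennreal (q y) \<partial>\<mu>)" .
    moreover have "(\<integral>\<^sup>+y. ennreal (q y) \<partial>\<mu>) \<noteq> \<infinity>" using fin[OF pq(2)] by (simp add: less_top)
    ultimately show ?thesis by (rule ennreal_add_right_imp_eq)
  qed
  have dens: "emeasure (density \<mu> (\<lambda>y. ennreal (u0 y))) D = emeasure (density \<nu> (\<lambda>y. ennreal (u0 y))) D"
    if D: "open D" for D
  proof -
    obtain F where F: "\<And>n::nat. F n \<in> tame_diff" "\<And>n x. 0 \<le> F n x" "\<And>n x. F n x \<le> u0 x"
      "\<And>n x. F n x \<le> F (Suc n) x" "\<And>n x. x \<notin> D \<Longrightarrow> F n x = 0"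
      "\<And>x. x \<in> D \<Longrightarrow> \<forall>\<^sub>F n in sequentially. F n x = u0 x"
      by (rule open_tame_diff_approximation[OF D]) blast
    have SUP: "ennreal (u0 y) * indicator D y = (SUP n. ennreal (F n y))" for y
    proof (cases "y \<in> D")
      case True
      obtain n where n: "F n y = u0 y" using F(6)[OF True] by (auto simp: eventually_sequentially)
      have "(SUP n. ennreal (F n y)) = ennreal (u0 y)"
        using F(3) n by (intro antisym SUP_least ennreal_leI SUP_upper2[of n]) simp_all
      then show ?thesis using True by simp
    next
      case False
      then show ?thesis using F(5) by simp
    qed
    have *: "emeasure (density \<rho> (\<lambda>y. ennreal (u0 y))) D = (SUP n. \<integral>\<^sup>+y. ennreal (F n y) \<partial>\<rho>)"
      if R: "sets \<rho> = sets borel" for \<rho>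
    proof -
      have "emeasure (density \<rho> (\<lambda>y. ennreal (u0 y))) D = (\<integral>\<^sup>+y. ennreal (u0 y) * indicator D y \<partial>\<rho>)"
        using u_meas D R by (intro emeasure_density) (simp_all add: measurable_cong_sets[OF R refl])
      also have "\<dots> = (SUP n. \<integral>\<^sup>+y. ennreal (F n y) \<partial>\<rho>)"
        unfolding SUP
        by (intro nn_integral_monotone_convergence_SUP incseq_SucI le_funI ennreal_leI F)
          (use meas[OF tame_diff_continuous[OF F(1)]] in \<open>simp add: measurable_cong_sets[OF R refl]\<close>)
      finally show ?thesis .
    qed
    show ?thesis unfolding *[OF M(1)] *[OF M(2)] using diff_eq[OF F(1,2)] by simp
  qed
  have density_eq: "density \<mu> (\<lambda>y. ennreal (u0 y)) = density \<nu> (\<lambda>y. ennreal (u0 y))"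
  proof (rule measure_eqI_generator_eq[where \<Omega> = UNIV and E = "{D. open D}" and A = "\<lambda>_. UNIV"])
    show "Int_stable {D :: 'a set. open D}" by (auto simp: Int_stable_def)
    have "emeasure (density \<mu> (\<lambda>y. ennreal (u0 y))) UNIV = (\<integral>\<^sup>+y. ennreal (u0 y) * indicator UNIV y \<partial>\<mu>)"
      using u_meas M(1) by (intro emeasure_density) (simp_all add: measurable_cong_sets[OF M(1) refl])
    then show "emeasure (density \<mu> (\<lambda>y. ennreal (u0 y))) UNIV \<noteq> \<infinity>"
      using fin[OF u0_tame] by (simp add: less_top)
  qed (use dens M in \<open>simp_all add: borel_def\<close>)
  have cancel_density: "density (density \<rho> (\<lambda>y. ennreal (u0 y))) (\<lambda>y. ennreal (1 / u0 y)) = \<rho>"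
    if R: "sets \<rho> = sets borel" for \<rho>
  proof -
    have "ennreal (u0 y) * ennreal (1 / u0 y) = 1" for y
      using u0_pos[of y] by (simp add: ennreal_mult[symmetric])
    then show ?thesis
      using u_meas inv_meas by (subst density_density_eq) (simp_all add: measurable_cong_sets[OF R refl] density_1)
  qed
  show ?thesis using cancel_density[OF M(1)] cancel_density[OF M(2)] density_eq by metis
qed

text \<open>The description of \<open>swept_measure\<close> defines a unique measure: existence is the Daniell representation on tame
  functions, extended to \<open>W\<close> by monotone convergence.\<close>

lemma swept_measure:
  "sets (swept_measure W x A) = sets borel"
  "u \<in> W \<Longrightarrow> (\<integral>\<^sup>+y. u y \<partial>swept_measure W x A) = reduced W u A x"
proof -
  let ?P = "\<lambda>\<mu>. sets \<mu> = sets borel \<and> (\<forall>u\<in>W. (\<integral>\<^sup>+y. u y \<partial>\<mu>) = reduced W u A x)"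
  obtain \<mu> where "sets \<mu> = sets borel \<and>
      (\<forall>p\<in>tame. (\<integral>\<^sup>+y. ennreal (p y) \<partial>\<mu>) = reduced W (\<lambda>y. ennreal (p y)) A x)"
    using exists_measure_representing_red[of A x] by (rule exE)
  then have \<mu>: "sets \<mu> = sets borel"
    "\<And>p. p \<in> tame \<Longrightarrow> (\<integral>\<^sup>+y. ennreal (p y) \<partial>\<mu>) = reduced W (\<lambda>y. ennreal (p y)) A x" by simp_all
  have P: "?P (swept_measure W x A)"
    unfolding swept_measure_def
  proof (rule theI)
    show "?P \<mu>" using \<mu>(1) nn_integral_eq_reduced[OF \<mu>] by simp
    fix \<nu> assume \<nu>: "?P \<nu>"
    have int: "(\<integral>\<^sup>+y. ennreal (p y) \<partial>\<nu>) = reduced W (\<lambda>y. ennreal (p y)) A x" if "p \<in> tame" for p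
      using \<nu>[THEN conjunct2] tameD(2)[OF that] by (rule bspec)
    show "\<nu> = \<mu>"
    proof (rule measure_eqI_tame)
      show "sets \<nu> = sets borel" using \<nu> by (rule conjunct1)
      show "sets \<mu> = sets borel" by (rule \<mu>)
      fix p assume p: "p \<in> tame"
      show "(\<integral>\<^sup>+y. ennreal (p y) \<partial>\<nu>) = (\<integral>\<^sup>+y. ennreal (p y) \<partial>\<mu>)" unfolding int[OF p] \<mu>(2)[OF p] ..
      show "(\<integral>\<^sup>+y. ennreal (p y) \<partial>\<nu>) < top"
        unfolding int[OF p] using reduced_tame_le[OF p] ennreal_less_top by (rule le_less_trans)
    qed
  qed
  show "sets (swept_measure W x A) = sets borel" using P by (rule conjunct1)
  show "(\<integral>\<^sup>+y. u y \<partial>swept_measure W x A) = reduced W u A x" if "u \<in> W"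
    using P[THEN conjunct2] that by (rule bspec)
qed

text \<open>Two tame functions that agree off \<open>D\<close> have the same reduction on \<open>- D\<close>, so the integral of their difference
  vanishes; differences that vanish off \<open>D\<close> exhaust \<open>D\<close>.\<close>

lemma AE_swept_measure:
  assumes D: "open D"
  shows "AE y in swept_measure W x (- D). y \<notin> D"
proof -
  let ?\<mu> = "swept_measure W x (- D)"
  have M: "sets ?\<mu> = sets borel" by (rule swept_measure)
  obtain F where F: "\<And>n::nat. F n \<in> tame_diff" "\<And>n x. 0 \<le> F n x" "\<And>n x. F n x \<le> u0 x"
    "\<And>n x. F n x \<le> F (Suc n) x" "\<And>n x. x \<notin> D \<Longrightarrow> F n x = 0"
    "\<And>x. x \<in> D \<Longrightarrow> \<forall>\<^sub>F n in sequentially. F n x = u0 x"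
    by (rule open_tame_diff_approximation[OF D]) blast
  have "AE y in ?\<mu>. ennreal (F n y) = 0" for n
  proof -
    obtain p q where pq: "p \<in> tame" "q \<in> tame" "F n = (\<lambda>x. p x - q x)" using F(1) by (rule tame_diffE)
    have le: "q y \<le> p y" for y using F(2)[of n y] pq(3) by simp
    have "p y = q y" if "y \<in> - D" for y using F(5)[of y n] that pq(3) by simp
    then have "reduced W (\<lambda>y. ennreal (p y)) (- D) x = reduced W (\<lambda>y. ennreal (q y)) (- D) x"
      by (intro antisym reduced_mono) simp_all
    then have "(\<integral>\<^sup>+y. ennreal (F n y) \<partial>?\<mu>) + (\<integral>\<^sup>+y. ennreal (q y) \<partial>?\<mu>) = 0 + (\<integral>\<^sup>+y. ennreal (q y) \<partial>?\<mu>)"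
      using nn_integral_tame_diff[OF M pq(1,2) le] swept_measure(2)[OF tameD(2)[OF pq(1)]]
        swept_measure(2)[OF tameD(2)[OF pq(2)]] pq(3) by simp
    moreover have "(\<integral>\<^sup>+y. ennreal (q y) \<partial>?\<mu>) \<noteq> \<infinity>"
      using swept_measure(2)[OF tameD(2)[OF pq(2)]] le_less_trans[OF reduced_tame_le[OF pq(2)] ennreal_less_top]
      by (metis infinity_ennreal_def less_irrefl)
    ultimately have "(\<integral>\<^sup>+y. ennreal (F n y) \<partial>?\<mu>) = 0" by (rule ennreal_add_right_imp_eq)
    moreover have "(\<lambda>y. ennreal (F n y)) \<in> borel_measurable ?\<mu>"
      unfolding measurable_cong_sets[OF M refl]
      by (intro borel_measurable_continuous_onI continuous_on_ennreal tame_diff_continuous F)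
    ultimately show ?thesis by (simp add: nn_integral_0_iff_AE)
  qed
  then have "AE y in ?\<mu>. \<forall>n. ennreal (F n y) = 0" by (simp add: AE_all_countable)
  then show ?thesis
  proof eventually_elim
    fix y assume *: "\<forall>n. ennreal (F n y) = 0"
    show "y \<notin> D"
    proof
      assume "y \<in> D"
      then obtain n where "F n y = u0 y" using F(6) by (auto simp: eventually_sequentially)
      then show False using *[rule_format, of n] u0_pos[of y] by simp
    qed
  qed
qed

end

section \<open>Harmonicity of the constants\<close>

lemma compact_closure_of_subset:
  fixes C :: "'a::t2_space set"
  assumes "compact C" and "U \<subseteq> C"
  shows "compact (closure U)"
proof -
  have "closure U \<subseteq> C" using assms by (intro closure_minimal compact_imp_closed)
  then have "closure U = C \<inter> closure U" by blast
  then show ?thesis using compact_Int_closed[OF assms(1) closed_closure] by metis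
qed

lemma compact_in_relatively_compact_open:
  assumes lc: "locally_compact_space (euclidean :: 'a::t2_space topology)" and K: "compact (K :: 'a set)"
  obtains V where "open V" "K \<subseteq> V" "compact (closure V)"
proof -
  have "\<exists>U. open U \<and> x \<in> U \<and> compact (closure U)" for x :: 'a
  proof -
    obtain U C where U: "open U" "compact C" "x \<in> U" "U \<subseteq> C"
    proof -
      have "\<forall>x::'a. \<exists>U. open U \<and> (\<exists>C. compact C \<and> x \<in> U \<and> U \<subseteq> C)"
        using lc by (simp add: locally_compact_space_def)
      then show ?thesis using that by blast
    qed
    with compact_closure_of_subset[OF U(2,4)] show ?thesis by blast
  qed
  then obtain U where U: "\<And>x::'a. open (U x)" "\<And>x. x \<in> U x" "\<And>x. compact (closure (U x))" by metis
  have "K \<subseteq> (\<Union>x\<in>K. U x)" using U(2) by blast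
  then obtain F where F: "F \<subseteq> K" "finite F" "K \<subseteq> (\<Union>x\<in>F. U x)"
    using compactE_image[OF K, of K U] U(1) by metis
  show ?thesis
  proof
    show "open (\<Union>x\<in>F. U x)" using U(1) by blast
    show "K \<subseteq> (\<Union>x\<in>F. U x)" by (rule F)
    show "compact (closure (\<Union>x\<in>F. U x))"
    proof (rule compact_closure_of_subset)
      show "compact (\<Union>x\<in>F. closure (U x))" using F(2) U(3) by (intro compact_UN)
      show "(\<Union>x\<in>F. U x) \<subseteq> (\<Union>x\<in>F. closure (U x))" by (intro UN_mono order_refl closure_subset)
    qed
  qed
qed

context weighted_balayage_space
begin

lemma e_v0_mem: "0 \<le> e \<Longrightarrow> (\<lambda>y. ennreal (e * v0 y)) \<in> W"
  using scale_mem[OF v0_mem, of e] v0_pos by (simp add: ennreal_mult less_imp_le)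

lemma ennreal_le_of_le_add_v0:
  assumes "\<And>e. 0 < e \<Longrightarrow> a \<le> b + ennreal (e * v0 x)"
  shows "a \<le> b"
proof (rule ennreal_le_epsilon)
  fix e :: real assume "0 < e"
  then have "0 < e / v0 x" "e / v0 x * v0 x = e" using v0_pos[of x] by simp_all
  with assms[of "e / v0 x"] show "a \<le> b + ennreal e" by simp
qed

text \<open>Here \<open>r\<close> is the smallest among all majorants in \<open>W\<close>, not only among the tame ones.\<close>

definition least_majorant :: "('a \<Rightarrow> real) \<Rightarrow> ('a \<Rightarrow> real) \<Rightarrow> bool" where
  "least_majorant d r \<longleftrightarrow> r \<in> tame \<and> (\<forall>y. d y \<le> r y) \<and>
     (\<forall>w\<in>W. (\<forall>z. ennreal (d z) \<le> w z) \<longrightarrow> (\<forall>y. ennreal (r y) \<le> w y))"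

lemma least_majorantD:
  assumes "least_majorant d r"
  shows "r \<in> tame" "d y \<le> r y" "w \<in> W \<Longrightarrow> (\<And>z. ennreal (d z) \<le> w z) \<Longrightarrow> ennreal (r y) \<le> w y"
  using assms unfolding least_majorant_def by simp_all

lemma exists_least_majorant:
  assumes "d \<in> tame_diff"
  shows "\<exists>r. least_majorant d r"
proof -
  obtain p q where pq: "p \<in> tame" "q \<in> tame" "d = (\<lambda>x. p x - q x)" using assms by (rule tame_diffE)
  obtain r where "r \<in> tame" "\<And>x. p x - q x \<le> r x"
    "\<And>w x. w \<in> W \<Longrightarrow> (\<And>y. ennreal (p y - q y) \<le> w y) \<Longrightarrow> ennreal (r x) \<le> w x"
    by (rule reduced_diff_tame[OF pq(1,2)]) blast
  then have "least_majorant d r" unfolding least_majorant_def pq(3) by simp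
  then show ?thesis by (rule exI[of _ r])
qed

text \<open>Where \<open>r\<close> stays away from \<open>d\<close>, it is harmonic. Indeed \<open>l * min w r + (1 - l) * r\<close> is a majorant of \<open>d\<close>: on
  \<open>D\<close> because of the gap between \<open>d\<close> and \<open>r\<close>, elsewhere because it equals \<open>r\<close>. Hence it is at least \<open>r\<close>, and
  \<open>min w r = r\<close>.\<close>

lemma least_majorant_fixed_off_noncontact:
  assumes lm: "least_majorant d r"
    and l: "0 < l" "l \<le> 1" and gap: "\<And>y. y \<in> D \<Longrightarrow> d y \<le> r y - l * r y"
    and w: "w \<in> W" "\<And>y. y \<notin> D \<Longrightarrow> ennreal (r y) \<le> w y"
  shows "ennreal (r y) \<le> w y"
proof -
  note r = least_majorantD(1)[OF lm] and dr = least_majorantD(2)[OF lm] and min = least_majorantD(3)[OF lm]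
  define m where "m y = enn2real (min (w y) (ennreal (r y)))" for y
  have m: "ennreal (m y) = min (w y) (ennreal (r y))" for y
    unfolding m_def by (rule ennreal_enn2real) (simp add: min_less_iff_disj)
  have m_nonneg: "0 \<le> m y" for y by (simp add: m_def)
  have r_nonneg: "0 \<le> r y" for y by (rule tameD(1)[OF r])
  have m_off: "m y = r y" if "y \<notin> D" for y
    unfolding m_def using w(2)[OF that] r_nonneg[of y] by (simp add: min_absorb2)
  have eq: "ennreal (l * m y + (1 - l) * r y) = ennreal l * min (w y) (ennreal (r y)) + ennreal (1 - l) * ennreal (r y)" for y
    using l m_nonneg[of y] r_nonneg[of y] by (simp add: ennreal_mult m)
  have "(\<lambda>y. ennreal (l * m y + (1 - l) * r y)) \<in> W"
    unfolding eq using l by (intro add_mem scale_mem min_mem w tameD(2) r) simp_all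
  moreover have "ennreal (d z) \<le> ennreal (l * m z + (1 - l) * r z)" for z
  proof (rule ennreal_leI, cases "z \<in> D")
    case True
    have "d z \<le> (1 - l) * r z" using gap[OF True] by (simp add: algebra_simps)
    then show "d z \<le> l * m z + (1 - l) * r z" using l m_nonneg[of z] by (simp add: add_increasing)
  next
    case False
    then show "d z \<le> l * m z + (1 - l) * r z" using dr[of z] by (simp add: m_off algebra_simps)
  qed
  ultimately have "ennreal (r y) \<le> ennreal (l * m y + (1 - l) * r y)" by (rule min)
  moreover have "0 \<le> l * m y + (1 - l) * r y" using l m_nonneg[of y] r_nonneg[of y] by simp
  ultimately have "r y \<le> l * m y + (1 - l) * r y" by (subst (asm) ennreal_le_iff)
  then have "l * r y \<le> l * m y" by (simp add: algebra_simps)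
  then have "ennreal (r y) \<le> ennreal (m y)" using l by (intro ennreal_leI) simp
  then show ?thesis unfolding m by simp
qed

end

locale unit_harmonic_balayage_space = weighted_balayage_space +
  assumes harmonic_one: "harmonic W (\<lambda>_. 1)"
begin

lemma swept_measure_total:
  assumes V: "open V" "compact (closure V)" and x: "x \<in> V"
  shows "(\<integral>\<^sup>+y. 1 \<partial>swept_measure W x (- V)) = 1"
proof -
  let ?\<mu> = "swept_measure W x (- V)"
  have "integrable ?\<mu> (\<lambda>y. 1 :: real)" "(\<integral>y. 1 \<partial>?\<mu>) = (1 :: real)"
    using harmonic_one V x unfolding harmonic_on_def by auto
  then have "(\<integral>\<^sup>+y. ennreal 1 \<partial>?\<mu>) = ennreal 1"
    by (subst nn_integral_eq_integral) simp_all
  then show ?thesis by simp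
qed

text \<open>The minimum principle. On the relatively compact open set \<open>D = {r > 1 + e v0}\<close> the function \<open>r\<close> is harmonic, since
  \<open>d \<le> 1\<close>. Its swept measures live off \<open>D\<close>, where \<open>r \<le> 1 + e v0\<close>, and have total mass \<open>1\<close>. So \<open>r \<le> 1 + e v0\<close> on
  \<open>D\<close> as well, a contradiction.\<close>

lemma least_majorant_le_one:
  assumes lm: "least_majorant d r" and d1: "\<And>y. d y \<le> 1"
  shows "r x \<le> 1"
proof (rule ccontr)
  assume "\<not> r x \<le> 1"
  note r = least_majorantD(1)[OF lm]
  define e where "e = (r x - 1) / (2 * v0 x)"
  have e: "0 < e" "1 + e * v0 x < r x" using \<open>\<not> r x \<le> 1\<close> v0_pos[of x] by (simp_all add: e_def field_simps)
  define D where "D = {y. 1 + e * v0 y < r y}"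
  obtain K where K: "compact K" "\<And>y. y \<notin> K \<Longrightarrow> r y \<le> e * v0 y" using tameD(4)[OF r e(1)] by blast
  have DK: "D \<subseteq> K" using K(2) by (force simp: D_def)
  have D: "open D"
    unfolding D_def by (intro open_Collect_less continuous_on_add continuous_on_mult_left continuous_on_const v0_cont tameD r)
  have cD: "compact (closure D)" using K(1) DK by (rule compact_closure_of_subset)
  have xD: "x \<in> D" using e by (simp add: D_def)
  have "continuous_on K (\<lambda>y. r y / v0 y)"
    using v0_pos by (intro continuous_on_divide continuous_on_subset[OF tameD(3)[OF r]] continuous_on_subset[OF v0_cont])
      (auto simp: less_imp_neq[symmetric])
  then obtain z where z: "\<And>y. y \<in> K \<Longrightarrow> r y / v0 y \<le> r z / v0 z"
    using continuous_attains_sup[OF K(1), of "\<lambda>y. r y / v0 y"] DK xD by blast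
  define B where "B = r z / v0 z + 1"
  have B: "0 < B" using tameD(1)[OF r, of z] v0_pos[of z] by (simp add: B_def add_nonneg_pos)
  have rB: "r y \<le> B * v0 y" if "y \<in> K" for y
  proof -
    have "r y / v0 y \<le> B" using z[OF that] by (simp add: B_def)
    then show ?thesis using v0_pos[of y] by (simp add: pos_divide_le_eq)
  qed
  \<comment> \<open>Chosen so that \<open>l * r \<le> e * v0\<close> on \<open>K\<close>; on \<open>D\<close> this leaves the gap \<open>d \<le> 1 \<le> r - l * r\<close>.\<close>
  define l where "l = min 1 (e / B)"
  have l: "0 < l" "l \<le> 1" using e(1) B by (simp_all add: l_def)
  have gap: "d y \<le> r y - l * r y" if "y \<in> D" for y
  proof -
    have "l * r y \<le> (e / B) * (B * v0 y)"
      using rB[of y] that DK l B e(1) tameD(1)[OF r, of y] by (intro mult_mono) (auto simp: l_def)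
    also have "\<dots> = e * v0 y" using B by simp
    finally show ?thesis using that d1[of y] by (simp add: D_def)
  qed
  let ?\<mu> = "swept_measure W x (- D)"
  have M: "sets ?\<mu> = sets borel" by (rule swept_measure)
  have "ennreal (r x) \<le> reduced W (\<lambda>y. ennreal (r y)) (- D) x"
    using least_majorant_fixed_off_noncontact[OF lm l gap] by (intro reduced_greatest) simp
  also have "\<dots> = (\<integral>\<^sup>+y. ennreal (r y) \<partial>?\<mu>)" by (intro swept_measure(2)[symmetric] tameD r)
  also have "\<dots> \<le> (\<integral>\<^sup>+y. 1 + ennreal (e * v0 y) \<partial>?\<mu>)"
  proof (rule nn_integral_mono_AE)
    show "AE y in ?\<mu>. ennreal (r y) \<le> 1 + ennreal (e * v0 y)"
      using AE_swept_measure[OF D, of x]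
    proof eventually_elim
      fix y assume "y \<notin> D"
      then have "ennreal (r y) \<le> ennreal (1 + e * v0 y)" by (intro ennreal_leI) (simp add: D_def)
      also have "\<dots> = 1 + ennreal (e * v0 y)" using e(1) v0_pos[of y] by (subst ennreal_plus) simp_all
      finally show "ennreal (r y) \<le> 1 + ennreal (e * v0 y)" .
    qed
  qed
  also have "\<dots> = (\<integral>\<^sup>+y. 1 \<partial>?\<mu>) + (\<integral>\<^sup>+y. ennreal (e * v0 y) \<partial>?\<mu>)"
    using e(1) by (intro nn_integral_add) (simp_all add: measurable_cong_sets[OF M refl] measurable_W e_v0_mem)
  also have "\<dots> = 1 + reduced W (\<lambda>y. ennreal (e * v0 y)) (- D) x"
    using e(1) by (simp add: swept_measure_total[OF D cD xD] swept_measure(2) e_v0_mem del: nn_integral_const)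
  also have "\<dots> \<le> 1 + ennreal (e * v0 x)"
    using e(1) by (intro add_left_mono reduced_lower e_v0_mem) simp_all
  also have "\<dots> = ennreal (1 + e * v0 x)" using e(1) v0_pos[of x] by (subst ennreal_plus) simp_all
  also have "\<dots> < ennreal (r x)" using e v0_pos[of x] by (intro ennreal_lessI) (simp_all add: tameD(1)[OF r] add_pos_nonneg less_trans[OF _ e(2)])
  finally show False by simp
qed

text \<open>The constant \<open>1\<close> is the supremum of the smallest majorants of the functions \<open>d \<le> 1\<close> in \<open>tame_diff\<close>.\<close>

lemma one_mem: "(\<lambda>y. 1) \<in> W"
proof -
  let ?C = "{r \<in> tame. \<forall>y. r y \<le> 1}"
  have SUP1: "(SUP p\<in>?C. ennreal (p x)) = 1" for x
  proof (rule antisym)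
    show "(SUP p\<in>?C. ennreal (p x)) \<le> 1"
      by (rule SUP_least) (auto simp: ennreal_le_1)
    show "1 \<le> (SUP p\<in>?C. ennreal (p x))"
    proof (rule dense_le)
      fix b :: ennreal assume "b < 1"
      define b' where "b' = enn2real b"
      have b: "b = ennreal b'" "0 \<le> b'" "b' < 1"
        using \<open>b < 1\<close> by (auto simp: b'_def less_trans[OF _ ennreal_one_less_top])
      define c where "c = (b' + 1) / 2"
      have c: "b' < c" "c < 1" "0 < c" using b by (simp_all add: c_def)
      define a where "a = c / u0 x"
      have a: "0 < a" "a * u0 x = c" using c(3) u0_pos[of x] by (simp_all add: a_def)
      let ?G = "{y. a * u0 y < 1}"
      have G: "open ?G" by (intro open_Collect_less continuous_on_mult_left u0_cont continuous_on_const)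
      obtain F where F: "\<And>n::nat. F n \<in> tame_diff" "\<And>n x. 0 \<le> F n x" "\<And>n x. F n x \<le> u0 x"
        "\<And>n x. F n x \<le> F (Suc n) x" "\<And>n x. x \<notin> ?G \<Longrightarrow> F n x = 0"
        "\<And>x. x \<in> ?G \<Longrightarrow> \<forall>\<^sub>F n in sequentially. F n x = u0 x"
        by (rule open_tame_diff_approximation[OF G]) blast
      have "x \<in> ?G" using a(2) c(2) by simp
      from F(6)[OF this] obtain n where n: "F n x = u0 x" by (auto simp: eventually_sequentially)
      have "(\<lambda>y. a * F n y) \<in> tame_diff" by (intro tame_diff_scale F)
      from exists_least_majorant[OF this] obtain r where r: "least_majorant (\<lambda>y. a * F n y) r" ..
      have "a * F n y \<le> 1" for y
      proof (cases "y \<in> ?G")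
        case True
        have "a * F n y \<le> a * u0 y" using a(1) F(3) by (intro mult_left_mono) simp_all
        then show ?thesis using True by simp
      qed (simp add: F(5))
      then have "r y \<le> 1" for y by (rule least_majorant_le_one[OF r])
      then have "r \<in> ?C" using least_majorantD(1)[OF r] by blast
      then have "ennreal (r x) \<le> (SUP p\<in>?C. ennreal (p x))" by (rule SUP_upper2) simp
      moreover have "b \<le> ennreal (r x)" unfolding b(1) using least_majorantD(2)[OF r, of x] n a(2) c(1) by (intro ennreal_leI) simp
      ultimately show "b \<le> (SUP p\<in>?C. ennreal (p x))" by (rule order_trans[rotated])
    qed
  qed
  have directed: "\<exists>r\<in>?C. \<forall>x. p x \<le> r x \<and> q x \<le> r x" if "p \<in> ?C" "q \<in> ?C" for p q
  proof -
    have "(\<lambda>x. max (p x) (q x)) \<in> tame_diff" using that by (intro tame_diff_max tame_diff_tame) simp_all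
    from exists_least_majorant[OF this] obtain r where r: "least_majorant (\<lambda>x. max (p x) (q x)) r" ..
    have "max (p y) (q y) \<le> 1" for y using that by simp
    then have "r y \<le> 1" for y by (rule least_majorant_le_one[OF r])
    moreover have "p y \<le> r y \<and> q y \<le> r y" for y using least_majorantD(2)[OF r, of y] by simp
    ultimately show ?thesis using least_majorantD(1)[OF r] by blast
  qed
  have "(\<lambda>x. 0) \<in> ?C" using tame_zero by simp
  then have nonempty: "?C \<noteq> {}" by (rule ex_in_conv[THEN iffD1, OF exI])
  have "?C \<subseteq> tame" by (rule Collect_restrict)
  then have "\<exists>p. (\<forall>n::nat. p n \<in> ?C) \<and> (\<forall>n x. p n x \<le> p (Suc n) x) \<and>
      (\<forall>x. (SUP n. ennreal (p n x)) = (SUP p\<in>?C. ennreal (p x)))"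
    using nonempty directed by (intro directed_tame_sequence ballI)
  then obtain p :: "nat \<Rightarrow> 'a \<Rightarrow> real" where
    P: "(\<forall>n. p n \<in> ?C) \<and> (\<forall>n x. p n x \<le> p (Suc n) x) \<and>
      (\<forall>x. (SUP n. ennreal (p n x)) = (SUP p\<in>?C. ennreal (p x)))" by (rule exE)
  note p = P[THEN conjunct1, THEN spec] P[THEN conjunct2, THEN conjunct1, THEN spec, THEN spec]
    P[THEN conjunct2, THEN conjunct2, THEN spec]
  have "(\<lambda>x. SUP n. ennreal (p n x)) \<in> W"
    using p(1,2) by (intro SUP_mem) (simp_all add: tameD(2) ennreal_leI)
  then show ?thesis unfolding p(3) SUP1 .
qed

lemma const_mem: "0 \<le> c \<Longrightarrow> (\<lambda>y. ennreal c) \<in> W"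
  using scale_mem[OF one_mem, of c] by simp

lemma reduced_const_complement:
  assumes V: "open V" "compact (closure V)"
  shows "reduced W (\<lambda>_. 1) (- V) x = 1"
proof (cases "x \<in> V")
  case True
  then show ?thesis using swept_measure(2)[OF one_mem, of x "- V"] swept_measure_total[OF V True] by simp
next
  case False
  then show ?thesis using reduced_eq[OF one_mem, of x "- V"] by simp
qed

lemma const_fixed:
  assumes V: "open V" "compact (closure V)" and c: "0 \<le> c"
    and w: "w \<in> W" "\<And>y. y \<in> - V \<Longrightarrow> ennreal c \<le> w y"
  shows "ennreal c \<le> w x"
proof (cases "c = 0")
  case False
  with c have "0 < c" by simp
  then have "ennreal c = reduced W (\<lambda>y. ennreal c * 1) (- V) x"
    by (subst reduced_scale) (simp_all add: reduced_const_complement[OF V])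
  also have "\<dots> \<le> w x" using w by (intro reduced_lower) simp_all
  finally show ?thesis .
qed simp

text \<open>Let \<open>p n\<close> increase to \<open>w\<close>, and let \<open>r n\<close> be the smallest majorant of the positive part of \<open>p n - c\<close>. The claim
  is \<open>r n \<le> w - c\<close>, for then \<open>r n\<close> increases to \<open>w - c\<close>. Given \<open>e > 0\<close>, the criterion
  \<open>diff_mem_of_fixed_by_reduction\<close> applies to \<open>min (w + e v0) (r n + c)\<close> and \<open>c\<close>, as \<open>r n \<le> e v0\<close> off a relatively
  compact open set \<open>V\<close> and \<open>c\<close>, being harmonic, is determined by its values off \<open>V\<close>. So
  \<open>min (w - c + e v0) (r n)\<close> is in \<open>W\<close>; it also majorizes \<open>p n - c\<close> and thus is at least \<open>r n\<close>.\<close>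

lemma subtract_const_mem:
  assumes w: "w \<in> W" and c: "0 \<le> c" and le: "\<And>y. ennreal c \<le> w y"
  shows "\<exists>g\<in>W. \<forall>y. w y = g y + ennreal c"
proof -
  obtain p where p: "\<And>n::nat. p n \<in> tame" "\<And>n y. p n y \<le> p (Suc n) y"
    "\<And>y. w y = (SUP n. ennreal (p n y))" by (rule increasing_tame_approximation[OF w]) blast
  have d: "(\<lambda>y. p n y - min (p n y) c) \<in> tame_diff" for n
    using c by (intro tame_diffI p tame_min const_mem continuous_on_const) simp_all
  have "\<forall>n. \<exists>r. least_majorant (\<lambda>y. p n y - min (p n y) c) r" using exists_least_majorant[OF d] by blast
  from choice[OF this] obtain r where lm: "\<And>n. least_majorant (\<lambda>y. p n y - min (p n y) c) (r n)" by blast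
  note r = least_majorantD(1,2)[OF lm] and r_min = least_majorantD(3)[OF lm]
  have r_nonneg: "0 \<le> r n y" for n y by (rule tameD(1)[OF r(1)])
  have p_le: "ennreal (p n y) \<le> ennreal (r n y) + ennreal c" for n y
  proof -
    have "p n y \<le> r n y + c" using r(2)[of n y] r_nonneg[of n y] by (cases "p n y \<le> c") simp_all
    then have "ennreal (p n y) \<le> ennreal (r n y + c)" by (rule ennreal_leI)
    then show ?thesis using r_nonneg[of n y] c by simp
  qed
  have pw: "ennreal (p n y) \<le> w y" for n y unfolding p(3) by (rule SUP_upper) simp
  have r_le: "ennreal (r n y) + ennreal c \<le> w y" for n y
  proof (rule ennreal_le_of_le_add_v0)
    fix e :: real assume e: "0 < e"
    obtain K where K: "compact K" "\<And>y. y \<notin> K \<Longrightarrow> r n y \<le> e * v0 y" using tameD(4)[OF r(1) e] by blast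
    obtain V where V: "open V" "K \<subseteq> V" "compact (closure V)"
      using locally_compact K(1) by (rule compact_in_relatively_compact_open)
    let ?Y = "\<lambda>y. min (w y + ennreal (e * v0 y)) (ennreal (r n y) + ennreal c)"
    have "\<exists>s\<in>W. \<forall>y. ?Y y = s y + ennreal c"
    proof (rule diff_mem_of_fixed_by_reduction[where A = "- V" and b = "\<lambda>y. ennreal (r n y)"])
      show "?Y \<in> W" using e c by (intro min_mem add_mem w e_v0_mem tameD(2) r const_mem) simp_all
      show "(\<lambda>y. ennreal (r n y)) \<in> W" by (intro tameD(2) r)
      show "(\<lambda>y. ennreal c) \<in> W" using c by (rule const_mem)
      show "?Y y = ennreal (r n y) + ennreal c" if "y \<in> - V" for y
      proof (rule min_absorb2)
        have "ennreal (r n y) \<le> ennreal (e * v0 y)" using that V(2) K(2) by (intro ennreal_leI) auto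
        then show "ennreal (r n y) + ennreal c \<le> w y + ennreal (e * v0 y)"
          using le[of y] by (subst add.commute) (rule add_mono)
      qed
      show "ennreal c \<le> u y" if "u \<in> W" "\<And>y. y \<in> - V \<Longrightarrow> ennreal c \<le> u y" for u y
        using const_fixed[OF V(1,3) c that] .
    qed simp_all
    then obtain s where s: "s \<in> W" "\<And>y. ?Y y = s y + ennreal c" by blast
    have "ennreal (p n z - min (p n z) c) \<le> s z" for z
    proof (cases "p n z \<le> c")
      case False
      have "ennreal (p n z) \<le> ?Y z" using p_le[of n z] pw[of n z] by (simp add: add_increasing2)
      then have "ennreal (p n z) - ennreal c \<le> s z" unfolding s(2) by (simp add: ennreal_minus_le_iff add.commute)
      then show ?thesis using False c by (simp add: ennreal_minus min_absorb2)
    qed simp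
    then have "ennreal (r n y) \<le> s y" by (rule r_min[OF s(1)])
    then have "ennreal (r n y) + ennreal c \<le> ?Y y" unfolding s(2) by (rule add_right_mono)
    then show "ennreal (r n y) + ennreal c \<le> w y + ennreal (e * v0 y)" by simp
  qed
  have r_mono: "ennreal (r n y) \<le> ennreal (r (Suc n) y)" for n y
  proof (rule r_min)
    show "(\<lambda>y. ennreal (r (Suc n) y)) \<in> W" by (intro tameD(2) r)
    fix z
    have "p n z - min (p n z) c \<le> r (Suc n) z" using r(2)[of "Suc n" z] p(2)[of n z] r_nonneg[of "Suc n" z]
      by (simp add: min_def split: if_splits)
    then show "ennreal (p n z - min (p n z) c) \<le> ennreal (r (Suc n) z)" by (rule ennreal_leI)
  qed
  have "(\<lambda>y. SUP n. ennreal (r n y)) \<in> W" by (rule SUP_mem) (simp_all only: tameD(2) r r_mono)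
  moreover have "w y = (SUP n. ennreal (r n y)) + ennreal c" for y
  proof -
    have "(SUP n. ennreal (r n y)) + ennreal c = (SUP n. ennreal (r n y) + ennreal c)"
      by (simp add: ennreal_SUP_add_left)
    also have "\<dots> = w y"
    proof (rule antisym)
      show "(SUP n. ennreal (r n y) + ennreal c) \<le> w y" by (intro SUP_least r_le)
      show "w y \<le> (SUP n. ennreal (r n y) + ennreal c)" unfolding p(3)
        by (rule SUP_mono) (use p_le in blast)
    qed
    finally show ?thesis ..
  qed
  ultimately show ?thesis by (intro bexI[of _ "\<lambda>y. SUP n. ennreal (r n y)"] allI)
qed

end

section \<open>Continuity of reduced functions\<close>

context unit_harmonic_balayage_space
begin

text \<open>Continuity of harmonic functions with values in \<open>[0, 1]\<close> will be proved by perturbing both \<open>h\<close> and \<open>1 - h\<close> by the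
  same continuous \<open>s\<close> such that the sums coincide on \<open>U\<close> with elements of \<open>W\<close>, which makes \<open>h\<close> both lower and upper
  semicontinuous. The advantage is that this property passes to monotone limits.\<close>

definition complemented_on :: "'a set \<Rightarrow> ('a \<Rightarrow> ennreal) \<Rightarrow> ('a \<Rightarrow> ennreal) \<Rightarrow> bool" where
  "complemented_on U s h \<longleftrightarrow> (\<forall>y\<in>U. h y \<le> 1) \<and> (\<exists>w\<in>W. \<forall>y\<in>U. w y = s y + h y) \<and>
     (\<exists>w\<in>W. \<forall>y\<in>U. w y = s y + (1 - h y))"

lemma complemented_on_cong:
  "(\<And>y. y \<in> U \<Longrightarrow> h y = k y) \<Longrightarrow> complemented_on U s h = complemented_on U s k"
  unfolding complemented_on_def by simp

lemma one_diff_one_diff: "h \<le> 1 \<Longrightarrow> 1 - (1 - h) = (h :: ennreal)"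
  by (rule diff_diff_ennreal) simp_all

lemma complemented_on_complement:
  assumes "complemented_on U s h"
  shows "complemented_on U s (\<lambda>y. 1 - h y)"
  using assms unfolding complemented_on_def by (simp add: one_diff_one_diff cong: ball_cong)

lemma add_complement_eq_diff:
  fixes a b :: ennreal
  assumes "a < top" and "b \<le> 1"
  shows "a + (1 - b) = (a + (a + 1)) - (a + b)"
proof -
  obtain r where r: "a = ennreal r" "0 \<le> r" using assms(1) by (cases a) auto
  have "b < top" using assms(2) by (rule le_less_trans) simp
  then obtain q where q: "b = ennreal q" "0 \<le> q" by (cases b) auto
  have q1: "q \<le> 1" using assms(2) q by (simp add: ennreal_le_1)
  have "a + (1 - b) = ennreal r + ennreal (1 - q)" using q(2) unfolding r(1) q(1) ennreal_1[symmetric] by (subst ennreal_minus) simp_all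
  also have "\<dots> = ennreal ((r + (r + 1)) - (r + q))" using r(2) q1 by (subst ennreal_plus[symmetric]) simp_all
  also have "\<dots> = ennreal (r + (r + 1)) - ennreal (r + q)" using r(2) q(2) by (intro ennreal_minus[symmetric]) simp
  also have "ennreal (r + (r + 1)) = a + (a + 1)"
    unfolding r(1) using r(2) by (simp only: ennreal_plus ennreal_1 add_nonneg_nonneg zero_le_one)
  also have "ennreal (r + q) = a + b" unfolding r(1) q(1) using r(2) q(2) by simp
  finally show ?thesis .
qed

lemma fine_lsc_regularization_mem_mono:
  assumes V: "V \<subseteq> W" and le: "Inf V \<le> Inf V'"
  shows "fine_lsc_regularization W (Inf V) \<le> fine_lsc_regularization W (Inf V')"
  using order_trans[OF fine_lsc_regularization_le le] lsc[OF B2[OF V]]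
  by (intro fine_lsc_regularization_greatest finely_lower_semicontinuous)

text \<open>(B1) handles \<open>s + h\<close>, after the functions of \<open>W\<close> have been replaced by an increasing sequence. For
  \<open>s + (1 - h)\<close> the limit is an infimum, and (B2) yields only its regularization. But the first part shows that
  the limit of \<open>h n\<close> is finely continuous on \<open>U\<close>, so the regularization does not change the infimum there.\<close>

lemma complemented_on_SUP:
  assumes U: "open U" and s: "s \<in> W" "\<And>y. y \<in> U \<Longrightarrow> s y < top"
    and h: "\<And>n::nat. complemented_on U s (h n)" and mono: "\<And>n y. y \<in> U \<Longrightarrow> h n y \<le> h (Suc n) y"
  shows "complemented_on U s (\<lambda>y. SUP n. h n y)"
proof -
  have h1: "h n y \<le> 1" if "y \<in> U" for n y using h[of n] that by (simp add: complemented_on_def)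
  have H1: "(SUP n. h n y) \<le> 1" if "y \<in> U" for y using h1[OF that] by (rule SUP_least)
  have "\<exists>w. w \<in> W \<and> (\<forall>y\<in>U. w y = s y + h n y)" for n
    using h[of n] unfolding complemented_on_def by blast
  then have "\<forall>n. \<exists>w. w \<in> W \<and> (\<forall>y\<in>U. w y = s y + h n y)" by (rule allI)
  from choice[OF this] obtain w where w: "\<And>n. w n \<in> W" "\<And>n y. y \<in> U \<Longrightarrow> w n y = s y + h n y" by blast
  have "\<exists>w. w \<in> W \<and> (\<forall>y\<in>U. w y = s y + (1 - h n y))" for n
    using h[of n] unfolding complemented_on_def by blast
  then have "\<forall>n. \<exists>w. w \<in> W \<and> (\<forall>y\<in>U. w y = s y + (1 - h n y))" by (rule allI)
  from choice[OF this] obtain w' where w': "\<And>n. w' n \<in> W" "\<And>n y. y \<in> U \<Longrightarrow> w' n y = s y + (1 - h n y)" by blast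
  have h_mono: "h m y \<le> h n y" if "m \<le> n" "y \<in> U" for m n y
    using lift_Suc_mono_le[of "\<lambda>n. h n y", OF mono[OF that(2)] that(1)] .
  \<comment> \<open>The \<open>w n\<close> are known to increase only on \<open>U\<close>. The regularized infima of the tails increase everywhere and still equal
    \<open>w n\<close> on \<open>U\<close>.\<close>
  define v where "v n = fine_lsc_regularization W (Inf (w ` {n..}))" for n
  have v_mem: "v n \<in> W" for n unfolding v_def using w(1) by (intro B2) blast
  have v_eq: "v n y = s y + h n y" if "y \<in> U" for n y
  proof -
    have "v n y = w n y" unfolding v_def
    proof (rule fine_lsc_regularization_Inf_eq[OF _ _ _ that])
      show "w ` {n..} \<subseteq> W" using w(1) by blast
      show "openin (fine_topology W) {z \<in> U. a < w n z}" for a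
      proof (rule openin_fine_topology_open)
        have "{z \<in> U. a < w n z} = U \<inter> {z. a < w n z}" by blast
        then show "open {z \<in> U. a < w n z}" using U lsc[OF w(1)] by (simp add: lower_semicontinuous_euclidean open_Int)
      qed
      fix z assume z: "z \<in> U"
      have "Inf (w ` {n..}) z = (INF m\<in>{n..}. w m z)" by (simp add: image_image)
      also have "\<dots> = w n z"
        using z by (intro antisym INF_lower INF_greatest) (simp_all add: w(2) add_left_mono h_mono)
      finally show "Inf (w ` {n..}) z = w n z" .
    qed
    then show ?thesis using w(2)[OF that] by simp
  qed
  define H where "H y = (SUP n. v n y)" for y
  have H_mem: "H \<in> W"
    unfolding H_def[abs_def]
  proof (rule SUP_mem[OF v_mem])
    fix n y
    have "v n \<le> v (Suc n)"
      unfolding v_def using w(1) by (intro fine_lsc_regularization_mem_mono Inf_superset_mono image_mono) auto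
    then show "v n y \<le> v (Suc n) y" by (rule le_funD)
  qed
  have H_eq: "H y = s y + (SUP n. h n y)" if "y \<in> U" for y
    unfolding H_def by (simp add: v_eq[OF that] ennreal_SUP_add_right)
  define G where "G = fine_lsc_regularization W (Inf (range w'))"
  have G_mem: "G \<in> W" unfolding G_def using w'(1) by (intro B2) blast
  have G_eq: "G y = s y + (1 - (SUP n. h n y))" if "y \<in> U" for y
    unfolding G_def
  proof (rule fine_lsc_regularization_Inf_eq[OF _ _ _ that])
    let ?g = "\<lambda>y. s y + (1 - (SUP n. h n y))"
    show "range w' \<subseteq> W" using w'(1) by blast
    have t: "(\<lambda>y. s y + (s y + 1)) \<in> W" by (intro add_mem s one_mem)
    have "?g y = (s y + (s y + 1)) - H y" if "y \<in> U" for y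
      unfolding H_eq[OF that] by (rule add_complement_eq_diff[OF s(2)[OF that] H1[OF that]])
    then have set: "{z \<in> U. a < ?g z} = {z \<in> U. a < (s z + (s z + 1)) - H z}" for a by auto
    show "openin (fine_topology W) {z \<in> U. a < ?g z}" for a
      unfolding set
      by (rule openin_fine_topology_diff[OF t H_mem _ U]) (use s(2) in \<open>simp add: less_top[symmetric]\<close>)
    fix z assume z: "z \<in> U"
    have "Inf (range w') z = (INF n. s z + (1 - h n z))" using w'(2)[OF z] by (simp add: image_image)
    also have "\<dots> = s z + (INF n. 1 - h n z)" by (rule INF_ennreal_const_add)
    also have "(INF n. 1 - h n z) = 1 - (SUP n. h n z)" by (rule ennreal_SUP_const_minus) simp_all
    finally show "Inf (range w') z = ?g z" .
  qed
  show ?thesis unfolding complemented_on_def using H1 H_mem H_eq G_mem G_eq by blast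
qed

lemma complemented_on_INF:
  assumes U: "open U" and s: "s \<in> W" "\<And>y. y \<in> U \<Longrightarrow> s y < top"
    and h: "\<And>n::nat. complemented_on U s (h n)" and mono: "\<And>n y. y \<in> U \<Longrightarrow> h (Suc n) y \<le> h n y"
  shows "complemented_on U s (\<lambda>y. INF n. h n y)"
proof -
  have "complemented_on U s (\<lambda>y. SUP n. 1 - h n y)"
    using mono by (intro complemented_on_SUP U s complemented_on_complement h ennreal_minus_mono) simp_all
  also have "(\<lambda>y. SUP n. 1 - h n y) = (\<lambda>y. 1 - (INF n. h n y))" by (simp add: SUP_const_minus_ennreal)
  finally have "complemented_on U s (\<lambda>y. 1 - (1 - (INF n. h n y)))" by (rule complemented_on_complement)
  moreover have "1 - (1 - (INF n. h n y)) = (INF n. h n y)" if "y \<in> U" for y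
    using h[of 0] that by (intro one_diff_one_diff INF_lower2[of 0]) (simp_all add: complemented_on_def)
  ultimately show ?thesis
    using complemented_on_cong[of U "\<lambda>y. 1 - (1 - (INF n. h n y))" "\<lambda>y. INF n. h n y"] by blast
qed

lemma complemented_on_continuous:
  assumes U: "open U" and s: "continuous_on U s" "\<And>y. y \<in> U \<Longrightarrow> s y < top" and h: "complemented_on U s h"
  shows "continuous_on U h"
proof -
  obtain w where w: "w \<in> W" "\<And>y. y \<in> U \<Longrightarrow> w y = s y + h y" using h by (auto simp: complemented_on_def)
  obtain w' where w': "w' \<in> W" "\<And>y. y \<in> U \<Longrightarrow> w' y = s y + (1 - h y)" using h by (auto simp: complemented_on_def)
  have h1: "h y \<le> 1" if "y \<in> U" for y using h that by (simp add: complemented_on_def)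
  have h_fin: "h y < top" if "y \<in> U" for y using h1[OF that] by (rule le_less_trans) simp
  have "continuous_on U w"
  proof (rule continuous_on_summand[OF lsc[OF w(1)] lsc[OF w'(1)] _ U])
    show "continuous_on U (\<lambda>y. s y + (s y + 1))" by (intro continuous_on_add_ennreal continuous_on_const s)
    fix y assume y: "y \<in> U"
    have "h y + (1 - h y) = 1" using h1[OF y] by (simp add: add_diff_self_ennreal)
    then show "w y + w' y = s y + (s y + 1)"
      unfolding w(2)[OF y] w'(2)[OF y] by (metis add.assoc add.commute)
    show "s y + (s y + 1) < \<infinity>" using s(2)[OF y] by simp
  qed
  then have "continuous_on U (\<lambda>y. w y - s y)"
    using s(2) h_fin by (intro continuous_on_diff_ennreal s) (auto simp: w(2) less_top[symmetric])
  moreover have "w y - s y = h y" if "y \<in> U" for y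
    unfolding w(2)[OF that] using s(2)[OF that] by (simp add: less_top)
  ultimately show ?thesis by (simp cong: continuous_on_cong)
qed

text \<open>Only the case of \<open>1 - c\<close> needs an argument: \<open>min (s + 1) (t + c)\<close> equals \<open>t + c\<close> where \<open>t \<le> s\<close>, so the criterion
  \<open>diff_mem_of_fixed_by_reduction\<close> shows that \<open>min (s + 1 - c) t\<close> is in \<open>W\<close>. On \<open>U\<close> this is \<open>s + (1 - c)\<close>.\<close>

lemma complemented_on_fixed:
  assumes s: "s \<in> tame" and t: "t \<in> tame" and c: "c \<in> W" "\<And>y. c y \<le> 1"
    and fixed: "\<And>w y. w \<in> W \<Longrightarrow> (\<And>z. t z \<le> s z \<Longrightarrow> c z \<le> w z) \<Longrightarrow> c y \<le> w y"
    and U: "\<And>y. y \<in> U \<Longrightarrow> s y + 1 \<le> t y"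
  shows "complemented_on U (\<lambda>y. ennreal (s y)) c"
proof -
  let ?s = "\<lambda>y. ennreal (s y)" and ?t = "\<lambda>y. ennreal (t y)"
  let ?Y = "\<lambda>y. min (?s y + 1) (?t y + c y)"
  have c_fin: "c y < top" for y using c(2)[of y] by (rule le_less_trans) simp
  have "\<exists>r\<in>W. \<forall>y. ?Y y = r y + c y"
  proof (rule diff_mem_of_fixed_by_reduction[where A = "{z. t z \<le> s z}" and b = ?t])
    show "?Y \<in> W" by (intro min_mem add_mem one_mem c tameD(2) s t)
    show "?t \<in> W" by (intro tameD t)
    show "?Y y = ?t y + c y" if "y \<in> {z. t z \<le> s z}" for y
      using that c(2)[of y] by (intro min_absorb2 add_mono ennreal_leI) simp_all
    show "c y \<le> w y" if "w \<in> W" "\<And>z. z \<in> {z. t z \<le> s z} \<Longrightarrow> c z \<le> w z" for w y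
      by (rule fixed[OF that(1)]) (use that(2) in simp)
  qed (use c c_fin in simp_all)
  then obtain r where r: "r \<in> W" "\<And>y. ?Y y = r y + c y" by blast
  have "r y = ?s y + (1 - c y)" if y: "y \<in> U" for y
  proof -
    have "?s y + 1 = ennreal (s y + 1)" using tameD(1)[OF s] by simp
    also have "\<dots> \<le> ?t y" using U[OF y] by (rule ennreal_leI)
    also have "\<dots> \<le> ?t y + c y" by simp
    finally have "r y + c y = ?s y + 1" using r(2)[of y] by (simp add: min_absorb1)
    also have "\<dots> = (?s y + (1 - c y)) + c y"
      using c(2)[of y] by (simp add: add.assoc diff_add_cancel_ennreal)
    finally show ?thesis using c_fin[of y] by (intro ennreal_add_right_imp_eq[of "r y" "c y"]) (simp_all add: less_top)
  qed
  moreover have "(\<lambda>y. ?s y + c y) \<in> W" by (intro add_mem c tameD s)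
  ultimately show ?thesis
    unfolding complemented_on_def using c(2) r(1)
    by (intro conjI ballI bexI[of _ "\<lambda>y. ?s y + c y"] bexI[of _ r]) simp_all
qed

text \<open>The complement of an open \<open>H\<close> containing \<open>- V\<close> is a compact subset of \<open>V\<close>, on which functions increasing to
  \<open>u0\<close> on \<open>V\<close> eventually exceed \<open>u0 / 2\<close>.\<close>

lemma decreasing_open_neighbourhoods:
  assumes V: "open (V :: 'a set)" "compact (closure V)"
  obtains G where "\<And>k::nat. open (G k)" "\<And>k. - V \<subseteq> G k" "\<And>k. G (Suc k) \<subseteq> G k"
    "\<And>H. open H \<Longrightarrow> - V \<subseteq> H \<Longrightarrow> \<exists>k. G k \<subseteq> H"
proof -
  obtain F where F: "\<And>n::nat. F n \<in> tame_diff" "\<And>n x. 0 \<le> F n x" "\<And>n x. F n x \<le> u0 x"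
    "\<And>n x. F n x \<le> F (Suc n) x" "\<And>n x. x \<notin> V \<Longrightarrow> F n x = 0"
    "\<And>x. x \<in> V \<Longrightarrow> \<forall>\<^sub>F n in sequentially. F n x = u0 x"
    by (rule open_tame_diff_approximation[OF V(1)]) blast
  let ?G = "\<lambda>k. {y. F k y < u0 y / 2}" and ?C = "\<lambda>k. {y. u0 y / 2 < F k y}"
  have F_mono: "F m y \<le> F n y" if "m \<le> n" for m n y
    using lift_Suc_mono_le[of "\<lambda>n. F n y", OF F(4) that] .
  have u2: "continuous_on UNIV (\<lambda>y. u0 y / 2)" using u0_cont by (intro continuous_on_divide continuous_on_const) simp_all
  show ?thesis
  proof
    fix k
    show "open (?G k)" by (intro open_Collect_less tame_diff_continuous F u2)
    show "- V \<subseteq> ?G k" using F(5) u0_pos by auto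
    show "?G (Suc k) \<subseteq> ?G k" using le_less_trans[OF F(4)] by blast
  next
    fix H assume H: "open H" "- V \<subseteq> H"
    have "compact (closure V \<inter> - H)" using H(1) by (intro compact_Int_closed V(2)) (simp add: closed_Compl)
    moreover have "open (?C k)" for k by (intro open_Collect_less tame_diff_continuous F u2)
    moreover have "closure V \<inter> - H \<subseteq> (\<Union>k\<in>UNIV. ?C k)"
    proof
      fix y assume "y \<in> closure V \<inter> - H"
      then have "y \<in> V" using H(2) by blast
      from F(6)[OF this] obtain k where "F k y = u0 y" by (auto simp: eventually_sequentially)
      then have "u0 y / 2 < F k y" using u0_pos[of y] by simp
      then show "y \<in> (\<Union>k\<in>UNIV. ?C k)" by blast
    qed
    ultimately obtain J where J: "finite J" "closure V \<inter> - H \<subseteq> (\<Union>k\<in>J. ?C k)"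
      using compactE_image[of "closure V \<inter> - H" UNIV ?C] by metis
    obtain m where m: "\<And>j. j \<in> J \<Longrightarrow> j \<le> m" using finite_nat_set_iff_bounded_le[of J] J(1) by blast
    have "y \<in> H" if "F m y < u0 y / 2" for y
    proof (rule ccontr)
      assume "y \<notin> H"
      then have "y \<in> closure V \<inter> - H" using H(2) closure_subset by blast
      then obtain j where "j \<in> J" "u0 y / 2 < F j y" using J(2) by blast
      with F_mono[OF m, of j y] that show False by simp
    qed
    then show "\<exists>k. ?G k \<subseteq> H" by blast
  qed
qed

text \<open>Around a point of \<open>V\<close> choose tame \<open>s\<close>, \<open>t\<close> with \<open>t \<ge> s + 1\<close> near the point and \<open>t \<le> s\<close> on an open set containing
  \<open>- V\<close>. If \<open>G\<close> is a small open set containing \<open>- V\<close>, then \<open>R\<^sub>p\<^sup>G\<close> is in \<open>W\<close> and determined by its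
  values on \<open>{t \<le> s}\<close>, so it is complemented. Being complemented is inherited by the infimum over \<open>G\<close>, which for
  tame \<open>p\<close> is the reduction on \<open>- V\<close>, and then by the supremum over tame functions increasing to \<open>p\<close>.\<close>

lemma continuous_on_reduced_complement:
  assumes p: "p \<in> W" "\<And>y. p y \<le> 1" and V: "open V" "compact (closure V)"
  shows "continuous_on V (reduced W p (- V))"
proof -
  have "\<exists>U. open U \<and> x \<in> U \<and> continuous_on U (reduced W p (- V))" if x: "x \<in> V" for x
  proof -
    obtain d where d: "d \<in> tame_diff" "0 < d x" "\<And>y. 0 \<le> d y" "\<And>y. y \<notin> V \<Longrightarrow> d y = 0"
      by (rule tame_diff_bump[OF V(1) x]) blast
    obtain p1 p2 where p12: "p1 \<in> tame" "p2 \<in> tame" "d = (\<lambda>x. p1 x - p2 x)" using d(1) by (rule tame_diffE)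
    define \<eta> where "\<eta> = d x / (2 * u0 x)"
    have \<eta>: "0 < \<eta>" "\<eta> * u0 x = d x / 2" using d(2) u0_pos[of x] by (simp_all add: \<eta>_def)
    \<comment> \<open>With these constants \<open>t - s = k * (d - \<eta> * u0)\<close>, which equals \<open>2\<close> at \<open>x\<close>.\<close>
    define k where "k = 4 / d x"
    have k: "0 < k" "k * d x = 4" using d(2) by (simp_all add: k_def)
    define s where "s y = k * (p2 y + \<eta> * u0 y)" for y
    define t where "t y = k * p1 y" for y
    have s: "s \<in> tame" unfolding s_def[abs_def] using k(1) \<eta>(1) by (intro tame_scale tame_add p12 u0_tame) simp_all
    have t: "t \<in> tame" unfolding t_def[abs_def] using k(1) by (intro tame_scale p12) simp_all
    have ts: "t y - s y = k * (d y - \<eta> * u0 y)" for y by (simp add: s_def t_def p12(3) algebra_simps)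
    define U where "U = {y. s y + 1 < t y}"
    have U: "open U" unfolding U_def by (intro open_Collect_less continuous_on_add continuous_on_const tameD s t)
    have "t x - s x = 2" unfolding ts \<eta>(2) using k(2) by (simp add: right_diff_distrib)
    then have xU: "x \<in> U" by (simp add: U_def)
    let ?H = "{y. d y < \<eta> * u0 y}"
    have H: "open ?H" by (intro open_Collect_less tame_diff_continuous d continuous_on_mult_left u0_cont)
    have VH: "- V \<subseteq> ?H" using d(4) \<eta>(1) u0_pos by auto
    have H_ts: "t y \<le> s y" if "y \<in> ?H" for y
    proof -
      have "k * (d y - \<eta> * u0 y) \<le> 0" using that k(1) by (simp add: mult_le_0_iff)
      then show ?thesis using ts[of y] by simp
    qed
    obtain G where G: "\<And>k::nat. open (G k)" "\<And>k. - V \<subseteq> G k" "\<And>k. G (Suc k) \<subseteq> G k"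
      "\<And>H. open H \<Longrightarrow> - V \<subseteq> H \<Longrightarrow> \<exists>k. G k \<subseteq> H"
      by (rule decreasing_open_neighbourhoods[OF V]) blast
    obtain k0 where k0: "G k0 \<subseteq> ?H" using G(4)[OF H VH] by blast
    have G_mono: "G n \<subseteq> G m" if "m \<le> n" for m n
      using lift_Suc_antimono_le[of G, OF G(3) that] .
    let ?s = "\<lambda>y. ennreal (s y)"
    have s_W: "?s \<in> W" by (intro tameD s)
    have open_case: "complemented_on U ?s (reduced W q (G (k + k0)))" if q: "q \<in> W" "\<And>y. q y \<le> 1" for q k
    proof (rule complemented_on_fixed[OF s t])
      show "reduced W q (G (k + k0)) \<in> W" by (intro reduced_open_mem q G)
      show "reduced W q (G (k + k0)) y \<le> 1" for y by (rule reduced_lower[OF one_mem q(2)])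
      show "s y + 1 \<le> t y" if "y \<in> U" for y using that by (simp add: U_def)
      fix w y assume w: "w \<in> W" "\<And>z. t z \<le> s z \<Longrightarrow> reduced W q (G (k + k0)) z \<le> w z"
      show "reduced W q (G (k + k0)) y \<le> w y"
      proof (rule reduced_lower[OF w(1)])
        fix z assume z: "z \<in> G (k + k0)"
        then have "z \<in> ?H" using G_mono[of k0 "k + k0"] k0 by auto
        then have "reduced W q (G (k + k0)) z \<le> w z" by (intro w H_ts)
        with reduced_upper[OF z, of q W] show "q z \<le> w z" by (rule order_trans)
      qed
    qed
    have tame_case: "complemented_on U ?s (reduced W (\<lambda>y. ennreal (q y)) (- V))"
      if q: "q \<in> tame" "\<And>y. q y \<le> 1" for q
    proof -
      let ?q = "\<lambda>y. ennreal (q y)"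
      have "complemented_on U ?s (\<lambda>y. INF k. reduced W ?q (G (k + k0)) y)"
      proof (rule complemented_on_INF[OF U s_W])
        show "complemented_on U ?s (reduced W ?q (G (k + k0)))" for k
          using q by (intro open_case tameD) (simp_all add: ennreal_le_1)
        show "reduced W ?q (G (Suc k + k0)) y \<le> reduced W ?q (G (k + k0)) y" for k y
          by (intro reduced_mono G_mono order_refl) simp
      qed simp
      moreover have "(INF k. reduced W ?q (G (k + k0)) y) = reduced W ?q (- V) y" for y
      proof (rule antisym)
        show "reduced W ?q (- V) y \<le> (INF k. reduced W ?q (G (k + k0)) y)"
          by (intro INF_greatest reduced_mono G order_refl)
        show "(INF k. reduced W ?q (G (k + k0)) y) \<le> reduced W ?q (- V) y"
        proof (rule ennreal_le_epsilon)
          fix e :: real assume "0 < e"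
          then obtain H' where H': "open H'" "- V \<subseteq> H'" "reduced W ?q H' y \<le> reduced W ?q (- V) y + ennreal e"
            by (rule reduced_open_approximation[OF q(1), where A = "- V" and x = y]) blast
          obtain j where j: "G j \<subseteq> H'" using G(4)[OF H'(1,2)] by blast
          have "(INF k. reduced W ?q (G (k + k0)) y) \<le> reduced W ?q (G (j + k0)) y" by (rule INF_lower) simp
          also have "\<dots> \<le> reduced W ?q H' y" using G_mono[of j "j + k0"] j by (intro reduced_mono order_refl) auto
          also note H'(3)
          finally show "(INF k. reduced W ?q (G (k + k0)) y) \<le> reduced W ?q (- V) y + ennreal e" .
        qed
      qed
      ultimately show ?thesis by simp
    qed
    obtain q where q: "\<And>n::nat. q n \<in> tame" "\<And>n y. q n y \<le> q (Suc n) y"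
      "\<And>y. p y = (SUP n. ennreal (q n y))" by (rule increasing_tame_approximation[OF p(1)]) blast
    have q1: "q n y \<le> 1" for n y
    proof -
      have "ennreal (q n y) \<le> p y" unfolding q(3) by (rule SUP_upper) simp
      then have "ennreal (q n y) \<le> 1" using p(2) by (rule order_trans)
      then show ?thesis by (simp add: ennreal_le_1)
    qed
    have "complemented_on U ?s (\<lambda>y. SUP n. reduced W (\<lambda>y. ennreal (q n y)) (- V) y)"
      using q(2) by (intro complemented_on_SUP U s_W tame_case q q1 reduced_mono ennreal_leI) simp_all
    moreover have "reduced W p (- V) = (\<lambda>y. SUP n. reduced W (\<lambda>y. ennreal (q n y)) (- V) y)"
      by (rule ext) (rule reduced_SUP[OF q])
    ultimately have compl: "complemented_on U ?s (reduced W p (- V))" by simp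
    have "continuous_on U ?s" by (rule continuous_on_subset[OF continuous_on_ennreal[OF tameD(3)[OF s]]]) simp
    then have "continuous_on U (reduced W p (- V))"
      by (rule complemented_on_continuous[OF U _ _ compl]) simp
    with U xU show ?thesis by blast
  qed
  then have "isCont (reduced W p (- V)) x" if "x \<in> V" for x
    using that by (metis continuous_on_eq_continuous_at)
  then show ?thesis by (simp add: continuous_at_imp_continuous_on)
qed

end

section \<open>Avoidable and unavoidable sets\<close>

text \<open>The lower limit is the largest lower semicontinuous minorant of the reduced function. It equals the fine
  regularization, as the latter is in \<open>W\<close> and so lower semicontinuous.\<close>

lemma (in balayage_space) regularized_reduced_mem: "regularized_reduced W u A \<in> W"
  and regularized_reduced_le: "regularized_reduced W u A x \<le> reduced W u A x"
proof -
  let ?R = "reduced W u A" and ?g = "regularized_reduced W u A"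
  let ?f = "fine_lsc_regularization W ?R"
  have f: "?f \<in> W" unfolding reduced_def by (rule B2) blast
  have fR: "?f x \<le> ?R x" for x using fine_lsc_regularization_le[of W ?R] by (rule le_funD)
  have gR: "?g x \<le> ?R x" for x
  proof (rule dense_le)
    fix a assume "a < ?g x"
    then have "eventually (\<lambda>y. a < ?R y) (nhds x)"
      using le_Liminf_iff[of "?g x" "nhds x" ?R] by (simp add: regularized_reduced_def)
    then show "a \<le> ?R x" by (intro less_imp_le) (rule eventually_nhds_x_imp_x)
  qed
  have "lower_semicontinuous euclidean ?g"
    unfolding lower_semicontinuous_euclidean
  proof
    fix a
    show "open {x. a < ?g x}"
    proof (subst open_subopen, rule ballI)
      fix x assume "x \<in> {x. a < ?g x}"
      then obtain b where b: "a < b" "b < ?g x" using dense by blast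
      then have "eventually (\<lambda>y. b < ?R y) (nhds x)"
        using le_Liminf_iff[of "?g x" "nhds x" ?R] by (simp add: regularized_reduced_def)
      then obtain S where S: "open S" "x \<in> S" "\<And>y. y \<in> S \<Longrightarrow> b < ?R y" by (auto simp: eventually_nhds)
      have "b \<le> ?g y" if "y \<in> S" for y
        unfolding regularized_reduced_def
      proof (rule Liminf_bounded)
        show "eventually (\<lambda>z. b \<le> ?R z) (nhds y)"
          using S that by (auto simp: eventually_nhds intro!: exI[of _ S] less_imp_le)
      qed
      then have "S \<subseteq> {x. a < ?g x}" using b(1) by (auto intro: less_le_trans)
      with S show "\<exists>T. open T \<and> x \<in> T \<and> T \<subseteq> {x. a < ?g x}" by blast
    qed
  qed
  then have "?g \<le> ?f" using gR by (intro fine_lsc_regularization_greatest finely_lower_semicontinuous) (auto simp: le_fun_def)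
  moreover have "?f \<le> ?g"
  proof (rule le_funI)
    fix x
    show "?f x \<le> ?g x"
      unfolding regularized_reduced_def le_Liminf_iff
    proof (intro allI impI)
      fix a assume a: "a < ?f x"
      have "open {y. a < ?f y}" using lsc[OF f] by (simp add: lower_semicontinuous_euclidean)
      then have "eventually (\<lambda>y. y \<in> {y. a < ?f y}) (nhds x)" using a by (intro eventually_nhds_in_open) simp_all
      then show "eventually (\<lambda>y. a < ?R y) (nhds x)"
        by eventually_elim (use fR less_le_trans in blast)
    qed
  qed
  ultimately show "?g \<in> W" using f by (metis antisym)
  show "?g x \<le> ?R x" by (rule gR)
qed

context unit_harmonic_balayage_space
begin

lemma reduced_one_le: "reduced W (\<lambda>_. 1) A x \<le> 1"
  by (rule reduced_lower[OF one_mem]) simp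

lemma unavoidable_or_INF_eq_0:
  "unavoidable W A \<or> (INF x. reduced W (\<lambda>_. 1) A x) = 0"
proof (rule ccontr)
  let ?R = "reduced W (\<lambda>_. 1) A"
  assume "\<not> ?thesis"
  then obtain x where x: "?R x \<noteq> 1" and INF: "(INF x. ?R x) \<noteq> 0" by (auto simp: unavoidable_def)
  then have x1: "?R x < 1" using reduced_one_le[of A x] by simp
  have "(INF x. ?R x) \<le> ?R x" by (rule INF_lower) simp
  with x1 have INF1: "(INF x. ?R x) < 1" by (rule le_less_trans[rotated])
  define c where "c = enn2real (INF x. ?R x)"
  have "(INF x. ?R x) < top" using INF1 ennreal_one_less_top by (rule less_trans)
  then have c_eq: "ennreal c = (INF x. ?R x)" unfolding c_def by (rule ennreal_enn2real)
  have c0: "0 < c" using INF c_eq by (metis c_def enn2real_nonneg ennreal_0 le_less)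
  have c1: "c < 1" using INF1 c_eq by (metis ennreal_less_one_iff)
  have c_le: "ennreal c \<le> ?R y" for y unfolding c_eq by (rule INF_lower) simp
  have "ennreal (1 - c) * ?R x + ennreal c \<le> ?R x"
  proof (rule reduced_greatest)
    fix w assume w: "w \<in> W" "\<forall>y\<in>A. 1 \<le> w y"
    have wR: "?R y \<le> w y" for y using w by (intro reduced_lower) simp_all
    obtain g where g: "g \<in> W" "\<And>y. w y = g y + ennreal c"
      using subtract_const_mem[OF w(1), of c] c0 order_trans[OF c_le wR] by auto
    have "ennreal (1 - c) \<le> g y" if "y \<in> A" for y
    proof -
      have "ennreal (1 - c) + ennreal c = 1" using c0 c1 by (subst ennreal_plus[symmetric]) simp_all
      also have "\<dots> \<le> g y + ennreal c" unfolding g(2)[symmetric] using w(2) that by (rule bspec)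
      finally show ?thesis by (simp add: add.commute[of _ "ennreal c"] ennreal_add_left_cancel_le)
    qed
    then have "reduced W (\<lambda>y. ennreal (1 - c) * 1) A x \<le> g x" using g(1) by (intro reduced_lower) simp_all
    then have "ennreal (1 - c) * ?R x \<le> g x" using c1 by (subst (asm) reduced_scale) simp_all
    then show "ennreal (1 - c) * ?R x + ennreal c \<le> w x" unfolding g(2) by (rule add_right_mono)
  qed
  moreover obtain r where r: "?R x = ennreal r" "0 \<le> r" using x1 by (cases "?R x") auto
  ultimately have "ennreal ((1 - c) * r + c) \<le> ennreal r" using c0 c1 by (simp add: ennreal_mult)
  then have "(1 - c) * r + c \<le> r" using r(2) by (simp add: ennreal_le_iff)
  then have "c * 1 \<le> c * r" by (simp add: algebra_simps)
  then have "1 \<le> r" using c0 by (simp only: mult_le_cancel_left_pos)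
  with x1 r(1) show False by simp
qed

lemma unavoidable_of_reduced_ge:
  assumes A: "unavoidable W A" and k: "0 < k" and B: "\<And>x. x \<in> A \<Longrightarrow> ennreal k \<le> reduced W (\<lambda>_. 1) B x"
  shows "unavoidable W B"
proof -
  have "ennreal k \<le> reduced W (\<lambda>_. 1) B x" for x
  proof (rule reduced_greatest)
    fix w assume w: "w \<in> W" "\<forall>y\<in>B. 1 \<le> w y"
    have "reduced W (\<lambda>_. 1) B y \<le> w y" for y using w by (intro reduced_lower) simp_all
    then have "reduced W (\<lambda>y. ennreal k * 1) A x \<le> w x"
      using B by (intro reduced_lower w) (auto intro: order_trans)
    then show "ennreal k \<le> w x"
      using A k by (subst (asm) reduced_scale) (simp_all add: unavoidable_def)
  qed
  then have "ennreal k \<le> (INF x. reduced W (\<lambda>_. 1) B x)" by (rule INF_greatest)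
  then have "(INF x. reduced W (\<lambda>_. 1) B x) \<noteq> 0" using k by auto
  then show ?thesis using unavoidable_or_INF_eq_0 by blast
qed

lemma superharmonic_le_one:
  assumes p: "p \<in> W" "\<And>y. p y \<le> 1"
  shows "superharmonic W p"
  unfolding superharmonic_def swept_measure(2)[OF p(1)]
proof (intro conjI allI impI ballI p continuous_on_reduced_complement)
  fix V x
  have "reduced W p (- V) x \<le> 1" by (rule reduced_lower[OF one_mem p(2)])
  then show "reduced W p (- V) x < \<infinity>" by (rule le_less_trans) simp
qed

lemma avoidable_iff_potential:
  assumes L: "liouville_property W"
  shows "avoidable W A \<longleftrightarrow> potential W (regularized_reduced W (\<lambda>_. 1) A)"
proof
  let ?R = "reduced W (\<lambda>_. 1) A" and ?g = "regularized_reduced W (\<lambda>_. 1) A"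
  have gR: "?g x \<le> ?R x" for x by (rule regularized_reduced_le)
  have g1: "?g x \<le> 1" for x using gR reduced_one_le by (rule order_trans)
  {
    assume "avoidable W A"
    then have INF: "(INF x. ?R x) = 0" using unavoidable_or_INF_eq_0 by blast
    show "potential W ?g"
      unfolding potential_def
    proof (intro conjI allI impI)
      show "superharmonic W ?g" using regularized_reduced_mem g1 by (rule superharmonic_le_one)
      fix h x assume h: "harmonic W h \<and> (\<forall>x. 0 \<le> h x \<and> ennreal (h x) \<le> ?g x)"
      have h_le: "ennreal (h y) \<le> ?g y" and h0: "0 \<le> h y" for y using h by simp_all
      have "h y \<le> 1" for y using order_trans[OF h_le g1, of y] by (simp add: ennreal_le_1)
      then have "bounded (range h)" using h0 by (intro boundedI[of _ 1]) auto
      then obtain c where c: "\<And>x. h x = c" using L h unfolding liouville_property_def by blast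
      have "ennreal c \<le> (INF x. ?R x)"
      proof (rule INF_greatest)
        fix y show "ennreal c \<le> ?R y" using order_trans[OF h_le gR, of y] c by simp
      qed
      then show "h x = 0" using INF h0[of x] c by (simp add: ennreal_eq_0_iff)
    qed
  }
  {
    assume pot: "potential W ?g"
    show "avoidable W A"
    proof
      assume "unavoidable W A"
      then have "?R = (\<lambda>_. 1)" by (simp add: unavoidable_def fun_eq_iff)
      then have "?g x = 1" for x by (simp add: regularized_reduced_def Liminf_const)
      then have "\<forall>x::'a. (1::real) = 0" using pot harmonic_one unfolding potential_def by (metis ennreal_1 order_refl zero_le_one)
      then show False by simp
    qed
  }
qed

text \<open>Sweeping does not increase \<open>u\<close> and \<open>v\<close> but preserves their sum.\<close>

lemma harmonic_summand_of_one:
  assumes u: "u \<in> W" and v: "v \<in> W" and sum: "\<And>x. u x + v x = 1"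
  shows "harmonic W (\<lambda>x. enn2real (u x))" and "u x \<le> 1"
proof -
  have u1: "u x \<le> 1" and v1: "v x \<le> 1" for x using sum[of x] by (metis le_iff_add add.commute)+
  show "u x \<le> 1" by (rule u1)
  have fin: "u x < top" "v x < top" for x using le_less_trans[OF u1] le_less_trans[OF v1] by simp_all
  show "harmonic W (\<lambda>x. enn2real (u x))"
    unfolding harmonic_on_def
  proof (intro conjI allI impI ballI)
    have "continuous_on UNIV u"
      by (rule continuous_on_summand[OF lsc[OF u] lsc[OF v] continuous_on_const[of _ 1]]) (simp_all add: sum)
    then show "continuous_on UNIV (\<lambda>x. enn2real (u x))" using fin(1) by (intro continuous_on_enn2real)
    fix V :: "'a set" and x assume V: "open V" "compact (closure V)" and x: "x \<in> V"
    let ?\<mu> = "swept_measure W x (- V)"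
    have M: "sets ?\<mu> = sets borel" by (rule swept_measure)
    have meas: "w \<in> borel_measurable ?\<mu>" if "w \<in> W" for w
      unfolding measurable_cong_sets[OF M refl] using that by (rule measurable_W)
    have iu: "(\<integral>\<^sup>+y. u y \<partial>?\<mu>) \<le> u x" unfolding swept_measure(2)[OF u] by (rule reduced_lower[OF u]) simp
    have iv: "(\<integral>\<^sup>+y. v y \<partial>?\<mu>) \<le> v x" unfolding swept_measure(2)[OF v] by (rule reduced_lower[OF v]) simp
    have "(\<integral>\<^sup>+y. u y \<partial>?\<mu>) + (\<integral>\<^sup>+y. v y \<partial>?\<mu>) = (\<integral>\<^sup>+y. u y + v y \<partial>?\<mu>)"
      by (intro nn_integral_add[symmetric] meas u v)
    also have "\<dots> = (\<integral>\<^sup>+y. 1 \<partial>?\<mu>)" by (simp only: sum)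
    also have "\<dots> = u x + v x" unfolding sum by (rule swept_measure_total[OF V x])
    finally have "u x + v x = (\<integral>\<^sup>+y. u y \<partial>?\<mu>) + (\<integral>\<^sup>+y. v y \<partial>?\<mu>)" ..
    also have "\<dots> \<le> (\<integral>\<^sup>+y. u y \<partial>?\<mu>) + v x" using iv by (rule add_left_mono)
    finally have "u x \<le> (\<integral>\<^sup>+y. u y \<partial>?\<mu>)"
      using fin(2)[of x, THEN less_imp_neq] by (simp add: add.commute[of _ "v x"] ennreal_add_left_cancel_le)
    with iu have eq: "(\<integral>\<^sup>+y. u y \<partial>?\<mu>) = u x" by (rule antisym)
    have eq': "(\<integral>\<^sup>+y. ennreal (enn2real (u y)) \<partial>?\<mu>) = ennreal (enn2real (u x))"
      using fin(1) by (simp add: eq)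
    have meas': "(\<lambda>y. enn2real (u y)) \<in> borel_measurable ?\<mu>"
      using meas[OF u] by measurable
    show "integrable ?\<mu> (\<lambda>y. enn2real (u y))"
      by (rule integrableI_nonneg[OF meas']) (simp_all add: eq')
    show "(\<integral>y. enn2real (u y) \<partial>?\<mu>) = enn2real (u x)"
      using eq' meas' by (subst integral_eq_nn_integral) simp_all
  qed
qed

lemma avoidable_Un_iff:
  assumes L: "liouville_property W"
  shows "avoidable W (A \<union> B) \<longleftrightarrow> avoidable W A \<and> avoidable W B"
proof
  have mono: "unavoidable W D" if "unavoidable W C" "C \<subseteq> D" for C D
  proof -
    have "1 \<le> reduced W (\<lambda>_. 1) D x" for x
      using that reduced_mono[of C D "\<lambda>_. 1" "\<lambda>_. 1" W x] by (simp add: unavoidable_def)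
    then show ?thesis unfolding unavoidable_def using reduced_one_le by (blast intro: antisym)
  qed
  show "avoidable W (A \<union> B) \<Longrightarrow> avoidable W A \<and> avoidable W B" using mono[of A "A \<union> B"] mono[of B "A \<union> B"] by blast
  assume AB: "avoidable W A \<and> avoidable W B"
  have half: "\<exists>w\<in>W. (\<forall>y\<in>C. 1 \<le> w y) \<and> (\<exists>x. w x < ennreal (1/2))" if "avoidable W C" for C
  proof -
    have "(INF x. reduced W (\<lambda>_. 1) C x) = 0" using that unavoidable_or_INF_eq_0 by blast
    moreover have "0 < ennreal (1/2)" by (rule ennreal_less_zero_iff[THEN iffD2]) simp
    ultimately have "(INF x. reduced W (\<lambda>_. 1) C x) < ennreal (1/2)" by (simp only:)
    then obtain x where x: "reduced W (\<lambda>_. 1) C x < ennreal (1/2)" unfolding INF_less_iff by blast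
    obtain w where "w \<in> W" "\<And>y. y \<in> C \<Longrightarrow> 1 \<le> w y" "w x < ennreal (1/2)"
      using x by (rule reduced_lessE) blast
    then show ?thesis by blast
  qed
  obtain w1 a where w1: "w1 \<in> W" "\<And>y. y \<in> A \<Longrightarrow> 1 \<le> w1 y" "w1 a < ennreal (1/2)" using half AB by blast
  obtain w2 b where w2: "w2 \<in> W" "\<And>y. y \<in> B \<Longrightarrow> 1 \<le> w2 y" "w2 b < ennreal (1/2)" using half AB by blast
  show "avoidable W (A \<union> B)"
  proof
    assume un: "unavoidable W (A \<union> B)"
    have "1 \<le> w1 x + w2 x" for x
    proof -
      have "1 \<le> w1 y + w2 y" if "y \<in> A \<union> B" for y
        using that w1(2)[of y] w2(2)[of y] by (auto intro: add_increasing add_increasing2)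
      then have "reduced W (\<lambda>_. 1) (A \<union> B) x \<le> w1 x + w2 x" by (intro reduced_lower[where w = "\<lambda>x. w1 x + w2 x"] add_mem w1 w2)
      then show ?thesis using un by (simp add: unavoidable_def)
    qed
    from B3[OF one_mem w1(1) w2(1) this] obtain u v where u: "u \<in> W" "u \<le> w1" and v: "v \<in> W" "v \<le> w2"
      and sum: "\<And>x. 1 = u x + v x" by blast
    have const: "\<exists>c. \<forall>x. enn2real (h x) = c" if h: "h \<in> W" "k \<in> W" "\<And>x. h x + k x = 1" for h k
    proof -
      have "enn2real (h x) \<le> 1" for x using harmonic_summand_of_one(2)[OF h, of x] by (intro enn2real_leI) simp_all
      then have "bounded (range (\<lambda>x. enn2real (h x)))" by (intro boundedI[of _ 1]) auto
      with L harmonic_summand_of_one(1)[OF h] show ?thesis unfolding liouville_property_def by blast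
    qed
    have fin: "u x < top" "v x < top" for x
      using harmonic_summand_of_one(2)[OF u(1) v(1) sum[symmetric], of x]
        harmonic_summand_of_one(2)[OF v(1) u(1), of x] sum by (auto simp: add.commute intro: le_less_trans)
    have uv: "enn2real (u x) + enn2real (v x) = 1" for x
    proof -
      have "ennreal (enn2real (u x) + enn2real (v x)) = ennreal 1"
        using sum[of x] fin by simp
      then show ?thesis by (subst (asm) ennreal_inj) simp_all
    qed
    obtain c where c: "\<And>x. enn2real (u x) = c" using const[OF u(1) v(1) sum[symmetric]] by blast
    have "enn2real (u a) < 1/2"
      by (rule enn2real_less_iff[OF fin(1), THEN iffD2, OF le_less_trans[OF le_funD[OF u(2)] w1(3)]])
    moreover have "enn2real (v b) < 1/2"
      by (rule enn2real_less_iff[OF fin(2), THEN iffD2, OF le_less_trans[OF le_funD[OF v(2)] w2(3)]])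
    ultimately show False using uv[of b] c[of a] c[of b] by simp
  qed
qed

end

theorem proposition2p3:
  fixes W :: "('a::{t2_space, second_countable_topology} \<Rightarrow> ennreal) set"
    and A B :: "'a set"
  assumes "balayage_space W"
    and "harmonic W (\<lambda>_. 1)"
  shows "(unavoidable W A \<or> (INF x. reduced W (\<lambda>_. 1) A x) = 0) \<and>
    (\<forall>\<kappa>::real. unavoidable W A \<and> \<kappa> > 0 \<and> (\<forall>x\<in>A. ennreal \<kappa> \<le> reduced W (\<lambda>_. 1) B x)
       \<longrightarrow> unavoidable W B) \<and>
    (liouville_property W \<longrightarrow>
       (avoidable W A \<longleftrightarrow> potential W (regularized_reduced W (\<lambda>_. 1) A)) \<and>
       (avoidable W (A \<union> B) \<longleftrightarrow> avoidable W A \<and> avoidable W B))"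
proof -
  obtain u0 v0 where "weighted_balayage_space W u0 v0"
    using balayage_space.exists_weights[OF assms(1)] by blast
  then interpret unit_harmonic_balayage_space W u0 v0
    using assms(2) by (intro unit_harmonic_balayage_space.intro unit_harmonic_balayage_space_axioms.intro)
  show ?thesis
  proof (intro conjI allI impI)
    show "unavoidable W A \<or> (INF x. reduced W (\<lambda>_. 1) A x) = 0" by (rule unavoidable_or_INF_eq_0)
    show "unavoidable W B"
      if "unavoidable W A \<and> \<kappa> > 0 \<and> (\<forall>x\<in>A. ennreal \<kappa> \<le> reduced W (\<lambda>_. 1) B x)" for \<kappa> :: real
      using that by (intro unavoidable_of_reduced_ge[of A \<kappa> B]) simp_all
    assume L: "liouville_property W"
    show "avoidable W A \<longleftrightarrow> potential W (regularized_reduced W (\<lambda>_. 1) A)"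
      by (rule avoidable_iff_potential[OF L])
    show "avoidable W (A \<union> B) \<longleftrightarrow> avoidable W A \<and> avoidable W B"
      by (rule avoidable_Un_iff[OF L])
  qed
qed

end
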